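(* Let $R$ be a unital topological ring and let $\pi\colon\Lambda\to\Gamma$ be a continuous $R$-bundle, where $\Gamma$ is étale and locally $R$-normal. Suppose that $\Gamma$ is graded over a discrete groupoid $G$ via a continuous homomorphism $d\colon\Gamma\to G$. Then there exists a $G$-graded isomorphism of algebras \[T\colon\mathcal{A}(\pi)\# G\to\mathcal{A}(\pi\#_d G)\] given by \[T(\alpha\delta_g)(\gamma,h)=\begin{cases}(\alpha(\gamma),g),&\text{if }g=h,\\(0_\gamma,h),&\text{otherwise},\end{cases}\] for all $g\in G$, all $\alpha\in\sum\{\mathcal{A}(\pi)_k:k\in G,\ \mathfrak{s}(k)=\mathfrak{r}(g)\}$, and all $(\gamma,h)\in\Gamma\#_d G$.
   Context: A space has a property "locally" if every point has a neighbourhood basis (neighbourhoods not necessarily open) of subsets having that property in the subspace topology. A space $X$ is $R$-normal if for any disjoint closed $A,B\subseteq X$ there is a continuous $f\colon X\to R$ with $f=0$ on $A$, $f=1$ on $B$. A semigroupoid $\Lambda$ is a directed graph with vertex set $\Lambda^{(0)}$, source and range maps $\mathfrak{s},\mathfrak{r}\colon\Lambda\to\Lambda^{(0)}$, and an associative product $\Lambda^{(2)}=\{(a,b):\mathfrak{s}(a)=\mathfrak{r}(b)\}\to\Lambda$ with $\mathfrak{s}(ab)=\mathfrak{s}(b)$, $\mathfrak{r}(ab)=\mathfrak{r}(a)$ (groupoids are examples). A homomorphism $\phi$ satisfies: $(a,b)$ composable implies $(\phi(a),\phi(b))$ composable and $\phi(ab)=\phi(a)\phi(b)$; it is rigid if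 conversely $(\phi(a),\phi(b))$ composable implies $(a,b)$ composable. Topological semigroupoid: $\mathfrak{s},\mathfrak{r}$ and product continuous. Étale: $\mathfrak{s},\mathfrak{r}$ are local homeomorphisms and $\Lambda^{(0)}$ is locally compact Hausdorff. An $R$-bundle is a rigid semigroupoid homomorphism $\pi\colon\Lambda\to\Gamma$ with an $R$-bimodule structure on each fiber $\pi^{-1}(\gamma)$, $\gamma\in\Gamma$, such that for $(\gamma_1,\gamma_2)\in\Gamma^{(2)}$ the product $\pi^{-1}(\gamma_1)\times\pi^{-1}(\gamma_2)\to\pi^{-1}(\gamma_1\gamma_2)$ is biadditive, satisfies $(xr)y=x(ry)$, and induces an $R$-bimodule homomorphism on $\pi^{-1}(\gamma_1)\otimes_R\pi^{-1}(\gamma_2)$. $0_\gamma$ is the zero of $\pi^{-1}(\gamma)$. The bundle is continuous if $\Lambda,\Gamma$ are topological semigroupoids and $\pi$, the fiberwise addition, the left and right scalar multiplications, and $\gamma\mapsto0_\gamma$ are continuous. A section of $\pi$ is a map $\alpha\colon\Gamma\to\Lambda$ with $\pi\circ\alpha=\mathrm{id}_\Gamma$; $\operatorname{supp}(\alpha)$ is the closure of $\{\gamma:\alpha(\gamma)\ne0_\gamma\}$. For $V\subseteq\Gamma$ open, $C_c(V,\pi)$ is the set of sections that are zero outside $V$, continuous on $V$, with $\operatorname{supp}(\alpha)\cap V$ compact. For $\Gamma$ étale and locally $R$-normal, the sectional algebra $\mathcal{A}(\pi)$ is the $R$-bimodule (pointwise operations) generated by all $C_c(V,\pi)$, $V$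 open Hausdorff, with product $(\alpha\ast\beta)(\gamma)=\sum_{ab=\gamma}\alpha(a)\beta(b)$. An algebra $A$ is graded by a discrete semigroupoid $G$ if $A=\bigoplus_{g\in G}A_g$ for sub-bimodules $A_g$ with $A_gA_h\subseteq A_{gh}$ if $(g,h)\in G^{(2)}$ and $A_gA_h=0$ otherwise. A graded isomorphism is a bijective algebra homomorphism mapping each homogeneous component of index $g$ into the one of index $g$. If $c\colon\Gamma\to G$ is a continuous homomorphism (a "grading" of $\Gamma$), $\mathcal{A}(\pi)$ is $G$-graded with $\mathcal{A}(\pi)_g$ the additive span of all $C_c(U,\pi)$ with $U$ open Hausdorff, $U\subseteq c^{-1}(g)$. Smash product: if $A=\bigoplus_{g\in G}A_g$ is graded over a discrete groupoid $G$, with projections $p_g\colon A\to A_g$, then $A\#G$ is the set of finite formal sums $\sum_{g\in G}a_g\delta_g$ with $a_g\in\sum\{A_h:\mathfrak{s}(h)=\mathfrak{r}(g)\}$, with entrywise bimodule structure and product extending $(a\delta_g)(b\delta_h)=a\,p_{gh^{-1}}(b)\,\delta_h$ if $\mathfrak{s}(g)=\mathfrak{s}(h)$ and $0$ otherwise. It is $G$-graded with $(A\#G)_g=\sum\{A_g\delta_h:h\in G,\mathfrak{r}(h)=\mathfrak{s}(g)\}$. Skew product: for a homomorphism $d\colon\Gamma\to G$ to a discrete groupoid, $\Gamma\#_dG=\{(\gamma,g)\in\Gamma\times G:\mathfrak{s}(d(\gamma))=\mathfrak{r}(g)\}$ with vertex set $\Gamma^{(0)}\times G$, $\mathfrak{s}(\gamma,g)=(\mathfrak{s}(\gamma),g)$,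 $\mathfrak{r}(\gamma,g)=(\mathfrak{r}(\gamma),d(\gamma)g)$ and $(\gamma_1,g_1)(\gamma_2,g_2)=(\gamma_1\gamma_2,g_2)$ when $\mathfrak{s}(\gamma_1)=\mathfrak{r}(\gamma_2)$ and $g_1=d(\gamma_2)g_2$; it is graded by $\widetilde d(\gamma,g)=d(\gamma)$. The bundle $\pi\#_dG\colon\Lambda\#_{d\circ\pi}G\to\Gamma\#_dG$ is $(\lambda,g)\mapsto(\pi(\lambda),g)$, with fibers $\pi^{-1}(\gamma)\times\{g\}$ having the bimodule structure of $\pi^{-1}(\gamma)$; $\mathcal{A}(\pi\#_dG)$ is $G$-graded via $\widetilde d$. *)

theory Defs
  imports "HOL-Analysis.Analysis" "HOL-Algebra.Generated_Groups" "HOL-Algebra.Ring"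
begin

section \<open>Topological preliminaries\<close>

text \<open>
  Unital topological rings: not necessarily commutative, Hausdorff or nontrivial. (The library
  class \<^class>\<open>ring_1\<close> would exclude the zero ring.)
\<close>

class unital_topological_ring = ring + topological_ab_group_add + topological_monoid_mult

definition locally_in :: "('a topology \<Rightarrow> bool) \<Rightarrow> 'a topology \<Rightarrow> bool" where
  "locally_in P X \<longleftrightarrow> neighbourhood_base_of (\<lambda>S. P (subtopology X S)) X"

definition R_normal :: "'r::unital_topological_ring itself \<Rightarrow> 'a topology \<Rightarrow> bool" where
  "R_normal _ X \<longleftrightarrow>
     (\<forall>A B. closedin X A \<and> closedin X B \<and> A \<inter> B = {} \<longrightarrow>
        (\<exists>f::'a \<Rightarrow> 'r. continuous_map X euclidean f \<and> (\<forall>x\<in>A. f x = 0) \<and> (\<forall>x\<in>B. f x = 1)))"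

definition local_homeomorphism :: "'a topology \<Rightarrow> 'b topology \<Rightarrow> ('a \<Rightarrow> 'b) \<Rightarrow> bool" where
  "local_homeomorphism X Y f \<longleftrightarrow>
     (\<forall>x\<in>topspace X. \<exists>U V. openin X U \<and> x \<in> U \<and> openin Y V \<and>
        homeomorphic_map (subtopology X U) (subtopology Y V) f)"


section \<open>Semigroupoids\<close>

text \<open>
  Arrows and vertices live in separate types; \<open>mul\<close> is only meaningful on composable pairs.
\<close>

record ('a, 'v) semigroupoid =
  arrows :: "'a set"
  vertices :: "'v set"
  src :: "'a \<Rightarrow> 'v"
  rng :: "'a \<Rightarrow> 'v"
  mul :: "'a \<Rightarrow> 'a \<Rightarrow> 'a"

record ('a, 'v) top_semigroupoid = "('a, 'v) semigroupoid" +
  arrow_top :: "'a topology"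
  vertex_top :: "'v topology"

definition composable :: "('a, 'v, 'm) semigroupoid_scheme \<Rightarrow> 'a \<Rightarrow> 'a \<Rightarrow> bool" where
  "composable S a b \<longleftrightarrow> a \<in> arrows S \<and> b \<in> arrows S \<and> src S a = rng S b"

locale semigroupoid =
  fixes S :: "('a, 'v, 'm) semigroupoid_scheme"
  assumes src_closed: "a \<in> arrows S \<Longrightarrow> src S a \<in> vertices S"
    and rng_closed: "a \<in> arrows S \<Longrightarrow> rng S a \<in> vertices S"
    and mul_closed: "composable S a b \<Longrightarrow> mul S a b \<in> arrows S"
    and src_mul: "composable S a b \<Longrightarrow> src S (mul S a b) = src S b"
    and rng_mul: "composable S a b \<Longrightarrow> rng S (mul S a b) = rng S a"
    and mul_assoc: "composable S a b \<Longrightarrow> composable S b c \<Longrightarrow>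
      mul S (mul S a b) c = mul S a (mul S b c)"

locale topological_semigroupoid = semigroupoid S
  for S :: "('a, 'v, 'm) top_semigroupoid_scheme" +
  assumes topspace_arrow_top: "topspace (arrow_top S) = arrows S"
    and topspace_vertex_top: "topspace (vertex_top S) = vertices S"
    and continuous_src: "continuous_map (arrow_top S) (vertex_top S) (src S)"
    and continuous_rng: "continuous_map (arrow_top S) (vertex_top S) (rng S)"
    and continuous_mul:
      "continuous_map
         (subtopology (prod_topology (arrow_top S) (arrow_top S)) {(a, b). composable S a b})
         (arrow_top S) (\<lambda>(a, b). mul S a b)"

locale etale_semigroupoid = topological_semigroupoid S
  for S :: "('a, 'v, 'm) top_semigroupoid_scheme" +
  assumes local_homeomorphism_src: "local_homeomorphism (arrow_top S) (vertex_top S) (src S)"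
    and local_homeomorphism_rng: "local_homeomorphism (arrow_top S) (vertex_top S) (rng S)"
    and Hausdorff_vertices: "Hausdorff_space (vertex_top S)"
    and locally_compact_vertices: "locally_in compact_space (vertex_top S)"

definition is_identity :: "('a, 'v, 'm) semigroupoid_scheme \<Rightarrow> 'v \<Rightarrow> 'a \<Rightarrow> bool" where
  "is_identity S v e \<longleftrightarrow> e \<in> arrows S \<and> src S e = v \<and> rng S e = v \<and>
     (\<forall>a\<in>arrows S. src S a = v \<longrightarrow> mul S a e = a) \<and>
     (\<forall>a\<in>arrows S. rng S a = v \<longrightarrow> mul S e a = a)"

definition is_inverse :: "('a, 'v, 'm) semigroupoid_scheme \<Rightarrow> 'a \<Rightarrow> 'a \<Rightarrow> bool" where
  "is_inverse S a b \<longleftrightarrow> composable S a b \<and> composable S b a \<and>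
     is_identity S (rng S a) (mul S a b) \<and> is_identity S (src S a) (mul S b a)"

locale groupoid = semigroupoid G
  for G :: "('a, 'v, 'm) semigroupoid_scheme" +
  assumes ex_identity: "v \<in> vertices G \<Longrightarrow> \<exists>e. is_identity G v e"
    and ex_inverse: "a \<in> arrows G \<Longrightarrow> \<exists>b. is_inverse G a b"

definition inverse_arrow :: "('a, 'v, 'm) semigroupoid_scheme \<Rightarrow> 'a \<Rightarrow> 'a" where
  "inverse_arrow G a = (THE b. is_inverse G a b)"

definition semigroupoid_hom ::
  "('a, 'v, 'm) semigroupoid_scheme \<Rightarrow> ('b, 'w, 'n) semigroupoid_scheme \<Rightarrow> ('a \<Rightarrow> 'b) \<Rightarrow> bool" where
  "semigroupoid_hom S S' \<phi> \<longleftrightarrow> \<phi> \<in> arrows S \<rightarrow> arrows S' \<and>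
     (\<forall>a b. composable S a b \<longrightarrow>
        composable S' (\<phi> a) (\<phi> b) \<and> \<phi> (mul S a b) = mul S' (\<phi> a) (\<phi> b))"

definition rigid_hom ::
  "('a, 'v, 'm) semigroupoid_scheme \<Rightarrow> ('b, 'w, 'n) semigroupoid_scheme \<Rightarrow> ('a \<Rightarrow> 'b) \<Rightarrow> bool" where
  "rigid_hom S S' \<phi> \<longleftrightarrow> semigroupoid_hom S S' \<phi> \<and>
     (\<forall>a\<in>arrows S. \<forall>b\<in>arrows S. composable S' (\<phi> a) (\<phi> b) \<longrightarrow> composable S a b)"


section \<open>Bimodules and algebras\<close>

text \<open>
  As for the library's record \<open>module\<close>, we extend the record of rings by the scalar actions.
  The field \<^const>\<open>mult\<close> carries the product when an algebra is meant and is unused otherwise;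
  the field \<^const>\<open>one\<close> is never used (our algebras need not have a unit).
\<close>

record ('r, 'm) bimodule = "'m ring" +
  lact :: "'r \<Rightarrow> 'm \<Rightarrow> 'm"
  ract :: "'m \<Rightarrow> 'r \<Rightarrow> 'm"

locale bimodule = abelian_group M
  for M :: "('r::unital_topological_ring, 'm, 'z) bimodule_scheme" (structure) +
  assumes lact_closed: "x \<in> carrier M \<Longrightarrow> lact M r x \<in> carrier M"
    and ract_closed: "x \<in> carrier M \<Longrightarrow> ract M x r \<in> carrier M"
    and lact_add: "x \<in> carrier M \<Longrightarrow> y \<in> carrier M \<Longrightarrow> lact M r (x \<oplus> y) = lact M r x \<oplus> lact M r y"
    and ract_add: "x \<in> carrier M \<Longrightarrow> y \<in> carrier M \<Longrightarrow> ract M (x \<oplus> y) r = ract M x r \<oplus> ract M y r"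
    and add_lact: "x \<in> carrier M \<Longrightarrow> lact M (r + s) x = lact M r x \<oplus> lact M s x"
    and add_ract: "x \<in> carrier M \<Longrightarrow> ract M x (r + s) = ract M x r \<oplus> ract M x s"
    and lact_lact: "x \<in> carrier M \<Longrightarrow> lact M r (lact M s x) = lact M (r * s) x"
    and ract_ract: "x \<in> carrier M \<Longrightarrow> ract M (ract M x r) s = ract M x (r * s)"
    and one_lact: "x \<in> carrier M \<Longrightarrow> lact M 1 x = x"
    and ract_one: "x \<in> carrier M \<Longrightarrow> ract M x 1 = x"
    and lact_ract: "x \<in> carrier M \<Longrightarrow> ract M (lact M r x) s = lact M r (ract M x s)"

definition sub_bimodule :: "'m set \<Rightarrow> ('r, 'm, 'z) bimodule_scheme \<Rightarrow> bool" where
  "sub_bimodule N M \<longleftrightarrow> subgroup N (add_monoid M) \<and>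
     (\<forall>r. \<forall>x\<in>N. lact M r x \<in> N \<and> ract M x r \<in> N)"

definition bimodule_generated :: "('r, 'm, 'z) bimodule_scheme \<Rightarrow> 'm set \<Rightarrow> 'm set" where
  "bimodule_generated M X = \<Inter>{N. sub_bimodule N M \<and> X \<subseteq> N}"

text \<open>
  Additive span (subgroup generated); applied to a union of subgroups, this is their sum.
\<close>

definition additive_span :: "('m, 'z) ring_scheme \<Rightarrow> 'm set \<Rightarrow> 'm set" where
  "additive_span M X = generate (add_monoid M) X"

text \<open>
  Sum of a finitely supported family over a possibly infinite index set.
\<close>

definition fsum :: "('m, 'z) ring_scheme \<Rightarrow> ('i \<Rightarrow> 'm) \<Rightarrow> 'i set \<Rightarrow> 'm" where
  "fsum M f I = finsum M f {i\<in>I. f i \<noteq> \<zero>\<^bsub>M\<^esub>}"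


section \<open>Gradings and smash products\<close>

text \<open>
  The grading of an algebra \<open>A\<close> is given by its family \<open>H\<close> of homogeneous components, indexed by
  the arrows of \<open>G\<close>. The decomposition of \<open>a\<close> is the unique finitely supported family with
  \<open>f g \<in> H g\<close> and sum \<open>a\<close>; its \<open>g\<close>-entry is the projection of \<open>a\<close> to \<open>H g\<close>.
\<close>

definition homogeneous_decomposition ::
  "('h, 'w, 'n) semigroupoid_scheme \<Rightarrow> ('m, 'z) ring_scheme \<Rightarrow> ('h \<Rightarrow> 'm set) \<Rightarrow>
     'm \<Rightarrow> ('h \<Rightarrow> 'm) \<Rightarrow> bool" where
  "homogeneous_decomposition G A H a f \<longleftrightarrow>
     f \<in> (\<Pi>\<^sub>E g\<in>arrows G. H g) \<and> finite {g\<in>arrows G. f g \<noteq> \<zero>\<^bsub>A\<^esub>} \<and> a = fsum A f (arrows G)"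

definition homogeneous_projection ::
  "('h, 'w, 'n) semigroupoid_scheme \<Rightarrow> ('m, 'z) ring_scheme \<Rightarrow> ('h \<Rightarrow> 'm set) \<Rightarrow>
     'h \<Rightarrow> 'm \<Rightarrow> 'm" where
  "homogeneous_projection G A H g a = (THE f. homogeneous_decomposition G A H a f) g"

definition algebra_hom ::
  "('r, 'm, 'y) bimodule_scheme \<Rightarrow> ('r, 'n, 'z) bimodule_scheme \<Rightarrow> ('m \<Rightarrow> 'n) \<Rightarrow> bool" where
  "algebra_hom A B T \<longleftrightarrow> T \<in> carrier A \<rightarrow> carrier B \<and>
     (\<forall>x\<in>carrier A. \<forall>y\<in>carrier A. T (x \<oplus>\<^bsub>A\<^esub> y) = T x \<oplus>\<^bsub>B\<^esub> T y) \<and>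
     (\<forall>x\<in>carrier A. \<forall>y\<in>carrier A. T (x \<otimes>\<^bsub>A\<^esub> y) = T x \<otimes>\<^bsub>B\<^esub> T y) \<and>
     (\<forall>r. \<forall>x\<in>carrier A. T (lact A r x) = lact B r (T x)) \<and>
     (\<forall>r. \<forall>x\<in>carrier A. T (ract A x r) = ract B (T x) r)"

definition graded_isomorphism ::
  "('h, 'w, 'k) semigroupoid_scheme \<Rightarrow>
     ('r, 'm, 'y) bimodule_scheme \<Rightarrow> ('h \<Rightarrow> 'm set) \<Rightarrow>
     ('r, 'n, 'z) bimodule_scheme \<Rightarrow> ('h \<Rightarrow> 'n set) \<Rightarrow> ('m \<Rightarrow> 'n) \<Rightarrow> bool" where
  "graded_isomorphism G A H B K T \<longleftrightarrow>
     algebra_hom A B T \<and> bij_betw T (carrier A) (carrier B) \<and>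
     (\<forall>g\<in>arrows G. T ` H g \<subseteq> K g)"

definition smash_coefficients ::
  "('h, 'w, 'n) semigroupoid_scheme \<Rightarrow> ('m, 'z) ring_scheme \<Rightarrow> ('h \<Rightarrow> 'm set) \<Rightarrow> 'h \<Rightarrow> 'm set" where
  "smash_coefficients G A H g =
     additive_span A (\<Union>k\<in>{k\<in>arrows G. src G k = rng G g}. H k)"

text \<open>
  The formal sum \<open>\<Sum>\<^sub>g a\<^sub>g \<delta>\<^sub>g\<close> is encoded as the finitely supported family \<open>g \<mapsto> a\<^sub>g\<close> on
  the arrows of \<open>G\<close>.
\<close>

definition smash_delta ::
  "('h, 'w, 'n) semigroupoid_scheme \<Rightarrow> ('m, 'z) ring_scheme \<Rightarrow> 'm \<Rightarrow> 'h \<Rightarrow> ('h \<Rightarrow> 'm)" where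
  "smash_delta G A a g = (\<lambda>h\<in>arrows G. if h = g then a else \<zero>\<^bsub>A\<^esub>)"

text \<open>
  The product is the biadditive extension of
  \<open>(a \<delta>\<^sub>g) (b \<delta>\<^sub>h) = a p(b) \<delta>\<^sub>h\<close> if \<open>g\<close>, \<open>h\<close> have the same source, and \<open>0\<close> otherwise, where \<open>p\<close>
  is the projection to the component of index \<open>g h\<^sup>-\<^sup>1\<close>; so the coefficient at \<open>h\<close> of a product
  \<open>u v\<close> collects the contributions of \<open>u\<^sub>g \<delta>\<^sub>g\<close> and \<open>v\<^sub>h \<delta>\<^sub>h\<close> for all \<open>g\<close>.
\<close>

definition smash_product ::
  "('h, 'w, 'n) semigroupoid_scheme \<Rightarrow> ('r, 'm, 'z) bimodule_scheme \<Rightarrow> ('h \<Rightarrow> 'm set) \<Rightarrow>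
     ('r, 'h \<Rightarrow> 'm) bimodule" where
  "smash_product G A H =
     \<lparr>carrier = {u \<in> (\<Pi>\<^sub>E g\<in>arrows G. smash_coefficients G A H g).
                  finite {g\<in>arrows G. u g \<noteq> \<zero>\<^bsub>A\<^esub>}},
      mult = (\<lambda>u v. \<lambda>h\<in>arrows G.
        fsum A
          (\<lambda>g. u g \<otimes>\<^bsub>A\<^esub> homogeneous_projection G A H (mul G g (inverse_arrow G h)) (v h))
          {g\<in>arrows G. src G g = src G h}),
      one = undefined,
      zero = (\<lambda>h\<in>arrows G. \<zero>\<^bsub>A\<^esub>),
      add = (\<lambda>u v. \<lambda>h\<in>arrows G. u h \<oplus>\<^bsub>A\<^esub> v h),
      lact = (\<lambda>r u. \<lambda>h\<in>arrows G. lact A r (u h)),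
      ract = (\<lambda>u r. \<lambda>h\<in>arrows G. ract A (u h) r)\<rparr>"

definition smash_grading ::
  "('h, 'w, 'n) semigroupoid_scheme \<Rightarrow> ('r, 'm, 'z) bimodule_scheme \<Rightarrow> ('h \<Rightarrow> 'm set) \<Rightarrow>
     'h \<Rightarrow> ('h \<Rightarrow> 'm) set" where
  "smash_grading G A H g =
     additive_span (smash_product G A H)
       {smash_delta G A a h | a h. a \<in> H g \<and> h \<in> arrows G \<and> rng G h = src G g}"


section \<open>Bundles\<close>

record ('l, 'x, 'g, 'v, 'r) bundle_data =
  total_sg :: "('l, 'x) top_semigroupoid"
  base_sg :: "('g, 'v) top_semigroupoid"
  proj :: "'l \<Rightarrow> 'g"
  fadd :: "'l \<Rightarrow> 'l \<Rightarrow> 'l"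
  fzero :: "'g \<Rightarrow> 'l"
  flact :: "'r \<Rightarrow> 'l \<Rightarrow> 'l"
  fract :: "'l \<Rightarrow> 'r \<Rightarrow> 'l"

definition fiber :: "('l, 'x, 'g, 'v, 'r) bundle_data \<Rightarrow> 'g \<Rightarrow> ('r, 'l) bimodule" where
  "fiber P \<gamma> =
     \<lparr>carrier = {x \<in> arrows (total_sg P). proj P x = \<gamma>},
      mult = undefined, one = undefined,
      zero = fzero P \<gamma>, add = fadd P, lact = flact P, ract = fract P\<rparr>"

text \<open>
  The last five conditions say that the product is biadditive and balanced and induces a homomorphism of bimodules on the
  tensor product of the two fibers.
\<close>

locale R_bundle =
  fixes P :: "('l, 'x, 'g, 'v, 'r::unital_topological_ring) bundle_data"
  assumes semigroupoid_total: "semigroupoid (total_sg P)"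
    and semigroupoid_base: "semigroupoid (base_sg P)"
    and rigid_proj: "rigid_hom (total_sg P) (base_sg P) (proj P)"
    and bimodule_fiber: "\<gamma> \<in> arrows (base_sg P) \<Longrightarrow> bimodule (fiber P \<gamma>)"
    and mul_add_left:
      "\<lbrakk>composable (base_sg P) \<gamma>\<^sub>1 \<gamma>\<^sub>2; x \<in> carrier (fiber P \<gamma>\<^sub>1); x' \<in> carrier (fiber P \<gamma>\<^sub>1);
        y \<in> carrier (fiber P \<gamma>\<^sub>2)\<rbrakk> \<Longrightarrow>
       mul (total_sg P) (fadd P x x') y = fadd P (mul (total_sg P) x y) (mul (total_sg P) x' y)"
    and mul_add_right:
      "\<lbrakk>composable (base_sg P) \<gamma>\<^sub>1 \<gamma>\<^sub>2; x \<in> carrier (fiber P \<gamma>\<^sub>1); y \<in> carrier (fiber P \<gamma>\<^sub>2);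
        y' \<in> carrier (fiber P \<gamma>\<^sub>2)\<rbrakk> \<Longrightarrow>
       mul (total_sg P) x (fadd P y y') = fadd P (mul (total_sg P) x y) (mul (total_sg P) x y')"
    and mul_balanced:
      "\<lbrakk>composable (base_sg P) \<gamma>\<^sub>1 \<gamma>\<^sub>2; x \<in> carrier (fiber P \<gamma>\<^sub>1); y \<in> carrier (fiber P \<gamma>\<^sub>2)\<rbrakk> \<Longrightarrow>
       mul (total_sg P) (fract P x r) y = mul (total_sg P) x (flact P r y)"
    and mul_lact:
      "\<lbrakk>composable (base_sg P) \<gamma>\<^sub>1 \<gamma>\<^sub>2; x \<in> carrier (fiber P \<gamma>\<^sub>1); y \<in> carrier (fiber P \<gamma>\<^sub>2)\<rbrakk> \<Longrightarrow>
       mul (total_sg P) (flact P r x) y = flact P r (mul (total_sg P) x y)"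
    and mul_ract:
      "\<lbrakk>composable (base_sg P) \<gamma>\<^sub>1 \<gamma>\<^sub>2; x \<in> carrier (fiber P \<gamma>\<^sub>1); y \<in> carrier (fiber P \<gamma>\<^sub>2)\<rbrakk> \<Longrightarrow>
       mul (total_sg P) x (fract P y r) = fract P (mul (total_sg P) x y) r"

locale continuous_R_bundle = R_bundle P
  for P :: "('l, 'x, 'g, 'v, 'r::unital_topological_ring) bundle_data" +
  assumes topological_total: "topological_semigroupoid (total_sg P)"
    and topological_base: "topological_semigroupoid (base_sg P)"
    and continuous_proj:
      "continuous_map (arrow_top (total_sg P)) (arrow_top (base_sg P)) (proj P)"
    and continuous_fadd:
      "continuous_map
         (subtopology (prod_topology (arrow_top (total_sg P)) (arrow_top (total_sg P)))
           {(x, y). proj P x = proj P y})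
         (arrow_top (total_sg P)) (\<lambda>(x, y). fadd P x y)"
    and continuous_flact:
      "continuous_map (prod_topology euclidean (arrow_top (total_sg P)))
         (arrow_top (total_sg P)) (\<lambda>(r, x). flact P r x)"
    and continuous_fract:
      "continuous_map (prod_topology (arrow_top (total_sg P)) euclidean)
         (arrow_top (total_sg P)) (\<lambda>(x, r). fract P x r)"
    and continuous_fzero:
      "continuous_map (arrow_top (base_sg P)) (arrow_top (total_sg P)) (fzero P)"


section \<open>Sectional algebras\<close>

text \<open>
  Sections are extensional functions, so that equality of functions is equality of sections.
\<close>

definition sections :: "('l, 'x, 'g, 'v, 'r) bundle_data \<Rightarrow> ('g \<Rightarrow> 'l) set" where
  "sections P = {\<alpha> \<in> arrows (base_sg P) \<rightarrow>\<^sub>E arrows (total_sg P).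
     \<forall>\<gamma>\<in>arrows (base_sg P). proj P (\<alpha> \<gamma>) = \<gamma>}"

definition supp :: "('l, 'x, 'g, 'v, 'r) bundle_data \<Rightarrow> ('g \<Rightarrow> 'l) \<Rightarrow> 'g set" where
  "supp P \<alpha> = arrow_top (base_sg P) closure_of {\<gamma> \<in> arrows (base_sg P). \<alpha> \<gamma> \<noteq> fzero P \<gamma>}"

definition Cc :: "('l, 'x, 'g, 'v, 'r) bundle_data \<Rightarrow> 'g set \<Rightarrow> ('g \<Rightarrow> 'l) set" where
  "Cc P V = {\<alpha> \<in> sections P.
     (\<forall>\<gamma>\<in>arrows (base_sg P) - V. \<alpha> \<gamma> = fzero P \<gamma>) \<and>
     continuous_map (subtopology (arrow_top (base_sg P)) V) (arrow_top (total_sg P)) \<alpha> \<and>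
     compactin (arrow_top (base_sg P)) (supp P \<alpha> \<inter> V)}"

definition open_Hausdorff :: "'a topology \<Rightarrow> 'a set \<Rightarrow> bool" where
  "open_Hausdorff X V \<longleftrightarrow> openin X V \<and> Hausdorff_space (subtopology X V)"

definition convolution ::
  "('l, 'x, 'g, 'v, 'r) bundle_data \<Rightarrow> ('g \<Rightarrow> 'l) \<Rightarrow> ('g \<Rightarrow> 'l) \<Rightarrow> ('g \<Rightarrow> 'l)" where
  "convolution P \<alpha> \<beta> = (\<lambda>\<gamma>\<in>arrows (base_sg P).
     fsum (fiber P \<gamma>) (\<lambda>(a, b). mul (total_sg P) (\<alpha> a) (\<beta> b))
       {(a, b). composable (base_sg P) a b \<and> mul (base_sg P) a b = \<gamma>})"

definition section_bimodule ::
  "('l, 'x, 'g, 'v, 'r) bundle_data \<Rightarrow> ('r, 'g \<Rightarrow> 'l) bimodule" where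
  "section_bimodule P =
     \<lparr>carrier = sections P,
      mult = convolution P,
      one = undefined,
      zero = (\<lambda>\<gamma>\<in>arrows (base_sg P). fzero P \<gamma>),
      add = (\<lambda>\<alpha> \<beta>. \<lambda>\<gamma>\<in>arrows (base_sg P). fadd P (\<alpha> \<gamma>) (\<beta> \<gamma>)),
      lact = (\<lambda>r \<alpha>. \<lambda>\<gamma>\<in>arrows (base_sg P). flact P r (\<alpha> \<gamma>)),
      ract = (\<lambda>\<alpha> r. \<lambda>\<gamma>\<in>arrows (base_sg P). fract P (\<alpha> \<gamma>) r)\<rparr>"

text \<open>
  The convolution is defined on all pairs of sections, but only meaningful on the sectional
  algebra, where the sums defining it are finite.
\<close>

definition sectional_algebra ::
  "('l, 'x, 'g, 'v, 'r) bundle_data \<Rightarrow> ('r, 'g \<Rightarrow> 'l) bimodule" where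
  "sectional_algebra P = (section_bimodule P)
     \<lparr>carrier := bimodule_generated (section_bimodule P)
        (\<Union>V\<in>{V. open_Hausdorff (arrow_top (base_sg P)) V}. Cc P V)\<rparr>"

definition sectional_grading ::
  "('l, 'x, 'g, 'v, 'r) bundle_data \<Rightarrow> ('g \<Rightarrow> 'h) \<Rightarrow> 'h \<Rightarrow> ('g \<Rightarrow> 'l) set" where
  "sectional_grading P c g = additive_span (sectional_algebra P)
     (\<Union>U\<in>{U. open_Hausdorff (arrow_top (base_sg P)) U \<and> (\<forall>\<gamma>\<in>U. c \<gamma> = g)}. Cc P U)"


section \<open>Skew products\<close>

definition skew_arrows ::
  "('g, 'v, 'm) semigroupoid_scheme \<Rightarrow> ('g \<Rightarrow> 'h) \<Rightarrow> ('h, 'w, 'n) semigroupoid_scheme \<Rightarrow>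
     ('g \<times> 'h) set" where
  "skew_arrows S d G = {(\<gamma>, g). \<gamma> \<in> arrows S \<and> g \<in> arrows G \<and> src G (d \<gamma>) = rng G g}"

text \<open>
  \<open>G\<close> is discrete; the arrows of the skew product carry the subspace topology of the product.
\<close>

definition skew_product ::
  "('g, 'v) top_semigroupoid \<Rightarrow> ('g \<Rightarrow> 'h) \<Rightarrow> ('h, 'w, 'n) semigroupoid_scheme \<Rightarrow>
     ('g \<times> 'h, 'v \<times> 'h) top_semigroupoid" where
  "skew_product S d G =
     \<lparr>arrows = skew_arrows S d G,
      vertices = vertices S \<times> arrows G,
      src = (\<lambda>(\<gamma>, g). (src S \<gamma>, g)),
      rng = (\<lambda>(\<gamma>, g). (rng S \<gamma>, mul G (d \<gamma>) g)),
      mul = (\<lambda>(\<gamma>\<^sub>1, g\<^sub>1) (\<gamma>\<^sub>2, g\<^sub>2). (mul S \<gamma>\<^sub>1 \<gamma>\<^sub>2, g\<^sub>2)),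
      arrow_top = subtopology (prod_topology (arrow_top S) (discrete_topology (arrows G)))
        (skew_arrows S d G),
      vertex_top = prod_topology (vertex_top S) (discrete_topology (arrows G))\<rparr>"

definition skew_bundle ::
  "('l, 'x, 'g, 'v, 'r) bundle_data \<Rightarrow> ('g \<Rightarrow> 'h) \<Rightarrow> ('h, 'w, 'n) semigroupoid_scheme \<Rightarrow>
     ('l \<times> 'h, 'x \<times> 'h, 'g \<times> 'h, 'v \<times> 'h, 'r) bundle_data" where
  "skew_bundle P d G =
     \<lparr>total_sg = skew_product (total_sg P) (d \<circ> proj P) G,
      base_sg = skew_product (base_sg P) d G,
      proj = (\<lambda>(x, g). (proj P x, g)),
      fadd = (\<lambda>(x, g) (y, h). (fadd P x y, g)),
      fzero = (\<lambda>(\<gamma>, g). (fzero P \<gamma>, g)),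
      flact = (\<lambda>r (x, g). (flact P r x, g)),
      fract = (\<lambda>(x, g) r. (fract P x r, g))\<rparr>"

definition skew_grading :: "('g \<Rightarrow> 'h) \<Rightarrow> 'g \<times> 'h \<Rightarrow> 'h" where
  "skew_grading d = (\<lambda>(\<gamma>, g). d \<gamma>)"

end

theory Submission
  imports Defs
begin

text \<open>
  As a space, the skew product \<open>\<Gamma> # G\<close> is the disjoint union, over the arrows \<open>h\<close> of \<open>G\<close>, of clopen
  copies of the sets \<open>\<Gamma>\<^sub>h = {\<gamma>. s(d \<gamma>) = r(h)}\<close>. A section of the skew bundle is therefore a family
  of sections \<open>u\<^sub>h\<close> of the original bundle, \<open>u\<^sub>h\<close> vanishing outside \<open>\<Gamma>\<^sub>h\<close>. On the other side, the coefficient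
  of \<open>\<delta>\<^sub>h\<close> in the smash product ranges over the sum of the components of degree \<open>k\<close> with \<open>s(k) = r(h)\<close>, and
  this sum consists exactly of the elements of the sectional algebra that vanish outside \<open>\<Gamma>\<^sub>h\<close>. So the two
  algebras have the same elements, and \<open>T\<close> reads a family of sections as a section of the skew bundle.
  A compact set meets only finitely many of the clopen copies, which is why exactly the finite
  families occur (\<open>assemble_Alg\<close>, \<open>assemble_surj\<close>).
  
  The factorizations of \<open>(\<gamma>, h)\<close> in the skew product are the pairs of \<open>(a, d(b)h)\<close> and \<open>(b, h)\<close> with
  \<open>ab = \<gamma>\<close>. Hence the convolution of \<open>T u\<close> and \<open>T v\<close> at \<open>(\<gamma>, h)\<close> is the sum of \<open>u\<^bsub>d(b)h\<^esub>(a) v\<^sub>h(b)\<close> over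
  \<open>ab = \<gamma>\<close>. In the smash product, the summand of index \<open>g\<close> contains the projection of \<open>v\<^sub>h\<close> to degree
  \<open>g h\<^sup>-\<^sup>1\<close>, which keeps \<open>v\<^sub>h(b)\<close> precisely when \<open>g = d(b)h\<close>; exchanging the two sums gives the same value
  (\<open>assemble_mult\<close>).
  
  Two facts about the sectional algebra carry this argument. First, restriction to a clopen set maps
  the algebra into itself, since it does so for compactly supported sections; thus the homogeneous
  components are described by their supports, and the projections are restrictions
  (\<open>sectional_grading_eq\<close>, \<open>homogeneous_projection_eq\<close>, \<open>smash_coefficients_eq\<close>). Secondly, the algebra
  is closed under convolution (\<open>convolution_closed\<close>). Local \<open>R\<close>-normality provides cut-off functions with
  values in \<open>R\<close>, which split every compactly supported section into sections supported on open sets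
  where the source map is injective (\<open>Cc_in_source_span\<close>). For two such sections each value of the
  convolution has at most one summand, and the result is again continuous with compact support on an
  open Hausdorff set (\<open>convolution_Cc\<close>).
\<close>

section \<open>Additive spans and finite sums\<close>

text \<open>
  The algebras in question are generated additively by compactly supported sections, so an additive
  map between them has to be examined on these generators only. Additivity is asked on a subgroup \<open>F\<close>
  because convolution is additive only where the sums defining it are finite.
\<close>

lemma additive_span_image_subset:
  assumes M: "abelian_group M" and N: "abelian_group N"
    and F: "subgroup F (add_monoid M)" and X: "X \<subseteq> F"
    and closed: "\<And>x. x \<in> F \<Longrightarrow> \<phi> x \<in> carrier N"
    and add: "\<And>x y. x \<in> F \<Longrightarrow> y \<in> F \<Longrightarrow> \<phi> (x \<oplus>\<^bsub>M\<^esub> y) = \<phi> x \<oplus>\<^bsub>N\<^esub> \<phi> y"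
    and B: "subgroup B (add_monoid N)" and XB: "\<And>x. x \<in> X \<Longrightarrow> \<phi> x \<in> B"
    and x: "x \<in> additive_span M X"
  shows "\<phi> x \<in> B"
proof -
  interpret M: abelian_group M by (rule M)
  interpret N: abelian_group N by (rule N)
  have zero: "\<zero>\<^bsub>M\<^esub> \<in> F" using subgroup.one_closed[OF F] by simp
  have \<phi>zero: "\<phi> \<zero>\<^bsub>M\<^esub> = \<zero>\<^bsub>N\<^esub>"
  proof -
    have "\<phi> \<zero>\<^bsub>M\<^esub> \<oplus>\<^bsub>N\<^esub> \<phi> \<zero>\<^bsub>M\<^esub> = \<phi> \<zero>\<^bsub>M\<^esub>" using add[OF zero zero] by simp
    then show ?thesis using closed[OF zero] by (metis N.add.l_cancel_one)
  qed
  have FM: "F \<subseteq> carrier M" using subgroup.subset[OF F] by simp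
  have "subgroup {x \<in> F. \<phi> x \<in> B} (add_monoid M)"
  proof (rule M.add.subgroupI)
    show "{x \<in> F. \<phi> x \<in> B} \<subseteq> carrier M" using FM by auto
    show "{x \<in> F. \<phi> x \<in> B} \<noteq> {}"
      using zero \<phi>zero subgroup.one_closed[OF B] by auto
    fix a b assume a: "a \<in> {x \<in> F. \<phi> x \<in> B}"
    then have Fa: "a \<in> F" and Ba: "\<phi> a \<in> B" by auto
    have inv: "\<ominus>\<^bsub>M\<^esub> a \<in> F"
      using subgroup.m_inv_closed[OF F Fa] by (simp add: a_inv_def)
    have "\<phi> (\<ominus>\<^bsub>M\<^esub> a) \<oplus>\<^bsub>N\<^esub> \<phi> a = \<zero>\<^bsub>N\<^esub>"
      using add[OF inv Fa] \<phi>zero FM Fa by (simp add: M.l_neg subsetD)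
    then have "\<phi> (\<ominus>\<^bsub>M\<^esub> a) = \<ominus>\<^bsub>N\<^esub> \<phi> a"
      using N.minus_equality closed[OF inv] closed[OF Fa] by metis
    then show "\<ominus>\<^bsub>M\<^esub> a \<in> {x \<in> F. \<phi> x \<in> B}"
      using inv subgroup.m_inv_closed[OF B Ba] by (simp add: a_inv_def)
    assume "b \<in> {x \<in> F. \<phi> x \<in> B}"
    with a show "a \<oplus>\<^bsub>M\<^esub> b \<in> {x \<in> F. \<phi> x \<in> B}"
      using subgroup.m_closed[OF F] subgroup.m_closed[OF B] add by auto
  qed
  then have "additive_span M X \<subseteq> {x \<in> F. \<phi> x \<in> B}"
    unfolding additive_span_def
    using X XB by (intro M.add.generate_subgroup_incl) auto
  with x show ?thesis by auto
qed

lemma (in abelian_group) additive_span_subgroup: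
  "X \<subseteq> carrier G \<Longrightarrow> subgroup (additive_span G X) (add_monoid G)"
  unfolding additive_span_def by (rule add.generate_is_subgroup) simp

lemma additive_span_superset: "x \<in> X \<Longrightarrow> x \<in> additive_span M X"
  unfolding additive_span_def by (rule generate.incl)

lemma (in abelian_group) additive_span_minimal:
  "X \<subseteq> H \<Longrightarrow> subgroup H (add_monoid G) \<Longrightarrow> additive_span G X \<subseteq> H"
  unfolding additive_span_def by (rule add.generate_subgroup_incl)

lemma (in abelian_group) finsum_mem_subgroup:
  assumes "subgroup H (add_monoid G)" "finite F" "\<And>i. i \<in> F \<Longrightarrow> f i \<in> H"
  shows "finsum G f F \<in> H"
  using assms(2,3)
proof (induction F)
  case empty
  then show ?case using subgroup.one_closed[OF assms(1)] by simp
next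
  case (insert i F)
  have "f \<in> insert i F \<rightarrow> carrier G" using insert.prems subgroup.subset[OF assms(1)] by auto
  then show ?case using insert subgroup.m_closed[OF assms(1)] by (auto simp: Pi_iff)
qed

lemma (in abelian_monoid) finsum_neutral:
  assumes "finite F" "E \<subseteq> F" "\<And>i. i \<in> F - E \<Longrightarrow> f i = \<zero>" "f \<in> E \<rightarrow> carrier G"
  shows "finsum G f E = finsum G f F"
  using assms by (intro add.finprod_mono_neutral_cong_left) auto

lemma (in abelian_monoid) fsum_eq_finsum:
  assumes "finite F" "F \<subseteq> I" "\<And>i. i \<in> I - F \<Longrightarrow> f i = \<zero>" "f \<in> F \<rightarrow> carrier G"
  shows "fsum G f I = finsum G f F"
  unfolding fsum_def using assms by (intro finsum_neutral) auto

lemma (in abelian_monoid) finsum_swap: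
  assumes "finite E" "finite F" "\<And>i j. i \<in> E \<Longrightarrow> j \<in> F \<Longrightarrow> f i j \<in> carrier G"
  shows "(\<Oplus>i\<in>E. \<Oplus>j\<in>F. f i j) = (\<Oplus>j\<in>F. \<Oplus>i\<in>E. f i j)"
  using assms(1,3)
proof (induction E)
  case empty
  then show ?case by simp
next
  case (insert i E)
  have "(\<Oplus>k\<in>insert i E. \<Oplus>j\<in>F. f k j) = (\<Oplus>j\<in>F. f i j) \<oplus> (\<Oplus>j\<in>F. \<Oplus>k\<in>E. f k j)"
    using insert by (subst finsum_insert) (auto intro!: finsum_closed)
  also have "\<dots> = (\<Oplus>j\<in>F. f i j \<oplus> (\<Oplus>k\<in>E. f k j))"
    using insert.prems by (subst finsum_addf) (auto intro!: finsum_closed)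
  also have "\<dots> = (\<Oplus>j\<in>F. \<Oplus>k\<in>insert i E. f k j)"
    using insert by (intro finsum_cong') (auto intro!: finsum_closed)
  finally show ?case .
qed

section \<open>Sections of a bundle of bimodules\<close>

definition nonzero_set :: "('l, 'x, 'g, 'v, 'r) bundle_data \<Rightarrow> ('g \<Rightarrow> 'l) \<Rightarrow> 'g set" where
  "nonzero_set P \<alpha> = {\<gamma> \<in> arrows (base_sg P). \<alpha> \<gamma> \<noteq> fzero P \<gamma>}"

text \<open>
  The data on which the additive theory of sections rests. They are inherited by the skew product
  bundle, so that everything proved here can be used on both sides of the isomorphism.
\<close>

locale bimodule_bundle =
  fixes P :: "('l, 'x, 'g, 'v, 'r::unital_topological_ring) bundle_data"
  assumes topspace_base: "topspace (arrow_top (base_sg P)) = arrows (base_sg P)"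
    and topspace_total: "topspace (arrow_top (total_sg P)) = arrows (total_sg P)"
    and fiber_bimodule: "\<gamma> \<in> arrows (base_sg P) \<Longrightarrow> bimodule (fiber P \<gamma>)"
    and continuous_flact_at:
      "continuous_map (arrow_top (total_sg P)) (arrow_top (total_sg P)) (flact P r)"
    and continuous_fract_at:
      "continuous_map (arrow_top (total_sg P)) (arrow_top (total_sg P)) (\<lambda>x. fract P x r)"
begin

abbreviation base_top :: "'g topology" where "base_top \<equiv> arrow_top (base_sg P)"
abbreviation total_top :: "'l topology" where "total_top \<equiv> arrow_top (total_sg P)"
abbreviation base :: "'g set" where "base \<equiv> arrows (base_sg P)"
abbreviation Sec :: "('r, 'g \<Rightarrow> 'l) bimodule" where "Sec \<equiv> section_bimodule P"
abbreviation Alg :: "('r, 'g \<Rightarrow> 'l) bimodule" where "Alg \<equiv> sectional_algebra P"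

lemma fiber_simps [simp]:
  "carrier (fiber P \<gamma>) = {x \<in> arrows (total_sg P). proj P x = \<gamma>}"
  "add (fiber P \<gamma>) = fadd P" "zero (fiber P \<gamma>) = fzero P \<gamma>"
  "lact (fiber P \<gamma>) = flact P" "ract (fiber P \<gamma>) = fract P"
  by (simp_all add: fiber_def)

lemma Sec_simps [simp]:
  "carrier Sec = sections P"
  "add Sec = (\<lambda>\<alpha> \<beta>. \<lambda>\<gamma>\<in>base. fadd P (\<alpha> \<gamma>) (\<beta> \<gamma>))"
  "zero Sec = (\<lambda>\<gamma>\<in>base. fzero P \<gamma>)"
  "lact Sec = (\<lambda>r \<alpha>. \<lambda>\<gamma>\<in>base. flact P r (\<alpha> \<gamma>))"
  "ract Sec = (\<lambda>\<alpha> r. \<lambda>\<gamma>\<in>base. fract P (\<alpha> \<gamma>) r)"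
  "mult Sec = convolution P"
  by (simp_all add: section_bimodule_def)

lemma Alg_simps [simp]:
  "add Alg = (\<lambda>\<alpha> \<beta>. \<lambda>\<gamma>\<in>base. fadd P (\<alpha> \<gamma>) (\<beta> \<gamma>))"
  "zero Alg = (\<lambda>\<gamma>\<in>base. fzero P \<gamma>)"
  "lact Alg = (\<lambda>r \<alpha>. \<lambda>\<gamma>\<in>base. flact P r (\<alpha> \<gamma>))"
  "ract Alg = (\<lambda>\<alpha> r. \<lambda>\<gamma>\<in>base. fract P (\<alpha> \<gamma>) r)"
  "mult Alg = convolution P"
  by (simp_all add: sectional_algebra_def)

lemma fiber_group: "\<gamma> \<in> base \<Longrightarrow> abelian_group (fiber P \<gamma>)"
  using fiber_bimodule bimodule.axioms(1) by blast

lemma sections_mem: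
  "\<alpha> \<in> sections P \<Longrightarrow> \<gamma> \<in> base \<Longrightarrow> \<alpha> \<gamma> \<in> carrier (fiber P \<gamma>)"
  by (auto simp: sections_def)

lemma sectionsI:
  "(\<And>\<gamma>. \<gamma> \<in> base \<Longrightarrow> f \<gamma> \<in> carrier (fiber P \<gamma>)) \<Longrightarrow> restrict f base \<in> sections P"
  by (auto simp: sections_def)

lemma sections_eqI:
  "\<alpha> \<in> sections P \<Longrightarrow> \<beta> \<in> sections P \<Longrightarrow> (\<And>\<gamma>. \<gamma> \<in> base \<Longrightarrow> \<alpha> \<gamma> = \<beta> \<gamma>) \<Longrightarrow> \<alpha> = \<beta>"
  by (auto simp: sections_def intro: PiE_ext)

lemma sections_extensional: "\<alpha> \<in> sections P \<Longrightarrow> restrict \<alpha> base = \<alpha>"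
  by (auto simp: sections_def)

lemma fiber_zero_closed: "\<gamma> \<in> base \<Longrightarrow> fzero P \<gamma> \<in> carrier (fiber P \<gamma>)"
  using abelian_monoid.zero_closed[OF abelian_group.axioms(1)[OF fiber_group]] by simp

lemma fiber_add_closed:
  assumes "\<gamma> \<in> base" "x \<in> carrier (fiber P \<gamma>)" "y \<in> carrier (fiber P \<gamma>)"
  shows "fadd P x y \<in> carrier (fiber P \<gamma>)"
proof -
  interpret bimodule "fiber P \<gamma>" using assms(1) by (rule fiber_bimodule)
  show ?thesis using a_closed[OF assms(2,3)] by simp
qed

lemma fiber_add_zero:
  assumes "\<gamma> \<in> base" "x \<in> carrier (fiber P \<gamma>)"
  shows "fadd P x (fzero P \<gamma>) = x" "fadd P (fzero P \<gamma>) x = x"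
proof -
  interpret bimodule "fiber P \<gamma>" using assms(1) by (rule fiber_bimodule)
  show "fadd P x (fzero P \<gamma>) = x" using r_zero[OF assms(2)] by simp
  show "fadd P (fzero P \<gamma>) x = x" using l_zero[OF assms(2)] by simp
qed

lemma fiber_act_closed:
  assumes "\<gamma> \<in> base" "x \<in> carrier (fiber P \<gamma>)"
  shows "flact P r x \<in> carrier (fiber P \<gamma>)" "fract P x r \<in> carrier (fiber P \<gamma>)"
proof -
  interpret bimodule "fiber P \<gamma>" using assms(1) by (rule fiber_bimodule)
  show "flact P r x \<in> carrier (fiber P \<gamma>)" "fract P x r \<in> carrier (fiber P \<gamma>)"
    using lact_closed[OF assms(2), of r] ract_closed[OF assms(2), of r] by simp_all
qed

lemma fiber_act_zero:
  assumes "\<gamma> \<in> base"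
  shows "flact P r (fzero P \<gamma>) = fzero P \<gamma>" "fract P (fzero P \<gamma>) r = fzero P \<gamma>"
proof -
  interpret bimodule "fiber P \<gamma>" using assms by (rule fiber_bimodule)
  let ?z = "zero (fiber P \<gamma>)"
  have "lact (fiber P \<gamma>) r ?z \<oplus>\<^bsub>fiber P \<gamma>\<^esub> lact (fiber P \<gamma>) r ?z = lact (fiber P \<gamma>) r ?z"
    using lact_add[of ?z ?z r] by (metis l_zero zero_closed)
  then have "lact (fiber P \<gamma>) r ?z = ?z"
    using lact_closed[OF zero_closed, of r] by (metis add.l_cancel_one)
  then show "flact P r (fzero P \<gamma>) = fzero P \<gamma>" by simp
  have "ract (fiber P \<gamma>) ?z r \<oplus>\<^bsub>fiber P \<gamma>\<^esub> ract (fiber P \<gamma>) ?z r = ract (fiber P \<gamma>) ?z r"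
    using ract_add[of ?z ?z r] by (metis l_zero zero_closed)
  then have "ract (fiber P \<gamma>) ?z r = ?z"
    using ract_closed[OF zero_closed, of r] by (metis add.l_cancel_one)
  then show "fract P (fzero P \<gamma>) r = fzero P \<gamma>" by simp
qed

lemma fiber_zero_lact:
  assumes "\<gamma> \<in> base" "x \<in> carrier (fiber P \<gamma>)"
  shows "flact P 0 x = fzero P \<gamma>"
proof -
  interpret bimodule "fiber P \<gamma>" using assms(1) by (rule fiber_bimodule)
  have "lact (fiber P \<gamma>) 0 x \<oplus>\<^bsub>fiber P \<gamma>\<^esub> lact (fiber P \<gamma>) 0 x = lact (fiber P \<gamma>) 0 x"
    using add_lact[OF assms(2), of 0 0] by simp
  then have "lact (fiber P \<gamma>) 0 x = \<zero>\<^bsub>fiber P \<gamma>\<^esub>"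
    using lact_closed[OF assms(2), of 0] by (metis add.l_cancel_one)
  then show ?thesis by simp
qed

lemma fiber_act_add:
  assumes "\<gamma> \<in> base" "x \<in> carrier (fiber P \<gamma>)" "y \<in> carrier (fiber P \<gamma>)"
  shows "flact P r (fadd P x y) = fadd P (flact P r x) (flact P r y)"
    and "fract P (fadd P x y) r = fadd P (fract P x r) (fract P y r)"
proof -
  interpret bimodule "fiber P \<gamma>" using assms(1) by (rule fiber_bimodule)
  show "flact P r (fadd P x y) = fadd P (flact P r x) (flact P r y)"
    and "fract P (fadd P x y) r = fadd P (fract P x r) (fract P y r)"
    using lact_add[OF assms(2,3), of r] ract_add[OF assms(2,3), of r] by simp_all
qed

lemma zero_section: "(\<lambda>\<gamma>\<in>base. fzero P \<gamma>) \<in> sections P"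
  by (rule sectionsI) (rule fiber_zero_closed)

lemma add_section:
  "\<alpha> \<in> sections P \<Longrightarrow> \<beta> \<in> sections P \<Longrightarrow> (\<lambda>\<gamma>\<in>base. fadd P (\<alpha> \<gamma>) (\<beta> \<gamma>)) \<in> sections P"
  by (rule sectionsI) (intro fiber_add_closed sections_mem)

lemma act_section:
  "\<alpha> \<in> sections P \<Longrightarrow> (\<lambda>\<gamma>\<in>base. flact P r (\<alpha> \<gamma>)) \<in> sections P"
  "\<alpha> \<in> sections P \<Longrightarrow> (\<lambda>\<gamma>\<in>base. fract P (\<alpha> \<gamma>) r) \<in> sections P"
  by (rule sectionsI, rule fiber_act_closed, assumption, rule sections_mem, assumption+)+

lemma Sec_abelian_group: "abelian_group Sec"
proof (rule abelian_groupI)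
  fix \<alpha> \<beta> \<gamma> assume \<alpha>: "\<alpha> \<in> carrier Sec" and \<beta>: "\<beta> \<in> carrier Sec"
  show "\<alpha> \<oplus>\<^bsub>Sec\<^esub> \<beta> \<in> carrier Sec" using add_section \<alpha> \<beta> by simp
  have "fadd P (\<alpha> x) (\<beta> x) = fadd P (\<beta> x) (\<alpha> x)" if x: "x \<in> base" for x
  proof -
    interpret bimodule "fiber P x" using x by (rule fiber_bimodule)
    show ?thesis using a_comm[OF sections_mem sections_mem] \<alpha> \<beta> x by simp
  qed
  then show "\<alpha> \<oplus>\<^bsub>Sec\<^esub> \<beta> = \<beta> \<oplus>\<^bsub>Sec\<^esub> \<alpha>" by (auto intro!: restrict_ext)
  have "fadd P (fzero P x) (\<alpha> x) = \<alpha> x" if "x \<in> base" for x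
    using fiber_add_zero(2)[OF that sections_mem] \<alpha> that by simp
  then show "\<zero>\<^bsub>Sec\<^esub> \<oplus>\<^bsub>Sec\<^esub> \<alpha> = \<alpha>"
    using sections_eqI[OF add_section[OF zero_section] _, of \<alpha> \<alpha>] \<alpha> by simp
  have inv: "(\<lambda>x\<in>base. \<ominus>\<^bsub>fiber P x\<^esub> (\<alpha> x)) \<in> sections P"
  proof (rule sectionsI)
    fix x assume x: "x \<in> base"
    interpret bimodule "fiber P x" using x by (rule fiber_bimodule)
    show "\<ominus>\<^bsub>fiber P x\<^esub> (\<alpha> x) \<in> carrier (fiber P x)"
      by (rule a_inv_closed, rule sections_mem) (use \<alpha> x in simp_all)
  qed
  have "fadd P (\<ominus>\<^bsub>fiber P x\<^esub> (\<alpha> x)) (\<alpha> x) = fzero P x" if x: "x \<in> base" for x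
  proof -
    interpret bimodule "fiber P x" using x by (rule fiber_bimodule)
    show ?thesis using l_neg[OF sections_mem] \<alpha> x by simp
  qed
  then have "(\<lambda>x\<in>base. \<ominus>\<^bsub>fiber P x\<^esub> (\<alpha> x)) \<oplus>\<^bsub>Sec\<^esub> \<alpha> = \<zero>\<^bsub>Sec\<^esub>"
    by (auto intro!: restrict_ext)
  with inv show "\<exists>\<beta>\<in>carrier Sec. \<beta> \<oplus>\<^bsub>Sec\<^esub> \<alpha> = \<zero>\<^bsub>Sec\<^esub>"
    by (metis Sec_simps(1))
  assume \<gamma>: "\<gamma> \<in> carrier Sec"
  have "fadd P (fadd P (\<alpha> x) (\<beta> x)) (\<gamma> x) = fadd P (\<alpha> x) (fadd P (\<beta> x) (\<gamma> x))" if x: "x \<in> base" for x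
  proof -
    interpret bimodule "fiber P x" using x by (rule fiber_bimodule)
    show ?thesis using a_assoc[OF sections_mem sections_mem sections_mem] \<alpha> \<beta> \<gamma> x by simp
  qed
  then show "\<alpha> \<oplus>\<^bsub>Sec\<^esub> \<beta> \<oplus>\<^bsub>Sec\<^esub> \<gamma> = \<alpha> \<oplus>\<^bsub>Sec\<^esub> (\<beta> \<oplus>\<^bsub>Sec\<^esub> \<gamma>)" by (auto intro!: restrict_ext)
qed (use zero_section in simp)

sublocale Sec: abelian_group "section_bimodule P" by (rule Sec_abelian_group)

lemma Sec_minus:
  assumes "\<alpha> \<in> sections P" "\<gamma> \<in> base"
  shows "(\<ominus>\<^bsub>Sec\<^esub> \<alpha>) \<gamma> = \<ominus>\<^bsub>fiber P \<gamma>\<^esub> (\<alpha> \<gamma>)"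
proof -
  interpret bimodule "fiber P \<gamma>" using assms(2) by (rule fiber_bimodule)
  have m: "\<ominus>\<^bsub>Sec\<^esub> \<alpha> \<in> sections P" using Sec.a_inv_closed[of \<alpha>] assms(1) by simp
  have "\<ominus>\<^bsub>Sec\<^esub> \<alpha> \<oplus>\<^bsub>Sec\<^esub> \<alpha> = \<zero>\<^bsub>Sec\<^esub>" using Sec.l_neg[of \<alpha>] assms(1) by simp
  then have "fadd P ((\<ominus>\<^bsub>Sec\<^esub> \<alpha>) \<gamma>) (\<alpha> \<gamma>) = fzero P \<gamma>"
    using assms(2) by (auto dest: fun_cong[where x = \<gamma>])
  then show ?thesis
    using minus_equality[of "(\<ominus>\<^bsub>Sec\<^esub> \<alpha>) \<gamma>" "\<alpha> \<gamma>"] sections_mem[OF m assms(2)] sections_mem[OF assms]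
    by simp
qed

lemma nonzero_set_subset: "nonzero_set P \<alpha> \<subseteq> base"
  by (auto simp: nonzero_set_def)

lemma nonzero_set_add:
  "nonzero_set P (\<lambda>\<gamma>\<in>base. fadd P (\<alpha> \<gamma>) (\<beta> \<gamma>)) \<subseteq> nonzero_set P \<alpha> \<union> nonzero_set P \<beta>"
  using fiber_add_zero fiber_zero_closed by (fastforce simp: nonzero_set_def)

lemma nonzero_set_zero [simp]: "nonzero_set P (\<lambda>\<gamma>\<in>base. fzero P \<gamma>) = {}"
  by (auto simp: nonzero_set_def)

lemma zero_section_iff:
  "\<alpha> \<in> sections P \<Longrightarrow> \<alpha> = (\<lambda>\<gamma>\<in>base. fzero P \<gamma>) \<longleftrightarrow> nonzero_set P \<alpha> = {}"
  by (auto simp: nonzero_set_def intro!: sections_eqI zero_section)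

text \<open>
  Addition can only shrink the union of the nonzero sets and negation preserves the nonzero set, so
  every ideal \<open>Q\<close> of subsets of the base cuts out a subgroup. This is used for the sets contained in a
  given one, the sets with finite intersection with each source fiber, and the sets on which only
  finitely many degrees occur.
\<close>

lemma small_support_subgroup:
  assumes "Q {}" "\<And>A B. Q A \<Longrightarrow> B \<subseteq> A \<Longrightarrow> Q B" "\<And>A B. Q A \<Longrightarrow> Q B \<Longrightarrow> Q (A \<union> B)"
  shows "subgroup {\<alpha> \<in> sections P. Q (nonzero_set P \<alpha>)} (add_monoid Sec)"
proof (rule Sec.add.subgroupI)
  show "{\<alpha> \<in> sections P. Q (nonzero_set P \<alpha>)} \<noteq> {}"
    using zero_section assms(1) by (metis (mono_tags, lifting) empty_iff mem_Collect_eq nonzero_set_zero)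
  fix \<alpha> \<beta> assume \<alpha>: "\<alpha> \<in> {\<alpha> \<in> sections P. Q (nonzero_set P \<alpha>)}"
  have "nonzero_set P (\<ominus>\<^bsub>Sec\<^esub> \<alpha>) \<subseteq> nonzero_set P \<alpha>"
  proof
    fix x assume x: "x \<in> nonzero_set P (\<ominus>\<^bsub>Sec\<^esub> \<alpha>)"
    then have xb: "x \<in> base" by (simp add: nonzero_set_def)
    interpret bimodule "fiber P x" using xb by (rule fiber_bimodule)
    show "x \<in> nonzero_set P \<alpha>"
      using x \<alpha> Sec_minus[OF _ xb, of \<alpha>] add.inv_one by (auto simp: nonzero_set_def a_inv_def)
  qed
  then show "\<ominus>\<^bsub>Sec\<^esub> \<alpha> \<in> {\<alpha> \<in> sections P. Q (nonzero_set P \<alpha>)}"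
    using \<alpha> assms(2) Sec.a_inv_closed[of \<alpha>] by auto
  assume "\<beta> \<in> {\<alpha> \<in> sections P. Q (nonzero_set P \<alpha>)}"
  with \<alpha> show "\<alpha> \<oplus>\<^bsub>Sec\<^esub> \<beta> \<in> {\<alpha> \<in> sections P. Q (nonzero_set P \<alpha>)}"
    using assms(2)[OF assms(3) nonzero_set_add] add_section by auto
qed auto

section \<open>Compactly supported sections and the sectional algebra\<close>

text \<open>
  The base need not be Hausdorff, so the closure in the definition of the support may leave \<open>V\<close> and is
  awkward to compute. Inside the Hausdorff set \<open>V\<close>, however, a compact set is closed, and therefore
  contains the part of the support in \<open>V\<close> as soon as it contains the nonzero set.
\<close>

lemma Cc_iff:
  assumes V: "open_Hausdorff base_top V"
  shows "\<alpha> \<in> Cc P V \<longleftrightarrow> \<alpha> \<in> sections P \<and> continuous_map (subtopology base_top V) total_top \<alpha> \<and>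
    (\<exists>C. compactin base_top C \<and> C \<subseteq> V \<and> nonzero_set P \<alpha> \<subseteq> C)"
proof
  assume "\<alpha> \<in> Cc P V"
  then have \<alpha>: "\<alpha> \<in> sections P" "\<forall>\<gamma>\<in>base - V. \<alpha> \<gamma> = fzero P \<gamma>"
    "continuous_map (subtopology base_top V) total_top \<alpha>" "compactin base_top (supp P \<alpha> \<inter> V)"
    by (auto simp: Cc_def)
  have "nonzero_set P \<alpha> \<subseteq> V" using \<alpha>(2) by (auto simp: nonzero_set_def)
  moreover have "nonzero_set P \<alpha> \<subseteq> supp P \<alpha>"
    unfolding supp_def nonzero_set_def by (rule closure_of_subset) (auto simp: topspace_base)
  ultimately show "\<alpha> \<in> sections P \<and> continuous_map (subtopology base_top V) total_top \<alpha> \<and>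
    (\<exists>C. compactin base_top C \<and> C \<subseteq> V \<and> nonzero_set P \<alpha> \<subseteq> C)" using \<alpha> by blast
next
  assume "\<alpha> \<in> sections P \<and> continuous_map (subtopology base_top V) total_top \<alpha> \<and>
    (\<exists>C. compactin base_top C \<and> C \<subseteq> V \<and> nonzero_set P \<alpha> \<subseteq> C)"
  then obtain C where \<alpha>: "\<alpha> \<in> sections P" "continuous_map (subtopology base_top V) total_top \<alpha>"
    and C: "compactin base_top C" "C \<subseteq> V" "nonzero_set P \<alpha> \<subseteq> C" by blast
  have closed: "closedin (subtopology base_top V) C"
    using V C unfolding open_Hausdorff_def
    by (intro compactin_imp_closedin) (auto simp: compactin_subtopology)
  have "supp P \<alpha> \<inter> V \<subseteq> subtopology base_top V closure_of nonzero_set P \<alpha>"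
    using C by (auto simp: closure_of_subtopology supp_def nonzero_set_def Int_absorb1)
  also have "\<dots> \<subseteq> C" using closed C(3) by (simp add: closure_of_minimal)
  finally have "supp P \<alpha> \<inter> V = supp P \<alpha> \<inter> C" using C(2) by blast
  moreover have "compactin base_top (supp P \<alpha> \<inter> C)"
    by (rule closed_Int_compactin) (auto simp: supp_def C(1))
  ultimately show "\<alpha> \<in> Cc P V" using \<alpha> C by (auto simp: Cc_def nonzero_set_def)
qed

lemma Cc_sections: "\<alpha> \<in> Cc P V \<Longrightarrow> \<alpha> \<in> sections P"
  by (simp add: Cc_def)

lemma Cc_nonzero: "\<alpha> \<in> Cc P V \<Longrightarrow> nonzero_set P \<alpha> \<subseteq> V"
  by (auto simp: Cc_def nonzero_set_def)

lemma Cc_continuous: "\<alpha> \<in> Cc P V \<Longrightarrow> continuous_map (subtopology base_top V) total_top \<alpha>"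
  by (simp add: Cc_def)

lemma open_Hausdorff_subset:
  "open_Hausdorff base_top V \<Longrightarrow> openin base_top U \<Longrightarrow> U \<subseteq> V \<Longrightarrow> open_Hausdorff base_top U"
  unfolding open_Hausdorff_def
  by (metis Hausdorff_space_subtopology inf.absorb_iff2 subtopology_subtopology)

lemma Cc_scale:
  assumes V: "open_Hausdorff base_top V" and \<alpha>: "\<alpha> \<in> Cc P V"
  shows "(\<lambda>\<gamma>\<in>base. flact P r (\<alpha> \<gamma>)) \<in> Cc P V" "(\<lambda>\<gamma>\<in>base. fract P (\<alpha> \<gamma>) r) \<in> Cc P V"
proof -
  have top: "topspace (subtopology base_top V) \<subseteq> base" by (simp add: topspace_base)
  have "continuous_map (subtopology base_top V) total_top (\<lambda>\<gamma>. flact P r (\<alpha> \<gamma>))"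
    "continuous_map (subtopology base_top V) total_top (\<lambda>\<gamma>. fract P (\<alpha> \<gamma>) r)"
    using continuous_map_compose[OF Cc_continuous[OF \<alpha>] continuous_flact_at]
     continuous_map_compose[OF Cc_continuous[OF \<alpha>] continuous_fract_at] by (auto simp: o_def)
  then have c: "continuous_map (subtopology base_top V) total_top (\<lambda>\<gamma>\<in>base. flact P r (\<alpha> \<gamma>))"
    "continuous_map (subtopology base_top V) total_top (\<lambda>\<gamma>\<in>base. fract P (\<alpha> \<gamma>) r)"
    using top by (auto elim!: continuous_map_eq)
  have n: "nonzero_set P (\<lambda>\<gamma>\<in>base. flact P r (\<alpha> \<gamma>)) \<subseteq> nonzero_set P \<alpha>"
    "nonzero_set P (\<lambda>\<gamma>\<in>base. fract P (\<alpha> \<gamma>) r) \<subseteq> nonzero_set P \<alpha>"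
    by (auto simp: nonzero_set_def fiber_act_zero)
  show "(\<lambda>\<gamma>\<in>base. flact P r (\<alpha> \<gamma>)) \<in> Cc P V" "(\<lambda>\<gamma>\<in>base. fract P (\<alpha> \<gamma>) r) \<in> Cc P V"
    using \<alpha> c n act_section unfolding Cc_iff[OF V] by blast+
qed

definition Cc_union :: "('g \<Rightarrow> 'l) set" where
  "Cc_union = (\<Union>V\<in>{V. open_Hausdorff base_top V}. Cc P V)"

lemma Cc_union_sections: "Cc_union \<subseteq> carrier Sec"
  using Cc_sections by (auto simp: Cc_union_def)

text \<open>
  Scalars preserve each \<open>C\<^sub>c(V)\<close>, so the subgroup generated by these sets is already a sub-bimodule.
\<close>

lemma Alg_carrier: "carrier Alg = additive_span Sec Cc_union"
proof -
  let ?S = "additive_span Sec Cc_union"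
  have sub: "subgroup ?S (add_monoid Sec)"
    by (rule Sec.additive_span_subgroup[OF Cc_union_sections])
  have full: "subgroup (carrier Sec) (add_monoid Sec)" using Sec.add.subgroup_self by simp
  have "lact Sec r \<alpha> \<in> ?S" "ract Sec \<alpha> r \<in> ?S" if "\<alpha> \<in> ?S" for r \<alpha>
  proof -
    show "lact Sec r \<alpha> \<in> ?S"
    proof (rule additive_span_image_subset[OF Sec_abelian_group Sec_abelian_group full
          Cc_union_sections _ _ sub _ that])
      show "lact Sec r (x \<oplus>\<^bsub>Sec\<^esub> y) = lact Sec r x \<oplus>\<^bsub>Sec\<^esub> lact Sec r y"
        if "x \<in> carrier Sec" "y \<in> carrier Sec" for x y
        using that sections_mem
        by (auto intro!: restrict_ext fiber_act_add(1) simp del: fiber_simps)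
      show "lact Sec r x \<in> ?S" if "x \<in> Cc_union" for x
        using that by (intro additive_span_superset) (auto simp: Cc_union_def intro: Cc_scale)
      show "lact Sec r x \<in> carrier Sec" if "x \<in> carrier Sec" for x
        unfolding Sec_simps by (rule act_section(1)) (use that in simp)
    qed
    show "ract Sec \<alpha> r \<in> ?S"
    proof (rule additive_span_image_subset[where \<phi> = "\<lambda>x. ract Sec x r",
            OF Sec_abelian_group Sec_abelian_group full
          Cc_union_sections _ _ sub _ that])
      show "ract Sec (x \<oplus>\<^bsub>Sec\<^esub> y) r = ract Sec x r \<oplus>\<^bsub>Sec\<^esub> ract Sec y r"
        if "x \<in> carrier Sec" "y \<in> carrier Sec" for x y
        using that sections_mem
        by (auto intro!: restrict_ext fiber_act_add(2) simp del: fiber_simps)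
      show "ract Sec x r \<in> ?S" if "x \<in> Cc_union" for x
        using that by (intro additive_span_superset) (auto simp: Cc_union_def intro: Cc_scale)
    qed (simp_all add: act_section)
  qed
  then have "sub_bimodule ?S Sec" unfolding sub_bimodule_def using sub by blast
  then have "bimodule_generated Sec Cc_union \<subseteq> ?S"
    unfolding bimodule_generated_def using additive_span_superset[of _ Cc_union] by blast
  moreover have "?S \<subseteq> bimodule_generated Sec Cc_union"
    unfolding bimodule_generated_def sub_bimodule_def
    using Sec.additive_span_minimal by blast
  ultimately show ?thesis
    by (simp add: sectional_algebra_def Cc_union_def)
qed

lemma Alg_subgroup: "subgroup (carrier Alg) (add_monoid Sec)"
  unfolding Alg_carrier by (rule Sec.additive_span_subgroup[OF Cc_union_sections])

lemma Alg_sections: "\<alpha> \<in> carrier Alg \<Longrightarrow> \<alpha> \<in> sections P"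
  using subgroup.subset[OF Alg_subgroup] by auto

lemma Alg_add_monoid: "add_monoid Alg = (add_monoid Sec)\<lparr>carrier := carrier Alg\<rparr>"
  by simp

lemma Alg_abelian_group: "abelian_group Alg"
proof -
  have g: "group (add_monoid Alg)"
    unfolding Alg_add_monoid by (rule Sec.add.subgroup_imp_group[OF Alg_subgroup])
  show ?thesis
  proof (rule comm_group_abelian_groupI, rule group.group_comm_groupI[OF g])
    fix x y assume "x \<in> carrier (add_monoid Alg)" "y \<in> carrier (add_monoid Alg)"
    then show "x \<otimes>\<^bsub>add_monoid Alg\<^esub> y = y \<otimes>\<^bsub>add_monoid Alg\<^esub> x"
      using Sec.a_comm[of x y] Alg_sections by simp
  qed
qed

sublocale Alg: abelian_group "sectional_algebra P" by (rule Alg_abelian_group)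

lemma Alg_span:
  assumes "X \<subseteq> carrier Alg"
  shows "additive_span Alg X = additive_span Sec X"
  unfolding additive_span_def Alg_add_monoid
  by (rule Sec.add.generate_consistent[OF assms Alg_subgroup])

lemma subgroup_Alg_iff:
  assumes "H \<subseteq> carrier Alg"
  shows "subgroup H (add_monoid Alg) \<longleftrightarrow> subgroup H (add_monoid Sec)"
  unfolding Alg_add_monoid
  using Sec.add.subgroup_incl[OF _ Alg_subgroup assms] Sec.add.incl_subgroup[OF Alg_subgroup]
  by blast

lemma Cc_Alg: "open_Hausdorff base_top V \<Longrightarrow> \<alpha> \<in> Cc P V \<Longrightarrow> \<alpha> \<in> carrier Alg"
  unfolding Alg_carrier by (rule additive_span_superset) (auto simp: Cc_union_def)

lemma Alg_mem_subgroup: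
  assumes "subgroup H (add_monoid Sec)"
    and "\<And>V \<alpha>. open_Hausdorff base_top V \<Longrightarrow> \<alpha> \<in> Cc P V \<Longrightarrow> \<alpha> \<in> H"
    and "\<alpha> \<in> carrier Alg"
  shows "\<alpha> \<in> H"
  using assms Sec.additive_span_minimal[of Cc_union H] unfolding Alg_carrier Cc_union_def by blast

lemma finsum_Alg_eval:
  assumes "finite F" "\<And>i. i \<in> F \<Longrightarrow> f i \<in> carrier Alg" "\<gamma> \<in> base"
  shows "finsum Alg f F \<gamma> = finsum (fiber P \<gamma>) (\<lambda>i. f i \<gamma>) F"
  using assms(1,2)
proof (induction F)
  case empty
  interpret bimodule "fiber P \<gamma>" using assms(3) by (rule fiber_bimodule)
  show ?case using assms(3) by simp
next
  case (insert i F)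
  interpret bimodule "fiber P \<gamma>" using assms(3) by (rule fiber_bimodule)
  have "\<And>j. j \<in> insert i F \<Longrightarrow> f j \<gamma> \<in> carrier (fiber P \<gamma>)"
    using insert.prems Alg_sections sections_mem assms(3) by blast
  then show ?case
    using insert assms(3) by (subst Alg.finsum_insert, simp, simp, simp add: Pi_iff, simp,
       subst finsum_insert) auto
qed

end

section \<open>Open sets with injective source in an etale semigroupoid\<close>

text \<open>
  One half of the notion of an open bisection: nothing is required of the range map. Injectivity of
  the source is what makes factorizations with both factors in given sets unique.
\<close>

definition source_section :: "('a, 'v, 'm) top_semigroupoid_scheme \<Rightarrow> 'a set \<Rightarrow> bool" where
  "source_section S W \<longleftrightarrow> openin (arrow_top S) W \<and> openin (vertex_top S) (src S ` W) \<and>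
     homeomorphic_map (subtopology (arrow_top S) W) (subtopology (vertex_top S) (src S ` W)) (src S)"

lemma source_section_inj:
  assumes "source_section S W" shows "inj_on (src S) W"
proof -
  have "W \<subseteq> topspace (arrow_top S)" using assms by (simp add: source_section_def openin_subset)
  then show ?thesis using assms homeomorphic_imp_injective_map
    unfolding source_section_def by (metis topspace_subtopology_subset)
qed

lemma source_section_open_image:
  assumes "source_section S W" "openin (arrow_top S) O'" "O' \<subseteq> W"
  shows "openin (vertex_top S) (src S ` O')"
proof -
  have "openin (subtopology (arrow_top S) W) O'" using assms(2,3)
    by (metis inf.absorb_iff1 openin_subtopology_Int)
  then have "openin (subtopology (vertex_top S) (src S ` W)) (src S ` O')"
    using assms(1) homeomorphic_imp_open_map unfolding source_section_def open_map_def by blast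
  then show ?thesis using assms(1) openin_trans_full unfolding source_section_def by blast
qed

lemma source_section_subset:
  assumes W: "source_section S W" and "openin (arrow_top S) O'" "O' \<subseteq> W"
  shows "source_section S O'"
proof -
  have "homeomorphic_map (subtopology (subtopology (arrow_top S) W) O')
      (subtopology (subtopology (vertex_top S) (src S ` W)) (src S ` O')) (src S)"
  proof (rule homeomorphic_map_subtopologies)
    show "homeomorphic_map (subtopology (arrow_top S) W)
        (subtopology (vertex_top S) (src S ` W)) (src S)"
      using W by (simp add: source_section_def)
    have "O' \<subseteq> topspace (arrow_top S)" "src S ` W \<subseteq> topspace (vertex_top S)"
      using W assms by (simp_all add: source_section_def openin_subset)
    then show "src S ` (topspace (subtopology (arrow_top S) W) \<inter> O') =
        topspace (subtopology (vertex_top S) (src S ` W)) \<inter> src S ` O'"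
      using assms(3) by auto
  qed
  moreover have "W \<inter> O' = O'" "src S ` W \<inter> src S ` O' = src S ` O'" using assms(3) by auto
  ultimately show ?thesis
    using assms(2) source_section_open_image[OF assms]
    by (simp add: source_section_def subtopology_subtopology)
qed

lemma source_section_inverse:
  assumes W: "source_section S W"
  obtains h where "continuous_map (subtopology (vertex_top S) (src S ` W)) (arrow_top S) h"
    "\<And>a. a \<in> W \<Longrightarrow> h (src S a) = a"
proof -
  have "W \<subseteq> topspace (arrow_top S)" using assms by (simp add: source_section_def openin_subset)
  moreover obtain h where "homeomorphic_maps (subtopology (arrow_top S) W)
      (subtopology (vertex_top S) (src S ` W)) (src S) h"
    using W unfolding source_section_def homeomorphic_map_maps by blast
  ultimately show ?thesis
    by (intro that[of h]) (auto simp: homeomorphic_maps_def intro: continuous_map_into_fulltopology)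
qed

context etale_semigroupoid
begin

lemma source_section_exists:
  assumes "openin (arrow_top S) U" "x \<in> U"
  obtains W where "source_section S W" "x \<in> W" "W \<subseteq> U"
proof -
  have "x \<in> topspace (arrow_top S)" using assms openin_subset by blast
  then obtain W V where W: "openin (arrow_top S) W" "x \<in> W" "openin (vertex_top S) V"
    "homeomorphic_map (subtopology (arrow_top S) W) (subtopology (vertex_top S) V) (src S)"
    using local_homeomorphism_src unfolding local_homeomorphism_def by blast
  have "src S ` W = V"
    using homeomorphic_imp_surjective_map[OF W(4)] W(1,3)
    by (metis openin_subset topspace_subtopology_subset)
  then have "source_section S W" using W by (simp add: source_section_def)
  then have "source_section S (W \<inter> U)"
    by (rule source_section_subset) (use W assms in auto)
  then show ?thesis using that W assms by blast
qed

lemma inj_src_open_Hausdorff: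
  assumes "openin (arrow_top S) W" "inj_on (src S) W"
  shows "open_Hausdorff (arrow_top S) W"
  unfolding open_Hausdorff_def
proof
  show "Hausdorff_space (subtopology (arrow_top S) W)"
  proof (rule Hausdorff_space_injective_preimage)
    show "continuous_map (subtopology (arrow_top S) W) (vertex_top S) (src S)"
      by (rule continuous_map_from_subtopology) (rule continuous_src)
    show "inj_on (src S) (topspace (subtopology (arrow_top S) W))"
      using assms(2) by (auto intro: inj_on_subset)
  qed (rule Hausdorff_vertices)
qed (rule assms(1))

lemma source_section_open_Hausdorff:
  "source_section S W \<Longrightarrow> open_Hausdorff (arrow_top S) W"
  by (rule inj_src_open_Hausdorff) (simp_all add: source_section_inj, simp add: source_section_def)

text \<open>
  Compact neighbourhoods are lifted from the vertex space along a local inverse of the source map.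
\<close>

lemma compact_neighbourhood:
  assumes "openin (arrow_top S) U" "x \<in> U"
  obtains A C where "openin (arrow_top S) A" "compactin (arrow_top S) C" "x \<in> A" "A \<subseteq> C" "C \<subseteq> U"
proof -
  obtain W where W: "source_section S W" "x \<in> W" "W \<subseteq> U"
    using source_section_exists[OF assms] .
  then have Wt: "W \<subseteq> topspace (arrow_top S)" by (simp add: source_section_def openin_subset)
  obtain h where h: "continuous_map (subtopology (vertex_top S) (src S ` W)) (arrow_top S) h"
    "\<And>a. a \<in> W \<Longrightarrow> h (src S a) = a"
    using source_section_inverse[OF W(1)] by blast
  have "openin (vertex_top S) (src S ` W)" using W by (simp add: source_section_def)
  then obtain A K where K: "openin (vertex_top S) A" "compact_space (subtopology (vertex_top S) K)"
    "src S x \<in> A" "A \<subseteq> K" "K \<subseteq> src S ` W"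
    using locally_compact_vertices W(2) unfolding locally_in_def neighbourhood_base_of
    by (metis imageI)
  have "K \<subseteq> topspace (vertex_top S)"
    using K(5) \<open>openin (vertex_top S) (src S ` W)\<close> openin_subset by blast
  then have "compactin (vertex_top S) K" using K(2) unfolding compactin_subspace by blast
  then have "compactin (subtopology (vertex_top S) (src S ` W)) K"
    using K(5) unfolding compactin_subtopology by blast
  then have C: "compactin (arrow_top S) (h ` K)" by (rule image_compactin) (rule h(1))
  have "openin (arrow_top S) {a \<in> W. src S a \<in> A}"
    by (rule openin_continuous_map_preimage_gen[OF continuous_src]) (use W K in \<open>auto simp: source_section_def\<close>)
  moreover have "{a \<in> W. src S a \<in> A} \<subseteq> h ` K"
  proof
    fix a assume "a \<in> {a \<in> W. src S a \<in> A}"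
    then show "a \<in> h ` K" using K(4) h(2)[of a] by (metis (no_types, lifting) imageI mem_Collect_eq subsetD)
  qed
  moreover have "h ` K \<subseteq> U"
  proof -
    have "h ` K \<subseteq> h ` src S ` W" using K(5) by (rule image_mono)
    also have "\<dots> = W" using h(2) by (simp add: image_image cong: image_cong_simp)
    finally show ?thesis using W(3) by (rule order_trans)
  qed
  ultimately show ?thesis using that C K(3) W(2) by blast
qed

text \<open>
  A source fiber is closed, because points of the vertex space are closed, and discrete, because the
  source map is locally injective.
\<close>

lemma finite_compact_source_fiber:
  assumes C: "compactin (arrow_top S) C"
  shows "finite {a \<in> C. src S a = v}"
proof (cases "v \<in> topspace (vertex_top S)")
  case True
  then have "closedin (arrow_top S) {a \<in> topspace (arrow_top S). src S a \<in> {v}}"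
    by (intro closedin_continuous_map_preimage[OF continuous_src] closedin_Hausdorff_singleton
        Hausdorff_vertices)
  then have "compactin (arrow_top S) ({a \<in> topspace (arrow_top S). src S a \<in> {v}} \<inter> C)"
    by (rule closed_Int_compactin) (rule C)
  moreover have "{a \<in> topspace (arrow_top S). src S a \<in> {v}} \<inter> C = {a \<in> C. src S a = v}"
    using compactin_subset_topspace[OF C] by auto
  ultimately have K: "compactin (arrow_top S) {a \<in> C. src S a = v}" by simp
  have "{a \<in> C. src S a = v} \<inter> arrow_top S derived_set_of {a \<in> C. src S a = v} = {}"
  proof (rule ccontr)
    assume "\<not> ?thesis"
    then obtain x where x: "x \<in> C" "src S x = v" "x \<in> arrow_top S derived_set_of {a \<in> C. src S a = v}"
      by blast
    obtain W where W: "source_section S W" "x \<in> W"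
      using source_section_exists[OF openin_topspace] x(1) compactin_subset_topspace[OF C] by blast
    then obtain y where "y \<noteq> x" "src S y = v" "y \<in> W"
      using x(3) unfolding in_derived_set_of source_section_def by blast
    then show False using source_section_inj[OF W(1)] W(2) x(2) by (auto dest: inj_onD)
  qed
  then show ?thesis using K discrete_compactin_eq_finite by blast
next
  case False
  then have "{a \<in> C. src S a = v} = {}"
    using compactin_subset_topspace[OF C] continuous_src
    by (auto simp: continuous_map_def)
  then show ?thesis by (metis finite.emptyI)
qed

text \<open>
  Functions separating closed sets are available only on a small neighbourhood \<open>N\<close> of \<open>x\<close>. The function
  taken there vanishes on \<open>N\<close> outside a compact subset \<open>C\<close> of its interior; as \<open>U\<close> is Hausdorff, \<open>C\<close> is closed
  in \<open>U\<close>, and the extension by zero to \<open>U\<close> is continuous.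
\<close>

lemma locally_R_normal_bump:
  assumes R: "locally_in (R_normal TYPE('r::unital_topological_ring)) (arrow_top S)"
    and U: "open_Hausdorff (arrow_top S) U" and W: "openin (arrow_top S) W" "x \<in> W" "W \<subseteq> U"
  obtains f :: "'a \<Rightarrow> 'r::unital_topological_ring" and D C
  where "continuous_map (subtopology (arrow_top S) U) euclidean f"
    "openin (arrow_top S) D" "x \<in> D" "compactin (arrow_top S) C" "C \<subseteq> W"
    "\<And>a. a \<in> D \<Longrightarrow> f a = 1" "\<And>a. a \<in> U - C \<Longrightarrow> f a = 0"
proof -
  let ?X = "arrow_top S"
  obtain A1 N where N: "openin ?X A1" "R_normal TYPE('r) (subtopology ?X N)" "x \<in> A1"
    "A1 \<subseteq> N" "N \<subseteq> W"
    using R W unfolding locally_in_def neighbourhood_base_of by meson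
  obtain A2 C where C: "openin ?X A2" "compactin ?X C" "x \<in> A2" "A2 \<subseteq> C" "C \<subseteq> A1"
    using compact_neighbourhood[OF N(1,3)] .
  obtain A3 D where D: "openin ?X A3" "compactin ?X D" "x \<in> A3" "A3 \<subseteq> D" "D \<subseteq> A2"
    using compact_neighbourhood[OF C(1,3)] .
  have NU: "N \<subseteq> U" using N W by blast
  have Ut: "U \<subseteq> topspace ?X" using U by (simp add: open_Hausdorff_def openin_subset)
  have HU: "Hausdorff_space (subtopology ?X U)" using U by (simp add: open_Hausdorff_def)
  have HN: "Hausdorff_space (subtopology ?X N)"
    using Hausdorff_space_subtopology[OF HU, of N] NU
    by (simp add: subtopology_subtopology Int_absorb1)
  have "closedin (subtopology ?X N) D"
    by (rule compactin_imp_closedin[OF HN]) (use D C N in \<open>auto simp: compactin_subtopology\<close>)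
  moreover have "closedin (subtopology ?X N) (N - A2)"
  proof -
    have "openin (subtopology ?X N) (N \<inter> A2)" using C(1) by (rule openin_subtopology_Int2)
    then have "closedin (subtopology ?X N) (topspace (subtopology ?X N) - N \<inter> A2)"
      by (rule openin_closedin_eq[THEN iffD1, THEN conjunct2])
    moreover have "topspace (subtopology ?X N) - N \<inter> A2 = N - A2" using NU Ut by auto
    ultimately show ?thesis by simp
  qed
  moreover have "(N - A2) \<inter> D = {}" using D by auto
  ultimately obtain f :: "'a \<Rightarrow> 'r" where f: "continuous_map (subtopology ?X N) euclidean f"
    "\<forall>a\<in>N - A2. f a = 0" "\<forall>a\<in>D. f a = 1"
    using N(2) unfolding R_normal_def by meson
  \<comment> \<open>The open sets \<open>A1\<close> and \<open>U - C\<close> cover \<open>U\<close>,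
    and \<open>f\<close> vanishes on their intersection.\<close>
  define f' where "f' a = (if a \<in> A1 then f a else 0)" for a
  have clC: "closedin (subtopology ?X U) C"
    by (rule compactin_imp_closedin[OF HU]) (use C N NU in \<open>auto simp: compactin_subtopology\<close>)
  have "continuous_map (subtopology ?X U) euclidean f'"
  proof (rule pasting_lemma[where I = "UNIV::bool set" and T = "\<lambda>b. if b then A1 else U - C"
        and f = "\<lambda>b. if b then f else (\<lambda>_. 0)"])
    fix i :: bool
    have "openin (subtopology ?X U) A1" using N NU
      by (metis inf.absorb_iff1 openin_subtopology_Int order_trans)
    moreover have "openin (subtopology ?X U) (U - C)"
      using clC Ut unfolding closedin_def by (simp add: Int_absorb1)
    ultimately show "openin (subtopology ?X U) (if i then A1 else U - C)" by simp
    have "continuous_map (subtopology ?X A1) euclidean f"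
      using f(1) N(4) by (rule continuous_map_from_subtopology_mono)
    moreover have "U \<inter> A1 = A1" using N NU by auto
    ultimately show "continuous_map (subtopology (subtopology ?X U) (if i then A1 else U - C)) euclidean
        (if i then f else (\<lambda>_. 0))" by (simp add: subtopology_subtopology)
  next
    fix i j :: bool and a
    assume "a \<in> topspace (subtopology ?X U) \<inter> (if i then A1 else U - C) \<inter> (if j then A1 else U - C)"
    then show "(if i then f else (\<lambda>_. 0)) a = (if j then f else (\<lambda>_. 0)) a"
      using f(2) N(4) C(4) by (auto split: if_splits)
  next
    fix a assume "a \<in> topspace (subtopology ?X U)"
    then have "a \<in> U" by simp
    then show "\<exists>j. j \<in> UNIV \<and> a \<in> (if j then A1 else U - C) \<and> f' a = (if j then f else (\<lambda>_. 0)) a"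
      using C(5) by (cases "a \<in> A1") (auto simp: f'_def intro: exI[of _ True] exI[of _ False])
  qed
  moreover have "f' a = 1" if "a \<in> A3" for a
  proof -
    have "a \<in> D" "a \<in> A1" using that D C by blast+
    then show ?thesis using f(3) by (simp add: f'_def)
  qed
  moreover have "f' a = 0" if "a \<in> U - C" for a
    using that f(2) N(4) C(4) by (auto simp: f'_def)
  moreover have "C \<subseteq> W" using C N by auto
  ultimately show ?thesis using that[of f' A3 C] D C by blast
qed

end

section \<open>Convolution\<close>

context R_bundle
begin

lemma mul_fiber:
  assumes "composable (base_sg P) a b" "x \<in> carrier (fiber P a)" "y \<in> carrier (fiber P b)"
  shows "mul (total_sg P) x y \<in> carrier (fiber P (mul (base_sg P) a b))"
    and "composable (total_sg P) x y"
proof -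
  show c: "composable (total_sg P) x y"
    using rigid_proj assms by (auto simp: rigid_hom_def fiber_def)
  show "mul (total_sg P) x y \<in> carrier (fiber P (mul (base_sg P) a b))"
    using semigroupoid.mul_closed[OF semigroupoid_total c] rigid_proj c assms(2,3)
    by (auto simp: rigid_hom_def semigroupoid_hom_def fiber_def)
qed

lemma mul_fzero:
  assumes ab: "composable (base_sg P) a b"
  shows "y \<in> carrier (fiber P b) \<Longrightarrow>
      mul (total_sg P) (fzero P a) y = fzero P (mul (base_sg P) a b)"
    and "x \<in> carrier (fiber P a) \<Longrightarrow>
      mul (total_sg P) x (fzero P b) = fzero P (mul (base_sg P) a b)"
proof -
  have base: "a \<in> arrows (base_sg P)" "b \<in> arrows (base_sg P)"
    "mul (base_sg P) a b \<in> arrows (base_sg P)"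
    using ab semigroupoid.mul_closed[OF semigroupoid_base ab] by (auto simp: composable_def)
  interpret A: bimodule "fiber P a" using base(1) by (rule bimodule_fiber)
  interpret B: bimodule "fiber P b" using base(2) by (rule bimodule_fiber)
  interpret C: bimodule "fiber P (mul (base_sg P) a b)" using base(3) by (rule bimodule_fiber)
  have A0: "fzero P a \<in> carrier (fiber P a)" "fadd P (fzero P a) (fzero P a) = fzero P a"
    using A.zero_closed A.l_zero[OF A.zero_closed] by (simp_all add: fiber_def)
  have B0: "fzero P b \<in> carrier (fiber P b)" "fadd P (fzero P b) (fzero P b) = fzero P b"
    using B.zero_closed B.l_zero[OF B.zero_closed] by (simp_all add: fiber_def)
  {
    assume y: "y \<in> carrier (fiber P b)"
    let ?z = "mul (total_sg P) (fzero P a) y"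
    have "?z \<oplus>\<^bsub>fiber P (mul (base_sg P) a b)\<^esub> ?z = ?z"
      using mul_add_left[OF ab A0(1) A0(1) y] A0(2) by (simp add: fiber_def)
    then have "?z = \<zero>\<^bsub>fiber P (mul (base_sg P) a b)\<^esub>"
      using mul_fiber(1)[OF ab A0(1) y] by (metis C.add.l_cancel_one)
    then show "?z = fzero P (mul (base_sg P) a b)" by (simp add: fiber_def)
  }
  {
    assume x: "x \<in> carrier (fiber P a)"
    let ?z = "mul (total_sg P) x (fzero P b)"
    have "?z \<oplus>\<^bsub>fiber P (mul (base_sg P) a b)\<^esub> ?z = ?z"
      using mul_add_right[OF ab x B0(1) B0(1)] B0(2) by (simp add: fiber_def)
    then have "?z = \<zero>\<^bsub>fiber P (mul (base_sg P) a b)\<^esub>"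
      using mul_fiber(1)[OF ab x B0(1)] by (metis C.add.l_cancel_one)
    then show "?z = fzero P (mul (base_sg P) a b)" by (simp add: fiber_def)
  }
qed

end

sublocale continuous_R_bundle \<subseteq> bimodule_bundle P
proof (rule bimodule_bundle.intro)
  show "topspace (arrow_top (base_sg P)) = arrows (base_sg P)"
    by (rule topological_semigroupoid.topspace_arrow_top[OF topological_base])
  show total: "topspace (arrow_top (total_sg P)) = arrows (total_sg P)"
    by (rule topological_semigroupoid.topspace_arrow_top[OF topological_total])
  fix r :: 'r
  have "continuous_map (arrow_top (total_sg P)) (prod_topology euclidean (arrow_top (total_sg P)))
      (\<lambda>x. (r, x))"
    by (intro continuous_map_pairedI) auto
  from continuous_map_compose[OF this continuous_flact]
  show "continuous_map (arrow_top (total_sg P)) (arrow_top (total_sg P)) (flact P r)"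
    by (simp add: o_def)
  have "continuous_map (arrow_top (total_sg P)) (prod_topology (arrow_top (total_sg P)) euclidean)
      (\<lambda>x. (x, r))"
    by (intro continuous_map_pairedI) auto
  from continuous_map_compose[OF this continuous_fract]
  show "continuous_map (arrow_top (total_sg P)) (arrow_top (total_sg P)) (\<lambda>x. fract P x r)"
    by (simp add: o_def)
qed (rule bimodule_fiber)

context continuous_R_bundle
begin

abbreviation factorizations :: "'g \<Rightarrow> ('g \<times> 'g) set" where
  "factorizations \<gamma> \<equiv> {(a, b). composable (base_sg P) a b \<and> mul (base_sg P) a b = \<gamma>}"

text \<open>
  The sections whose convolution is a finite sum: a factorization \<open>ab = \<gamma>\<close> with nonzero contribution has
  \<open>b\<close> in the source fiber of \<open>\<gamma>\<close>, and then \<open>a\<close> in the source fiber over the range of \<open>b\<close>.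
\<close>

definition source_finite :: "('g \<Rightarrow> 'l) set" where
  "source_finite = {\<alpha> \<in> sections P.
     \<forall>v. finite {\<gamma> \<in> nonzero_set P \<alpha>. src (base_sg P) \<gamma> = v}}"

lemma source_finite_subgroup: "subgroup source_finite (add_monoid Sec)"
  unfolding source_finite_def
proof (rule small_support_subgroup)
  fix A B :: "'g set"
  assume A: "\<forall>v. finite {\<gamma> \<in> A. src (base_sg P) \<gamma> = v}"
  show "\<forall>v. finite {\<gamma> \<in> B. src (base_sg P) \<gamma> = v}" if "B \<subseteq> A"
    using A that by (auto intro: finite_subset[rotated])
  assume B: "\<forall>v. finite {\<gamma> \<in> B. src (base_sg P) \<gamma> = v}"
  have "{\<gamma> \<in> A \<union> B. src (base_sg P) \<gamma> = v} =
      {\<gamma> \<in> A. src (base_sg P) \<gamma> = v} \<union> {\<gamma> \<in> B. src (base_sg P) \<gamma> = v}" for v by blast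
  then show "\<forall>v. finite {\<gamma> \<in> A \<union> B. src (base_sg P) \<gamma> = v}" using A B by simp
qed simp

lemma source_finite_sections: "\<alpha> \<in> source_finite \<Longrightarrow> \<alpha> \<in> sections P"
  by (simp add: source_finite_def)

definition nonzero_factorizations :: "('g \<Rightarrow> 'l) \<Rightarrow> ('g \<Rightarrow> 'l) \<Rightarrow> 'g \<Rightarrow> ('g \<times> 'g) set" where
  "nonzero_factorizations \<alpha> \<beta> \<gamma> =
    {(a, b) \<in> factorizations \<gamma>. a \<in> nonzero_set P \<alpha> \<and> b \<in> nonzero_set P \<beta>}"

lemma finite_nonzero_factorizations:
  assumes "\<alpha> \<in> source_finite" "\<beta> \<in> source_finite"
  shows "finite (nonzero_factorizations \<alpha> \<beta> \<gamma>)"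
proof (rule finite_subset)
  let ?B = "{b \<in> nonzero_set P \<beta>. src (base_sg P) b = src (base_sg P) \<gamma>}"
  let ?A = "\<lambda>b. {a \<in> nonzero_set P \<alpha>. src (base_sg P) a = rng (base_sg P) b}"
  show "nonzero_factorizations \<alpha> \<beta> \<gamma> \<subseteq> (\<lambda>(b, a). (a, b)) ` (SIGMA b:?B. ?A b)"
    using semigroupoid.src_mul[OF semigroupoid_base]
    by (force simp: nonzero_factorizations_def composable_def image_iff)
  show "finite ((\<lambda>(b, a). (a, b)) ` (SIGMA b:?B. ?A b))"
    using assms by (intro finite_imageI finite_SigmaI) (simp_all add: source_finite_def)
qed

lemma factor_term_closed:
  assumes "\<alpha> \<in> sections P" "\<beta> \<in> sections P" "p \<in> factorizations \<gamma>"
  shows "(\<lambda>(a, b). mul (total_sg P) (\<alpha> a) (\<beta> b)) p \<in> carrier (fiber P \<gamma>)"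
proof -
  obtain a b where p: "p = (a, b)" "composable (base_sg P) a b" "mul (base_sg P) a b = \<gamma>"
    using assms(3) by auto
  then have "a \<in> base" "b \<in> base" by (simp_all add: composable_def)
  then show ?thesis
    using mul_fiber(1)[OF p(2) sections_mem[OF assms(1)] sections_mem[OF assms(2)]] p by simp
qed

text \<open>
  The freedom in choosing \<open>F\<close> allows several convolutions to be evaluated over one index set, as in the
  proof of biadditivity.
\<close>

lemma convolution_eq:
  assumes \<alpha>: "\<alpha> \<in> sections P" and \<beta>: "\<beta> \<in> sections P" and \<gamma>: "\<gamma> \<in> base"
    and F: "finite F" "F \<subseteq> factorizations \<gamma>" "nonzero_factorizations \<alpha> \<beta> \<gamma> \<subseteq> F"
  shows "convolution P \<alpha> \<beta> \<gamma> = finsum (fiber P \<gamma>) (\<lambda>(a, b). mul (total_sg P) (\<alpha> a) (\<beta> b)) F"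
proof -
  interpret bimodule "fiber P \<gamma>" using \<gamma> by (rule fiber_bimodule)
  have "fsum (fiber P \<gamma>) (\<lambda>(a, b). mul (total_sg P) (\<alpha> a) (\<beta> b)) (factorizations \<gamma>) =
      finsum (fiber P \<gamma>) (\<lambda>(a, b). mul (total_sg P) (\<alpha> a) (\<beta> b)) F"
  proof (rule fsum_eq_finsum[OF F(1,2)])
    fix p assume p: "p \<in> factorizations \<gamma> - F"
    then obtain a b where ab: "p = (a, b)" "composable (base_sg P) a b" "mul (base_sg P) a b = \<gamma>"
      by auto
    then have base: "a \<in> base" "b \<in> base" by (simp_all add: composable_def)
    have "\<alpha> a = fzero P a \<or> \<beta> b = fzero P b"
      using p F(3) ab base by (auto simp: nonzero_factorizations_def nonzero_set_def)
    then show "(\<lambda>(a, b). mul (total_sg P) (\<alpha> a) (\<beta> b)) p = \<zero>\<^bsub>fiber P \<gamma>\<^esub>"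
      using mul_fzero[OF ab(2)] sections_mem[OF \<alpha> base(1)] sections_mem[OF \<beta> base(2)] ab by auto
  next
    show "(\<lambda>(a, b). mul (total_sg P) (\<alpha> a) (\<beta> b)) \<in> F \<rightarrow> carrier (fiber P \<gamma>)"
      using factor_term_closed[OF \<alpha> \<beta>] F(2) by blast
  qed
  then show ?thesis using \<gamma> by (simp add: convolution_def)
qed

lemma convolution_section:
  assumes "\<alpha> \<in> source_finite" "\<beta> \<in> source_finite"
  shows "convolution P \<alpha> \<beta> \<in> sections P"
proof -
  have "convolution P \<alpha> \<beta> \<gamma> \<in> carrier (fiber P \<gamma>)" if \<gamma>: "\<gamma> \<in> base" for \<gamma>
  proof -
    interpret bimodule "fiber P \<gamma>" using \<gamma> by (rule fiber_bimodule)
    have r: "nonzero_factorizations \<alpha> \<beta> \<gamma> \<subseteq> factorizations \<gamma>" by (auto simp: nonzero_factorizations_def)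
    show ?thesis
      using factor_term_closed[of \<alpha> \<beta>] assms source_finite_sections r
      by (subst convolution_eq[OF _ _ \<gamma> finite_nonzero_factorizations[OF assms] r subset_refl])
        (blast intro!: finsum_closed)+
  qed
  then have "restrict (convolution P \<alpha> \<beta>) base \<in> sections P" by (rule sectionsI)
  then show ?thesis by (simp add: convolution_def)
qed

lemma convolution_add:
  assumes \<alpha>: "\<alpha> \<in> source_finite" and \<alpha>': "\<alpha>' \<in> source_finite" and \<beta>: "\<beta> \<in> source_finite"
  shows "convolution P (\<alpha> \<oplus>\<^bsub>Sec\<^esub> \<alpha>') \<beta> = convolution P \<alpha> \<beta> \<oplus>\<^bsub>Sec\<^esub> convolution P \<alpha>' \<beta>"
    and "convolution P \<beta> (\<alpha> \<oplus>\<^bsub>Sec\<^esub> \<alpha>') = convolution P \<beta> \<alpha> \<oplus>\<^bsub>Sec\<^esub> convolution P \<beta> \<alpha>'"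
proof -
  have sum: "\<alpha> \<oplus>\<^bsub>Sec\<^esub> \<alpha>' \<in> source_finite"
    using subgroup.m_closed[OF source_finite_subgroup \<alpha> \<alpha>'] by simp
  note sec = source_finite_sections[OF \<alpha>] source_finite_sections[OF \<alpha>'] source_finite_sections[OF \<beta>]
    source_finite_sections[OF sum]
  show "convolution P (\<alpha> \<oplus>\<^bsub>Sec\<^esub> \<alpha>') \<beta> = convolution P \<alpha> \<beta> \<oplus>\<^bsub>Sec\<^esub> convolution P \<alpha>' \<beta>"
  proof (rule sections_eqI)
    fix \<gamma> assume \<gamma>: "\<gamma> \<in> base"
    interpret bimodule "fiber P \<gamma>" using \<gamma> by (rule fiber_bimodule)
    let ?F = "nonzero_factorizations \<alpha> \<beta> \<gamma> \<union> nonzero_factorizations \<alpha>' \<beta> \<gamma>"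
    have F: "finite ?F" "?F \<subseteq> factorizations \<gamma>"
      using finite_nonzero_factorizations \<alpha> \<alpha>' \<beta> by (auto simp: nonzero_factorizations_def)
    have rel: "nonzero_factorizations (\<alpha> \<oplus>\<^bsub>Sec\<^esub> \<alpha>') \<beta> \<gamma> \<subseteq> ?F"
      using nonzero_set_add[of \<alpha> \<alpha>'] by (auto simp: nonzero_factorizations_def)
    have "convolution P (\<alpha> \<oplus>\<^bsub>Sec\<^esub> \<alpha>') \<beta> \<gamma> =
       finsum (fiber P \<gamma>) (\<lambda>p. (\<lambda>(a, b). mul (total_sg P) (\<alpha> a) (\<beta> b)) p \<oplus>\<^bsub>fiber P \<gamma>\<^esub>
         (\<lambda>(a, b). mul (total_sg P) (\<alpha>' a) (\<beta> b)) p) ?F"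
      unfolding convolution_eq[OF sec(4,3) \<gamma> F rel]
    proof (rule finsum_cong')
      show "(\<lambda>p. (\<lambda>(a, b). mul (total_sg P) (\<alpha> a) (\<beta> b)) p \<oplus>\<^bsub>fiber P \<gamma>\<^esub>
         (\<lambda>(a, b). mul (total_sg P) (\<alpha>' a) (\<beta> b)) p) \<in> ?F \<rightarrow> carrier (fiber P \<gamma>)"
        using factor_term_closed[OF sec(1,3)] factor_term_closed[OF sec(2,3)] F(2)
        by (blast intro!: a_closed)
      fix p assume "p \<in> ?F"
      then obtain a b where ab: "p = (a, b)" "composable (base_sg P) a b" using F(2) by blast
      then have base: "a \<in> base" "b \<in> base" by (simp_all add: composable_def)
      show "(\<lambda>(a, b). mul (total_sg P) ((\<alpha> \<oplus>\<^bsub>Sec\<^esub> \<alpha>') a) (\<beta> b)) p =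
          (\<lambda>(a, b). mul (total_sg P) (\<alpha> a) (\<beta> b)) p \<oplus>\<^bsub>fiber P \<gamma>\<^esub>
          (\<lambda>(a, b). mul (total_sg P) (\<alpha>' a) (\<beta> b)) p"
        using mul_add_left[OF ab(2) sections_mem[OF sec(1) base(1)] sections_mem[OF sec(2) base(1)]
            sections_mem[OF sec(3) base(2)]] ab base by simp
    qed simp
    also have "\<dots> = convolution P \<alpha> \<beta> \<gamma> \<oplus>\<^bsub>fiber P \<gamma>\<^esub> convolution P \<alpha>' \<beta> \<gamma>"
      unfolding convolution_eq[OF sec(1,3) \<gamma> F Un_upper1] convolution_eq[OF sec(2,3) \<gamma> F Un_upper2]
      using factor_term_closed[OF sec(1,3)] factor_term_closed[OF sec(2,3)] F(2)
      by (intro finsum_addf) blast+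
    finally show "convolution P (\<alpha> \<oplus>\<^bsub>Sec\<^esub> \<alpha>') \<beta> \<gamma> =
        (convolution P \<alpha> \<beta> \<oplus>\<^bsub>Sec\<^esub> convolution P \<alpha>' \<beta>) \<gamma>" using \<gamma> by simp
  next
    show "convolution P (\<alpha> \<oplus>\<^bsub>Sec\<^esub> \<alpha>') \<beta> \<in> sections P" by (rule convolution_section[OF sum \<beta>])
    show "convolution P \<alpha> \<beta> \<oplus>\<^bsub>Sec\<^esub> convolution P \<alpha>' \<beta> \<in> sections P"
      unfolding Sec_simps by (intro add_section convolution_section \<alpha> \<alpha>' \<beta>)
  qed
  show "convolution P \<beta> (\<alpha> \<oplus>\<^bsub>Sec\<^esub> \<alpha>') = convolution P \<beta> \<alpha> \<oplus>\<^bsub>Sec\<^esub> convolution P \<beta> \<alpha>'"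
  proof (rule sections_eqI)
    fix \<gamma> assume \<gamma>: "\<gamma> \<in> base"
    interpret bimodule "fiber P \<gamma>" using \<gamma> by (rule fiber_bimodule)
    let ?F = "nonzero_factorizations \<beta> \<alpha> \<gamma> \<union> nonzero_factorizations \<beta> \<alpha>' \<gamma>"
    have F: "finite ?F" "?F \<subseteq> factorizations \<gamma>"
      using finite_nonzero_factorizations \<alpha> \<alpha>' \<beta> by (auto simp: nonzero_factorizations_def)
    have rel: "nonzero_factorizations \<beta> (\<alpha> \<oplus>\<^bsub>Sec\<^esub> \<alpha>') \<gamma> \<subseteq> ?F"
      using nonzero_set_add[of \<alpha> \<alpha>'] by (auto simp: nonzero_factorizations_def)
    have "convolution P \<beta> (\<alpha> \<oplus>\<^bsub>Sec\<^esub> \<alpha>') \<gamma> =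
       finsum (fiber P \<gamma>) (\<lambda>p. (\<lambda>(a, b). mul (total_sg P) (\<beta> a) (\<alpha> b)) p \<oplus>\<^bsub>fiber P \<gamma>\<^esub>
         (\<lambda>(a, b). mul (total_sg P) (\<beta> a) (\<alpha>' b)) p) ?F"
      unfolding convolution_eq[OF sec(3,4) \<gamma> F rel]
    proof (rule finsum_cong')
      show "(\<lambda>p. (\<lambda>(a, b). mul (total_sg P) (\<beta> a) (\<alpha> b)) p \<oplus>\<^bsub>fiber P \<gamma>\<^esub>
         (\<lambda>(a, b). mul (total_sg P) (\<beta> a) (\<alpha>' b)) p) \<in> ?F \<rightarrow> carrier (fiber P \<gamma>)"
        using factor_term_closed[OF sec(3,1)] factor_term_closed[OF sec(3,2)] F(2)
        by (blast intro!: a_closed)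
      fix p assume "p \<in> ?F"
      then obtain a b where ab: "p = (a, b)" "composable (base_sg P) a b" using F(2) by blast
      then have base: "a \<in> base" "b \<in> base" by (simp_all add: composable_def)
      show "(\<lambda>(a, b). mul (total_sg P) (\<beta> a) ((\<alpha> \<oplus>\<^bsub>Sec\<^esub> \<alpha>') b)) p =
          (\<lambda>(a, b). mul (total_sg P) (\<beta> a) (\<alpha> b)) p \<oplus>\<^bsub>fiber P \<gamma>\<^esub>
          (\<lambda>(a, b). mul (total_sg P) (\<beta> a) (\<alpha>' b)) p"
        using mul_add_right[OF ab(2) sections_mem[OF sec(3) base(1)] sections_mem[OF sec(1) base(2)]
            sections_mem[OF sec(2) base(2)]] ab base by simp
    qed simp
    also have "\<dots> = convolution P \<beta> \<alpha> \<gamma> \<oplus>\<^bsub>fiber P \<gamma>\<^esub> convolution P \<beta> \<alpha>' \<gamma>"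
      unfolding convolution_eq[OF sec(3,1) \<gamma> F Un_upper1] convolution_eq[OF sec(3,2) \<gamma> F Un_upper2]
      using factor_term_closed[OF sec(3,1)] factor_term_closed[OF sec(3,2)] F(2)
      by (intro finsum_addf) blast+
    finally show "convolution P \<beta> (\<alpha> \<oplus>\<^bsub>Sec\<^esub> \<alpha>') \<gamma> =
        (convolution P \<beta> \<alpha> \<oplus>\<^bsub>Sec\<^esub> convolution P \<beta> \<alpha>') \<gamma>" using \<gamma> by simp
  next
    show "convolution P \<beta> (\<alpha> \<oplus>\<^bsub>Sec\<^esub> \<alpha>') \<in> sections P" by (rule convolution_section[OF \<beta> sum])
    show "convolution P \<beta> \<alpha> \<oplus>\<^bsub>Sec\<^esub> convolution P \<beta> \<alpha>' \<in> sections P"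
      unfolding Sec_simps by (intro add_section convolution_section \<alpha> \<alpha>' \<beta>)
  qed
qed

end

section \<open>The sectional algebra is closed under convolution\<close>

locale etale_R_bundle = continuous_R_bundle P + etale: etale_semigroupoid "base_sg P"
  for P :: "('l, 'x, 'g, 'v, 'r::unital_topological_ring) bundle_data" +
  assumes locally_R_normal: "locally_in (R_normal TYPE('r)) (arrow_top (base_sg P))"
begin

abbreviation vtop :: "'v topology" where "vtop \<equiv> vertex_top (base_sg P)"

definition source_Cc_union :: "('g \<Rightarrow> 'l) set" where
  "source_Cc_union = (\<Union>W\<in>{W. source_section (base_sg P) W}. Cc P W)"

lemma source_Cc_union_subset: "source_Cc_union \<subseteq> Cc_union"
  using etale.source_section_open_Hausdorff by (auto simp: source_Cc_union_def Cc_union_def)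

text \<open>
  Multiplication by a scalar function \<open>f\<close> moves the support of \<open>\<alpha>\<close> into \<open>C\<close>, hence from \<open>U\<close> into the smaller
  set \<open>W\<close>. The alternative \<open>\<alpha> \<gamma> = 0\<close> is there for the factor \<open>1 - f\<close>, which does not shrink the support.
\<close>

lemma Cc_cutoff:
  fixes f :: "'g \<Rightarrow> 'r"
  assumes U: "open_Hausdorff base_top U" and \<alpha>: "\<alpha> \<in> Cc P U"
    and f: "continuous_map (subtopology base_top U) euclidean f"
    and W: "openin base_top W" "W \<subseteq> U"
    and C: "compactin base_top C" "C \<subseteq> W" "\<And>\<gamma>. \<gamma> \<in> U - C \<Longrightarrow> f \<gamma> = 0 \<or> \<alpha> \<gamma> = fzero P \<gamma>"
  shows "(\<lambda>\<gamma>\<in>base. flact P (f \<gamma>) (\<alpha> \<gamma>)) \<in> Cc P W"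
proof -
  have HW: "open_Hausdorff base_top W" using open_Hausdorff_subset[OF U W] .
  have \<alpha>s: "\<alpha> \<in> sections P" using \<alpha> by (rule Cc_sections)
  have "continuous_map (subtopology base_top U) (prod_topology euclidean total_top)
      (\<lambda>\<gamma>. (f \<gamma>, \<alpha> \<gamma>))"
    using f Cc_continuous[OF \<alpha>] by (rule continuous_map_pairedI)
  from continuous_map_compose[OF this continuous_flact]
  have "continuous_map (subtopology base_top U) total_top (\<lambda>\<gamma>. flact P (f \<gamma>) (\<alpha> \<gamma>))"
    by (simp add: o_def)
  then have "continuous_map (subtopology base_top W) total_top (\<lambda>\<gamma>. flact P (f \<gamma>) (\<alpha> \<gamma>))"
    using W(2) by (rule continuous_map_from_subtopology_mono)
  then have cont: "continuous_map (subtopology base_top W) total_top (\<lambda>\<gamma>\<in>base. flact P (f \<gamma>) (\<alpha> \<gamma>))"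
    by (rule continuous_map_eq) (simp add: topspace_base)
  have "nonzero_set P (\<lambda>\<gamma>\<in>base. flact P (f \<gamma>) (\<alpha> \<gamma>)) \<subseteq> C"
  proof
    fix \<gamma> assume "\<gamma> \<in> nonzero_set P (\<lambda>\<gamma>\<in>base. flact P (f \<gamma>) (\<alpha> \<gamma>))"
    then have b: "\<gamma> \<in> base" and nz: "flact P (f \<gamma>) (\<alpha> \<gamma>) \<noteq> fzero P \<gamma>" by (auto simp: nonzero_set_def)
    have "\<alpha> \<gamma> \<noteq> fzero P \<gamma>" using nz fiber_act_zero(1)[OF b] by auto
    moreover have "f \<gamma> \<noteq> 0" using nz fiber_zero_lact[OF b sections_mem[OF \<alpha>s b]] by auto
    moreover have "\<gamma> \<in> U" using calculation(1) b Cc_nonzero[OF \<alpha>] by (auto simp: nonzero_set_def)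
    ultimately show "\<gamma> \<in> C" using C(3) by blast
  qed
  moreover have "(\<lambda>\<gamma>\<in>base. flact P (f \<gamma>) (\<alpha> \<gamma>)) \<in> sections P"
    by (rule sectionsI, rule fiber_act_closed(1), assumption, rule sections_mem[OF \<alpha>s])
  ultimately show ?thesis using cont C unfolding Cc_iff[OF HW] by blast
qed

text \<open>
  A partition of unity without order or positivity: if \<open>f = 1\<close> on \<open>D\<close>, then in \<open>\<beta> = f \<beta> + (1 - f) \<beta>\<close> the
  first summand is supported on a set with injective source, and the second one vanishes on \<open>D\<close>.
  Finitely many sets \<open>D\<close> cover the compact support, so repeating this leaves the zero section.
\<close>

lemma Cc_in_source_span:
  assumes U: "open_Hausdorff base_top U" and \<alpha>: "\<alpha> \<in> Cc P U"
  shows "\<alpha> \<in> additive_span Sec source_Cc_union"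
proof -
  let ?S = "additive_span Sec source_Cc_union"
  have S: "subgroup ?S (add_monoid Sec)"
    using source_Cc_union_subset Cc_union_sections by (intro Sec.additive_span_subgroup) blast
  define good where "good D \<longleftrightarrow> openin base_top D \<and> (\<exists>W C (f :: 'g \<Rightarrow> 'r). source_section (base_sg P) W \<and> W \<subseteq> U \<and>
      continuous_map (subtopology base_top U) euclidean f \<and> compactin base_top C \<and> C \<subseteq> W \<and>
      (\<forall>\<gamma>\<in>D. f \<gamma> = 1) \<and> (\<forall>\<gamma>\<in>U - C. f \<gamma> = 0))" for D
  have span: "\<beta> \<in> ?S"
    if "finite F" "\<forall>D\<in>F. good D" "\<beta> \<in> Cc P U" "nonzero_set P \<beta> \<subseteq> \<Union>F" for F \<beta>
    using that
  proof (induction F arbitrary: \<beta>)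
    case empty
    then have "\<beta> = \<zero>\<^bsub>Sec\<^esub>" using zero_section_iff Cc_sections by auto
    moreover have "\<zero>\<^bsub>Sec\<^esub> \<in> ?S"
      using subgroup.one_closed[OF S] unfolding monoid.simps .
    ultimately show ?case by metis
  next
    case (insert D F)
    obtain W C and f :: "'g \<Rightarrow> 'r" where W: "source_section (base_sg P) W" "W \<subseteq> U"
      and f: "continuous_map (subtopology base_top U) euclidean f"
      and C: "compactin base_top C" "C \<subseteq> W" and fD: "\<forall>\<gamma>\<in>D. f \<gamma> = 1" "\<forall>\<gamma>\<in>U - C. f \<gamma> = 0"
      using insert.prems(1)[THEN bspec, OF insertI1] unfolding good_def by (elim conjE exE)
    let ?\<beta>1 = "\<lambda>\<gamma>\<in>base. flact P (f \<gamma>) (\<beta> \<gamma>)" and ?\<beta>2 = "\<lambda>\<gamma>\<in>base. flact P (1 - f \<gamma>) (\<beta> \<gamma>)"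
    have \<beta>s: "\<beta> \<in> sections P" using insert.prems(2) by (rule Cc_sections)
    have Wo: "openin base_top W" using W by (simp add: source_section_def)
    have b1: "?\<beta>1 \<in> Cc P W"
      by (rule Cc_cutoff[OF U insert.prems(2) f Wo W(2) C]) (use fD in blast)
    then have S1: "?\<beta>1 \<in> ?S" using W by (intro additive_span_superset) (auto simp: source_Cc_union_def)
    have "continuous_on UNIV (\<lambda>x::'r. 1 - x)" by (intro continuous_intros)
    then have "continuous_map (subtopology base_top U) euclidean ((\<lambda>x. 1 - x) \<circ> f)"
      by (intro continuous_map_compose[OF f]) simp
    then have f': "continuous_map (subtopology base_top U) euclidean (\<lambda>\<gamma>. 1 - f \<gamma>)"
      by (simp add: o_def)
    obtain K where K: "compactin base_top K" "K \<subseteq> U" "nonzero_set P \<beta> \<subseteq> K"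
      using insert.prems(2) unfolding Cc_iff[OF U] by blast
    have Uo: "openin base_top U" using U by (simp add: open_Hausdorff_def)
    have b2: "?\<beta>2 \<in> Cc P U"
    proof (rule Cc_cutoff[OF U insert.prems(2) f' Uo subset_refl K(1,2)])
      fix \<gamma> assume "\<gamma> \<in> U - K"
      moreover have "U \<subseteq> base" using openin_subset[OF Uo] by (simp add: topspace_base)
      ultimately have "\<beta> \<gamma> = fzero P \<gamma>" using K(3) by (auto simp: nonzero_set_def)
      then show "1 - f \<gamma> = 0 \<or> \<beta> \<gamma> = fzero P \<gamma>" by simp
    qed
    have "nonzero_set P ?\<beta>2 \<subseteq> \<Union>F"
    proof
      fix \<gamma> assume \<gamma>: "\<gamma> \<in> nonzero_set P ?\<beta>2"
      then have b: "\<gamma> \<in> base" and nz: "flact P (1 - f \<gamma>) (\<beta> \<gamma>) \<noteq> fzero P \<gamma>" by (auto simp: nonzero_set_def)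
      have "f \<gamma> \<noteq> 1" using nz fiber_zero_lact[OF b sections_mem[OF \<beta>s b]] by auto
      moreover have "\<beta> \<gamma> \<noteq> fzero P \<gamma>" using nz fiber_act_zero(1)[OF b] by auto
      ultimately show "\<gamma> \<in> \<Union>F" using insert.prems(3) fD b by (auto simp: nonzero_set_def)
    qed
    then have S2: "?\<beta>2 \<in> ?S" using insert.IH[OF _ b2] insert.prems(1) by blast
    have "\<beta> = ?\<beta>1 \<oplus>\<^bsub>Sec\<^esub> ?\<beta>2"
    proof (rule sections_eqI[OF \<beta>s])
      show "?\<beta>1 \<oplus>\<^bsub>Sec\<^esub> ?\<beta>2 \<in> sections P"
        unfolding Sec_simps by (intro add_section Cc_sections[OF b1] Cc_sections[OF b2])
      fix \<gamma> assume b: "\<gamma> \<in> base"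
      interpret bimodule "fiber P \<gamma>" using b by (rule fiber_bimodule)
      have "\<beta> \<gamma> \<in> carrier (fiber P \<gamma>)" by (rule sections_mem[OF \<beta>s b])
      then have "flact P (f \<gamma> + (1 - f \<gamma>)) (\<beta> \<gamma>) = fadd P (flact P (f \<gamma>) (\<beta> \<gamma>)) (flact P (1 - f \<gamma>) (\<beta> \<gamma>))"
        "flact P 1 (\<beta> \<gamma>) = \<beta> \<gamma>"
        using add_lact[of "\<beta> \<gamma>" "f \<gamma>" "1 - f \<gamma>"] one_lact[of "\<beta> \<gamma>"] by simp_all
      then show "\<beta> \<gamma> = (?\<beta>1 \<oplus>\<^bsub>Sec\<^esub> ?\<beta>2) \<gamma>" using b by simp
    qed
    then show ?case using subgroup.m_closed[OF S S1 S2] by simp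
  qed
  obtain K where K: "compactin base_top K" "K \<subseteq> U" "nonzero_set P \<alpha> \<subseteq> K"
    using \<alpha> unfolding Cc_iff[OF U] by blast
  have cover: "\<exists>D. good D \<and> x \<in> D" if x: "x \<in> K" for x
  proof -
    have Uo: "openin base_top U" using U by (simp add: open_Hausdorff_def)
    obtain W where W: "source_section (base_sg P) W" "x \<in> W" "W \<subseteq> U"
      using etale.source_section_exists[OF Uo] K(2) x by blast
    then have Wo: "openin base_top W" by (simp add: source_section_def)
    obtain f :: "'g \<Rightarrow> 'r" and D C where f: "continuous_map (subtopology base_top U) euclidean f"
      "openin base_top D" "x \<in> D" "compactin base_top C" "C \<subseteq> W"
      "\<And>a. a \<in> D \<Longrightarrow> f a = 1" "\<And>a. a \<in> U - C \<Longrightarrow> f a = 0"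
      by (rule etale.locally_R_normal_bump[OF locally_R_normal U Wo W(2,3)]) (rule that)
    have "good D" unfolding good_def
      by (intro conjI exI[of _ W] exI[of _ C] exI[of _ f] ballI f W(1,3))
    with f(3) show ?thesis by blast
  qed
  have "\<exists>F. finite F \<and> F \<subseteq> {D. good D} \<and> K \<subseteq> \<Union>F"
  proof (rule compactinD[OF K(1)])
    show "openin base_top D" if "D \<in> {D. good D}" for D using that by (simp add: good_def)
    show "K \<subseteq> \<Union>{D. good D}" using cover by blast
  qed
  then obtain F where "finite F" "F \<subseteq> {D. good D}" "K \<subseteq> \<Union>F" by blast
  then show ?thesis using span[of F \<alpha>] \<alpha> K(3) by blast
qed

lemma Alg_source_span: "carrier Alg = additive_span Sec source_Cc_union"
proof
  have S: "subgroup (additive_span Sec source_Cc_union) (add_monoid Sec)"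
    using source_Cc_union_subset Cc_union_sections by (intro Sec.additive_span_subgroup) blast
  show "carrier Alg \<subseteq> additive_span Sec source_Cc_union"
    using Alg_mem_subgroup[OF S] Cc_in_source_span by blast
  show "additive_span Sec source_Cc_union \<subseteq> carrier Alg"
    using source_Cc_union_subset additive_span_superset[of _ Cc_union Sec]
    by (intro Sec.additive_span_minimal Alg_subgroup) (auto simp: Alg_carrier)
qed

lemma Alg_source_finite: "carrier Alg \<subseteq> source_finite"
proof
  fix \<alpha> assume "\<alpha> \<in> carrier Alg"
  then show "\<alpha> \<in> source_finite"
  proof (rule Alg_mem_subgroup[OF source_finite_subgroup, rotated])
    fix V \<alpha> assume V: "open_Hausdorff base_top V" "\<alpha> \<in> Cc P V"
    then obtain C where "compactin base_top C" "nonzero_set P \<alpha> \<subseteq> C" unfolding Cc_iff[OF V(1)] by blast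
    then have "finite {\<gamma> \<in> nonzero_set P \<alpha>. src (base_sg P) \<gamma> = v}" for v
      by (intro finite_subset[OF _ etale.finite_compact_source_fiber[of C v]]) auto
    then show "\<alpha> \<in> source_finite" using V Cc_sections by (auto simp: source_finite_def)
  qed
qed

text \<open>
  With injective sources on \<open>U\<close> and \<open>W\<close>, a product \<open>ab\<close> with \<open>a \<in> U\<close> and \<open>b \<in> W\<close> determines \<open>b\<close> by its source, and
  then \<open>a\<close> by the range of \<open>b\<close>. So the convolution has at most one summand at each point, and \<open>b\<close> serves
  as a coordinate on the set \<open>UW\<close> of all products. The points to verify are that \<open>UW\<close> is open and
  Hausdorff, and that the convolution, expressed in this coordinate, is continuous and compactly
  supported.
\<close>

lemma convolution_Cc:
  assumes U: "source_section (base_sg P) U" and \<alpha>: "\<alpha> \<in> Cc P U"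
    and W: "source_section (base_sg P) W" and \<beta>: "\<beta> \<in> Cc P W"
  shows "convolution P \<alpha> \<beta> \<in> carrier Alg"
proof -
  let ?s = "src (base_sg P)" and ?r = "rng (base_sg P)" and ?m = "mul (base_sg P)"
  have HU: "open_Hausdorff base_top U" and HW: "open_Hausdorff base_top W"
    using U W etale.source_section_open_Hausdorff by blast+
  have Uo: "openin base_top U" and Wo: "openin base_top W" and sUo: "openin vtop (?s ` U)"
    using U W by (simp_all add: source_section_def)
  have Ub: "U \<subseteq> base" and Wb: "W \<subseteq> base"
    using openin_subset[OF Uo] openin_subset[OF Wo] by (simp_all add: topspace_base)
  note injW = source_section_inj[OF W]
  obtain h where h: "continuous_map (subtopology vtop (?s ` U)) base_top h" "\<And>a. a \<in> U \<Longrightarrow> h (?s a) = a"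
    using source_section_inverse[OF U] by blast
  obtain k where k: "continuous_map (subtopology vtop (?s ` W)) base_top k" "\<And>a. a \<in> W \<Longrightarrow> k (?s a) = a"
    using source_section_inverse[OF W] by blast
  \<comment> \<open>\<open>W'\<close> are the possible right factors, and \<open>m b\<close> is the product with right factor \<open>b\<close>\<close>
  define W' where "W' = {b \<in> W. ?r b \<in> ?s ` U}"
  define m where "m b = ?m (h (?r b)) b" for b
  have W'o: "openin base_top W'" unfolding W'_def
    by (rule openin_continuous_map_preimage_gen[OF etale.continuous_rng Wo sUo])
  have hr: "h (?r b) \<in> U" "?s (h (?r b)) = ?r b" "composable (base_sg P) (h (?r b)) b"
    "m b \<in> base" "?s (m b) = ?s b" if b: "b \<in> W'" for b
  proof -
    obtain a where a: "a \<in> U" "?s a = ?r b" using b by (auto simp: W'_def)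
    then have ha: "h (?r b) = a" using h(2) by metis
    show "h (?r b) \<in> U" "?s (h (?r b)) = ?r b" using a ha by auto
    show c: "composable (base_sg P) (h (?r b)) b"
      using a ha b Ub Wb by (auto simp: composable_def W'_def)
    show "m b \<in> base" "?s (m b) = ?s b"
      using etale.mul_closed[OF c] etale.src_mul[OF c] by (simp_all add: m_def)
  qed
  have cont_h: "continuous_map (subtopology base_top W') base_top (\<lambda>b. h (?r b))"
  proof -
    have "continuous_map (subtopology base_top W') (subtopology vtop (?s ` U)) ?r"
      by (rule continuous_map_into_subtopology)
        (auto intro: continuous_map_from_subtopology etale.continuous_rng simp: W'_def)
    from continuous_map_compose[OF this h(1)] show ?thesis by (simp add: o_def)
  qed
  have cont_m: "continuous_map (subtopology base_top W') base_top m"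
  proof -
    have "continuous_map (subtopology base_top W')
        (subtopology (prod_topology base_top base_top) {(a, b). composable (base_sg P) a b})
        (\<lambda>b. (h (?r b), b))"
      using cont_h hr(3)
      by (intro continuous_map_into_subtopology continuous_map_pairedI)
        (auto intro: continuous_map_from_subtopology)
    from continuous_map_compose[OF this etale.continuous_mul]
    show ?thesis by (simp add: o_def m_def[abs_def])
  qed
  have W'W: "W' \<subseteq> W" by (auto simp: W'_def)
  define UW where "UW = m ` W'"
  \<comment> \<open>On a neighbourhood \<open>Q\<close> of \<open>m b\<close> with injective source, \<open>\<delta>\<close> and \<open>m c\<close> agree once their sources do;
    so near \<open>m b\<close> membership in \<open>UW\<close> is an open condition on the source.\<close>
  have UWo: "openin base_top UW"
  proof (subst openin_subopen, intro ballI)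
    fix \<gamma> assume "\<gamma> \<in> UW"
    then obtain b where b: "b \<in> W'" "\<gamma> = m b" by (auto simp: UW_def)
    have "\<gamma> \<in> topspace base_top" using hr(4) b by (simp add: topspace_base)
    then obtain Q where Q: "source_section (base_sg P) Q" "\<gamma> \<in> Q"
      using etale.source_section_exists[OF openin_topspace] by blast
    then have Qo: "openin base_top Q" by (simp add: source_section_def)
    define W'' where "W'' = {b \<in> W'. m b \<in> Q}"
    have "openin (subtopology base_top W') {b \<in> topspace (subtopology base_top W'). m b \<in> Q}"
      by (rule openin_continuous_map_preimage[OF cont_m Qo])
    moreover have "{b \<in> topspace (subtopology base_top W'). m b \<in> Q} = W''"
      using W'W Wb by (auto simp: W''_def topspace_base)
    ultimately have W''o: "openin base_top W''" using openin_trans_full[OF _ W'o] by simp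
    have "openin vtop (?s ` W'')"
      by (rule source_section_open_image[OF W W''o]) (use W'W in \<open>auto simp: W''_def\<close>)
    then have "openin base_top {\<delta> \<in> Q. ?s \<delta> \<in> ?s ` W''}"
      by (rule openin_continuous_map_preimage_gen[OF etale.continuous_src Qo])
    moreover have "\<gamma> \<in> {\<delta> \<in> Q. ?s \<delta> \<in> ?s ` W''}"
      using b Q hr(5) by (auto simp: W''_def)
    moreover have "{\<delta> \<in> Q. ?s \<delta> \<in> ?s ` W''} \<subseteq> UW"
    proof
      fix \<delta> assume "\<delta> \<in> {\<delta> \<in> Q. ?s \<delta> \<in> ?s ` W''}"
      then obtain c where c: "\<delta> \<in> Q" "c \<in> W'" "m c \<in> Q" "?s \<delta> = ?s c" by (auto simp: W''_def)
      then have "\<delta> = m c" using hr(5)[OF c(2)] source_section_inj[OF Q(1)] by (metis inj_onD)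
      then show "\<delta> \<in> UW" using c(2) by (simp add: UW_def)
    qed
    ultimately show "\<exists>T. openin base_top T \<and> \<gamma> \<in> T \<and> T \<subseteq> UW" by blast
  qed
  have "inj_on ?s UW"
    unfolding UW_def
  proof (rule inj_onI, elim imageE)
    fix \<gamma> \<delta> b c assume b: "b \<in> W'" "\<gamma> = m b" and c: "c \<in> W'" "\<delta> = m c" and "?s \<gamma> = ?s \<delta>"
    then have "?s b = ?s c" using hr(5) by simp
    then have "b = c" using b(1) c(1) W'W injW by (auto dest: inj_onD)
    then show "\<gamma> = \<delta>" using b c by simp
  qed
  then have HUW: "open_Hausdorff base_top UW" by (rule etale.inj_src_open_Hausdorff[OF UWo])
  have \<alpha>s: "\<alpha> \<in> sections P" and \<beta>s: "\<beta> \<in> sections P" using \<alpha> \<beta> Cc_sections by blast+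
  have rel: "nonzero_factorizations \<alpha> \<beta> \<gamma> \<subseteq> {(h (?r b), b) | b. b \<in> W' \<and> m b = \<gamma>}" for \<gamma>
  proof
    fix p assume "p \<in> nonzero_factorizations \<alpha> \<beta> \<gamma>"
    then obtain a b where p: "p = (a, b)" "composable (base_sg P) a b" "?m a b = \<gamma>"
      "a \<in> U" "b \<in> W" using Cc_nonzero[OF \<alpha>] Cc_nonzero[OF \<beta>] by (auto simp: nonzero_factorizations_def)
    then have sa: "?s a = ?r b" by (simp add: composable_def)
    then have "?r b \<in> ?s ` U" using p(4) by (metis imageI)
    then have "b \<in> W'" "h (?r b) = a" using p(4,5) h(2)[OF p(4)] sa by (simp_all add: W'_def)
    then show "p \<in> {(h (?r b), b) | b. b \<in> W' \<and> m b = \<gamma>}" using p by (auto simp: m_def)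
  qed
  have val: "convolution P \<alpha> \<beta> (m b) = mul (total_sg P) (\<alpha> (h (?r b))) (\<beta> b)" if b: "b \<in> W'" for b
  proof -
    interpret bimodule "fiber P (m b)" using hr(4)[OF b] by (rule fiber_bimodule)
    have "nonzero_factorizations \<alpha> \<beta> (m b) \<subseteq> {(h (?r b), b)}"
    proof
      fix p assume "p \<in> nonzero_factorizations \<alpha> \<beta> (m b)"
      then obtain c where c: "c \<in> W'" "m c = m b" "p = (h (?r c), c)" using rel by blast
      then have "?s c = ?s b" using hr(5) b by metis
      then have "c = b" using c(1) b W'W injW by (auto dest: inj_onD)
      then show "p \<in> {(h (?r b), b)}" using c by simp
    qed
    moreover have fact: "{(h (?r b), b)} \<subseteq> factorizations (m b)" using hr(3)[OF b] by (auto simp: m_def)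
    ultimately have "convolution P \<alpha> \<beta> (m b) =
        finsum (fiber P (m b)) (\<lambda>(a, b). mul (total_sg P) (\<alpha> a) (\<beta> b)) {(h (?r b), b)}"
      by (intro convolution_eq \<alpha>s \<beta>s hr(4) b) auto
    also have "\<dots> = mul (total_sg P) (\<alpha> (h (?r b))) (\<beta> b)"
      using factor_term_closed[OF \<alpha>s \<beta>s, of "(h (?r b), b)" "m b"] fact
        fiber_add_zero(1)[OF hr(4)[OF b]]
      by (subst finsum_insert) auto
    finally show ?thesis .
  qed
  have "\<alpha> \<in> source_finite" "\<beta> \<in> source_finite"
    using Alg_source_finite Cc_Alg HU HW \<alpha> \<beta> by blast+
  then have sec: "convolution P \<alpha> \<beta> \<in> sections P" by (rule convolution_section)
  \<comment> \<open>\<open>k\<close> inverts the source on \<open>W\<close>; as \<open>m\<close> preserves sources, \<open>\<gamma> \<mapsto> k (s \<gamma>)\<close> inverts \<open>m\<close>\<close>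
  have kb: "k (?s \<gamma>) \<in> W'" "m (k (?s \<gamma>)) = \<gamma>" if "\<gamma> \<in> UW" for \<gamma>
    using that hr(5) k(2) W'W by (auto simp: UW_def)
  have "continuous_map (subtopology base_top UW) total_top
      (\<lambda>\<gamma>. mul (total_sg P) (\<alpha> (h (?r (k (?s \<gamma>))))) (\<beta> (k (?s \<gamma>))))"
  proof -
    have "continuous_map (subtopology base_top UW) (subtopology vtop (?s ` W)) ?s"
    proof (rule continuous_map_into_subtopology)
      show "continuous_map (subtopology base_top UW) vtop ?s"
        by (rule continuous_map_from_subtopology) (rule etale.continuous_src)
      show "?s \<in> topspace (subtopology base_top UW) \<rightarrow> ?s ` W"
        using hr(5) W'W by (auto simp: UW_def)
    qed
    from continuous_map_compose[OF this k(1)]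
    have "continuous_map (subtopology base_top UW) base_top (\<lambda>\<gamma>. k (?s \<gamma>))" by (simp add: o_def)
    then have kc: "continuous_map (subtopology base_top UW) (subtopology base_top W') (\<lambda>\<gamma>. k (?s \<gamma>))"
      by (rule continuous_map_into_subtopology) (use kb in auto)
    have "continuous_map (subtopology base_top UW) (subtopology base_top U) (\<lambda>\<gamma>. h (?r (k (?s \<gamma>))))"
    proof (rule continuous_map_into_subtopology)
      show "continuous_map (subtopology base_top UW) base_top (\<lambda>\<gamma>. h (?r (k (?s \<gamma>))))"
        using continuous_map_compose[OF kc cont_h] by (simp add: o_def)
    qed (use kb hr in auto)
    from continuous_map_compose[OF this Cc_continuous[OF \<alpha>]]
    have ca: "continuous_map (subtopology base_top UW) total_top (\<lambda>\<gamma>. \<alpha> (h (?r (k (?s \<gamma>)))))"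
      by (simp add: o_def)
    have "continuous_map (subtopology base_top W') total_top \<beta>"
      using Cc_continuous[OF \<beta>] W'W by (rule continuous_map_from_subtopology_mono)
    from continuous_map_compose[OF kc this]
    have cb: "continuous_map (subtopology base_top UW) total_top (\<lambda>\<gamma>. \<beta> (k (?s \<gamma>)))"
      by (simp add: o_def)
    have "continuous_map (subtopology base_top UW)
        (subtopology (prod_topology total_top total_top) {(a, b). composable (total_sg P) a b})
        (\<lambda>\<gamma>. (\<alpha> (h (?r (k (?s \<gamma>)))), \<beta> (k (?s \<gamma>))))"
    proof (intro continuous_map_into_subtopology continuous_map_pairedI ca cb)
      have "composable (total_sg P) (\<alpha> (h (?r b))) (\<beta> b)" if b: "b \<in> W'" for b
        by (rule mul_fiber(2)[OF hr(3)[OF b]])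
          (use hr[OF b] b W'W Ub Wb in \<open>auto intro!: sections_mem \<alpha>s \<beta>s simp del: fiber_simps\<close>)
      then show "(\<lambda>\<gamma>. (\<alpha> (h (?r (k (?s \<gamma>)))), \<beta> (k (?s \<gamma>)))) \<in> topspace (subtopology base_top UW) \<rightarrow>
          {(a, b). composable (total_sg P) a b}" using kb by auto
    qed
    from continuous_map_compose[OF this topological_semigroupoid.continuous_mul[OF topological_total]]
    show ?thesis by (simp add: o_def)
  qed
  then have cont: "continuous_map (subtopology base_top UW) total_top (convolution P \<alpha> \<beta>)"
  proof (rule continuous_map_eq)
    fix \<gamma> assume "\<gamma> \<in> topspace (subtopology base_top UW)"
    then have "\<gamma> \<in> UW" by simp
    from val[OF kb(1)[OF this]] kb(2)[OF this]
    show "mul (total_sg P) (\<alpha> (h (?r (k (?s \<gamma>))))) (\<beta> (k (?s \<gamma>))) = convolution P \<alpha> \<beta> \<gamma>" by simp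
  qed
  obtain A where A: "compactin base_top A" "A \<subseteq> U" "nonzero_set P \<alpha> \<subseteq> A"
    using \<alpha> unfolding Cc_iff[OF HU] by blast
  obtain B where B: "compactin base_top B" "B \<subseteq> W" "nonzero_set P \<beta> \<subseteq> B"
    using \<beta> unfolding Cc_iff[OF HW] by blast
  \<comment> \<open>The right factors in \<open>B\<close> that match a left factor in \<open>A\<close> form a closed subset of \<open>B\<close>,
    because the vertex space is Hausdorff.\<close>
  have "closedin vtop (?s ` A)"
    by (rule compactin_imp_closedin[OF etale.Hausdorff_vertices image_compactin[OF A(1) etale.continuous_src]])
  then have "closedin base_top {b \<in> topspace base_top. ?r b \<in> ?s ` A}"
    by (rule closedin_continuous_map_preimage[OF etale.continuous_rng])
  then have "compactin base_top ({b \<in> topspace base_top. ?r b \<in> ?s ` A} \<inter> B)"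
    by (rule closed_Int_compactin) (rule B(1))
  moreover have "{b \<in> topspace base_top. ?r b \<in> ?s ` A} \<inter> B \<subseteq> W'"
    using A(2) B(2) by (auto simp: W'_def)
  ultimately have "compactin (subtopology base_top W') ({b \<in> topspace base_top. ?r b \<in> ?s ` A} \<inter> B)"
    unfolding compactin_subtopology by blast
  then have comp: "compactin base_top (m ` ({b \<in> topspace base_top. ?r b \<in> ?s ` A} \<inter> B))" (is "compactin _ ?K")
    by (rule image_compactin) (rule cont_m)
  have KUW: "?K \<subseteq> UW" using A(2) B(2) by (auto simp: UW_def W'_def)
  have "nonzero_set P (convolution P \<alpha> \<beta>) \<subseteq> ?K"
  proof
    fix \<gamma> assume \<gamma>: "\<gamma> \<in> nonzero_set P (convolution P \<alpha> \<beta>)"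
    then have b: "\<gamma> \<in> base" by (simp add: nonzero_set_def)
    interpret bimodule "fiber P \<gamma>" using b by (rule fiber_bimodule)
    have "nonzero_factorizations \<alpha> \<beta> \<gamma> \<noteq> {}"
    proof
      assume "nonzero_factorizations \<alpha> \<beta> \<gamma> = {}"
      then have "convolution P \<alpha> \<beta> \<gamma> = finsum (fiber P \<gamma>) (\<lambda>(a, b). mul (total_sg P) (\<alpha> a) (\<beta> b)) {}"
        by (intro convolution_eq \<alpha>s \<beta>s b) auto
      then show False using \<gamma> by (simp add: nonzero_set_def)
    qed
    then obtain p where p: "p \<in> nonzero_factorizations \<alpha> \<beta> \<gamma>" by blast
    then obtain c where c: "p = (h (?r c), c)" "c \<in> W'" "m c = \<gamma>" using rel by blast
    have "h (?r c) \<in> A" "c \<in> B" using p c A(3) B(3) by (auto simp: nonzero_factorizations_def)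
    then show "\<gamma> \<in> ?K" using c hr(2)[OF c(2)] W'W Wb
      by (auto simp: topspace_base intro!: image_eqI[of _ m c] image_eqI[of _ ?s "h (?r c)"])
  qed
  then have "convolution P \<alpha> \<beta> \<in> Cc P UW" unfolding Cc_iff[OF HUW] using sec cont comp KUW by blast
  then show ?thesis by (rule Cc_Alg[OF HUW])
qed

text \<open>
  Biadditivity reduces the claim to generators, in one factor after the other.
\<close>

theorem convolution_closed:
  assumes \<alpha>: "\<alpha> \<in> carrier Alg" and \<beta>: "\<beta> \<in> carrier Alg"
  shows "convolution P \<alpha> \<beta> \<in> carrier Alg"
proof -
  have X: "source_Cc_union \<subseteq> source_finite"
    using Alg_source_finite Alg_source_span additive_span_superset[of _ source_Cc_union] by blast
  have left: "convolution P \<alpha> \<beta> \<in> carrier Alg" if "\<beta> \<in> source_Cc_union" for \<beta>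
  proof (rule additive_span_image_subset[where \<phi> = "\<lambda>\<alpha>. convolution P \<alpha> \<beta>",
        OF Sec_abelian_group Sec_abelian_group source_finite_subgroup X _ _ Alg_subgroup _
          \<alpha>[unfolded Alg_source_span]])
    have \<beta>': "\<beta> \<in> source_finite" using that X by blast
    show "convolution P x \<beta> \<in> carrier Sec" if "x \<in> source_finite" for x
      using convolution_section[OF that \<beta>'] by simp
    show "convolution P (x \<oplus>\<^bsub>Sec\<^esub> y) \<beta> = convolution P x \<beta> \<oplus>\<^bsub>Sec\<^esub> convolution P y \<beta>"
      if "x \<in> source_finite" "y \<in> source_finite" for x y
      by (rule convolution_add(1)[OF that \<beta>'])
    show "convolution P x \<beta> \<in> carrier Alg" if x: "x \<in> source_Cc_union" for x
      using x \<open>\<beta> \<in> source_Cc_union\<close> convolution_Cc by (auto simp: source_Cc_union_def)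
  qed
  have \<alpha>': "\<alpha> \<in> source_finite" using \<alpha> Alg_source_finite by blast
  show ?thesis
  proof (rule additive_span_image_subset[where \<phi> = "\<lambda>\<beta>. convolution P \<alpha> \<beta>",
        OF Sec_abelian_group Sec_abelian_group source_finite_subgroup X _ _ Alg_subgroup left
          \<beta>[unfolded Alg_source_span]])
    show "convolution P \<alpha> x \<in> carrier Sec" if "x \<in> source_finite" for x
      using convolution_section[OF \<alpha>' that] by simp
    show "convolution P \<alpha> (x \<oplus>\<^bsub>Sec\<^esub> y) = convolution P \<alpha> x \<oplus>\<^bsub>Sec\<^esub> convolution P \<alpha> y"
      if "x \<in> source_finite" "y \<in> source_finite" for x y
      by (rule convolution_add(2)[OF that \<alpha>'])
  qed
qed

end

section \<open>Gradings and homogeneous components\<close>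

lemma (in abelian_monoid) finsum_single:
  assumes "finite F" "\<And>i. i \<in> F \<Longrightarrow> i \<noteq> j \<Longrightarrow> f i = \<zero>" "f j \<in> carrier G" "j \<notin> F \<Longrightarrow> f j = \<zero>"
  shows "finsum G f F = f j"
proof -
  have cl: "f \<in> insert j F \<rightarrow> carrier G" using assms by (metis Pi_I insertE zero_closed)
  have "finsum G f F = finsum G f (insert j F)"
    by (rule finsum_neutral) (use assms cl in auto)
  also have "\<dots> = finsum G f {j}"
    by (rule finsum_neutral[symmetric]) (use assms cl in auto)
  also have "\<dots> = f j" using assms(3) by simp
  finally show ?thesis .
qed

context bimodule_bundle
begin

definition restriction :: "'g set \<Rightarrow> ('g \<Rightarrow> 'l) \<Rightarrow> ('g \<Rightarrow> 'l)" where
  "restriction Y \<alpha> = (\<lambda>\<gamma>\<in>base. if \<gamma> \<in> Y then \<alpha> \<gamma> else fzero P \<gamma>)"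

lemma restriction_section: "\<alpha> \<in> sections P \<Longrightarrow> restriction Y \<alpha> \<in> sections P"
  unfolding restriction_def
  by (rule sectionsI) (use sections_mem fiber_zero_closed in \<open>simp del: fiber_simps\<close>)

lemma restriction_add:
  "restriction Y (\<alpha> \<oplus>\<^bsub>Sec\<^esub> \<beta>) = restriction Y \<alpha> \<oplus>\<^bsub>Sec\<^esub> restriction Y \<beta>"
  using fiber_add_zero(1)[OF _ fiber_zero_closed]
  by (auto simp: restriction_def intro!: restrict_ext)

lemma nonzero_set_restriction: "nonzero_set P (restriction Y \<alpha>) = nonzero_set P \<alpha> \<inter> Y"
  by (auto simp: nonzero_set_def restriction_def)

lemma restriction_id:
  "\<alpha> \<in> sections P \<Longrightarrow> nonzero_set P \<alpha> \<subseteq> Y \<Longrightarrow> restriction Y \<alpha> = \<alpha>"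
  by (rule sections_eqI[OF restriction_section]) (auto simp: restriction_def nonzero_set_def)

lemma Cc_restriction:
  assumes V: "open_Hausdorff base_top V" and Y: "openin base_top Y" "closedin base_top Y"
    and \<alpha>: "\<alpha> \<in> Cc P V"
  shows "open_Hausdorff base_top (V \<inter> Y)" "restriction Y \<alpha> \<in> Cc P (V \<inter> Y)"
proof -
  have "openin base_top (V \<inter> Y)" using V Y(1) by (simp add: open_Hausdorff_def openin_Int)
  then show VY: "open_Hausdorff base_top (V \<inter> Y)" by (rule open_Hausdorff_subset[OF V]) simp
  obtain C where C: "compactin base_top C" "C \<subseteq> V" "nonzero_set P \<alpha> \<subseteq> C"
    using \<alpha> unfolding Cc_iff[OF V] by blast
  have "compactin base_top (Y \<inter> C)" by (rule closed_Int_compactin[OF Y(2) C(1)])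
  moreover have "continuous_map (subtopology base_top (V \<inter> Y)) total_top \<alpha>"
    using Cc_continuous[OF \<alpha>] Int_lower1 by (rule continuous_map_from_subtopology_mono)
  then have "continuous_map (subtopology base_top (V \<inter> Y)) total_top (restriction Y \<alpha>)"
    by (rule continuous_map_eq) (auto simp: restriction_def topspace_base)
  moreover have "restriction Y \<alpha> \<in> sections P" by (rule restriction_section[OF Cc_sections[OF \<alpha>]])
  moreover have "Y \<inter> C \<subseteq> V \<inter> Y" "nonzero_set P (restriction Y \<alpha>) \<subseteq> Y \<inter> C"
    using C by (auto simp: nonzero_set_restriction)
  ultimately show "restriction Y \<alpha> \<in> Cc P (V \<inter> Y)" unfolding Cc_iff[OF VY] by blast
qed

text \<open>
  Restriction to a clopen set is additive and cuts a generator in \<open>C\<^sub>c(V)\<close> down to one in \<open>C\<^sub>c(V \<inter> Y)\<close>.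
  With \<open>B\<close> the span of the generators supported in \<open>Y\<close>, this shows that the elements of the algebra
  vanishing outside \<open>Y\<close> are spanned by such generators.
\<close>

lemma restriction_Alg:
  assumes Y: "openin base_top Y" "closedin base_top Y" and \<alpha>: "\<alpha> \<in> carrier Alg"
    and B: "subgroup B (add_monoid Sec)"
    and gen: "\<And>V. open_Hausdorff base_top V \<Longrightarrow> V \<subseteq> Y \<Longrightarrow> Cc P V \<subseteq> B"
  shows "restriction Y \<alpha> \<in> B"
proof (rule additive_span_image_subset[where \<phi> = "restriction Y",
      OF Sec_abelian_group Sec_abelian_group _ Cc_union_sections _ _ B _ \<alpha>[unfolded Alg_carrier]])
  show "subgroup (carrier Sec) (add_monoid Sec)" using Sec.add.subgroup_self by simp
  show "restriction Y \<alpha> \<in> carrier Sec" if "\<alpha> \<in> carrier Sec" for \<alpha>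
    using that restriction_section by simp
  show "restriction Y \<alpha> \<in> B" if "\<alpha> \<in> Cc_union" for \<alpha>
    using that Cc_restriction[OF _ Y] gen[OF _ Int_lower2] unfolding Cc_union_def by blast
qed (rule restriction_add)

text \<open>
  A compact set has finite image in a discrete space. Applied to the grading, this bounds the number
  of degrees of an element; applied to the projection of the skew product to \<open>G\<close>, it bounds the number
  of its nonzero slices.
\<close>

lemma Alg_image_finite:
  assumes c: "continuous_map base_top (discrete_topology D) c" and \<alpha>: "\<alpha> \<in> carrier Alg"
  shows "finite (c ` nonzero_set P \<alpha>)"
proof -
  have "subgroup {\<alpha> \<in> sections P. finite (c ` nonzero_set P \<alpha>)} (add_monoid Sec)"
    by (rule small_support_subgroup) (auto simp: image_Un intro: finite_subset[OF image_mono])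
  then have "\<alpha> \<in> {\<alpha> \<in> sections P. finite (c ` nonzero_set P \<alpha>)}"
  proof (rule Alg_mem_subgroup[OF _ _ \<alpha>])
    fix V \<beta> assume V: "open_Hausdorff base_top V" "\<beta> \<in> Cc P V"
    then obtain C where C: "compactin base_top C" "nonzero_set P \<beta> \<subseteq> C" unfolding Cc_iff[OF V(1)] by blast
    have "compactin (discrete_topology D) (c ` C)" by (rule image_compactin[OF C(1) c])
    then have "finite (c ` C)" by (simp add: compactin_discrete_topology)
    then show "\<beta> \<in> {\<alpha> \<in> sections P. finite (c ` nonzero_set P \<alpha>)}"
      using C(2) Cc_sections[OF V(2)] by (auto intro: finite_subset[OF image_mono])
  qed
  then show ?thesis by simp
qed

end

text \<open>
  The grading enters only through the clopen partition of the base into its level sets.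
\<close>

locale graded_bundle = bimodule_bundle P
  for P :: "('l, 'x, 'g, 'v, 'r::unital_topological_ring) bundle_data" +
  fixes G :: "('h, 'w, 'n) semigroupoid_scheme" and c :: "'g \<Rightarrow> 'h"
  assumes continuous_grading: "continuous_map base_top (discrete_topology (arrows G)) c"
begin

abbreviation grade :: "'h \<Rightarrow> ('g \<Rightarrow> 'l) set" where "grade \<equiv> sectional_grading P c"
abbreviation component :: "'h \<Rightarrow> ('g \<Rightarrow> 'l) \<Rightarrow> ('g \<Rightarrow> 'l)" where
  "component g \<equiv> restriction {\<gamma> \<in> base. c \<gamma> = g}"

lemma grading_arrow: "\<gamma> \<in> base \<Longrightarrow> c \<gamma> \<in> arrows G"
  using continuous_grading by (auto simp: continuous_map_def topspace_base)

lemma grading_clopen: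
  shows "openin base_top {\<gamma> \<in> base. Q (c \<gamma>)}" "closedin base_top {\<gamma> \<in> base. Q (c \<gamma>)}"
proof -
  have eq: "{\<gamma> \<in> base. Q (c \<gamma>)} = {\<gamma> \<in> topspace base_top. c \<gamma> \<in> {g \<in> arrows G. Q g}}"
    using grading_arrow by (auto simp: topspace_base)
  show "openin base_top {\<gamma> \<in> base. Q (c \<gamma>)}" unfolding eq
    by (rule openin_continuous_map_preimage[OF continuous_grading]) auto
  show "closedin base_top {\<gamma> \<in> base. Q (c \<gamma>)}" unfolding eq
    by (rule closedin_continuous_map_preimage[OF continuous_grading]) auto
qed

lemma support_in_subgroup:
  "subgroup {\<alpha> \<in> carrier Alg. nonzero_set P \<alpha> \<subseteq> Y} (add_monoid Alg)"
proof -
  have "subgroup {\<alpha> \<in> sections P. nonzero_set P \<alpha> \<subseteq> Y} (add_monoid Sec)"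
    by (rule small_support_subgroup) auto
  from Sec.add.subgroups_Inter_pair[OF this Alg_subgroup]
  have "subgroup ({\<alpha> \<in> sections P. nonzero_set P \<alpha> \<subseteq> Y} \<inter> carrier Alg) (add_monoid Sec)" .
  moreover have "{\<alpha> \<in> sections P. nonzero_set P \<alpha> \<subseteq> Y} \<inter> carrier Alg =
      {\<alpha> \<in> carrier Alg. nonzero_set P \<alpha> \<subseteq> Y}" using Alg_sections by auto
  ultimately show ?thesis by (subst subgroup_Alg_iff) auto
qed

text \<open>
  Homogeneity is a condition on the support: restriction to the level set of \<open>g\<close> fixes an element
  supported there and rewrites it as a sum of generators of degree \<open>g\<close>.
\<close>

theorem sectional_grading_eq: "grade g = {\<alpha> \<in> carrier Alg. nonzero_set P \<alpha> \<subseteq> {\<gamma> \<in> base. c \<gamma> = g}}"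
proof
  let ?X = "\<Union>U\<in>{U. open_Hausdorff base_top U \<and> (\<forall>\<gamma>\<in>U. c \<gamma> = g)}. Cc P U"
  have X: "?X \<subseteq> carrier Alg" using Cc_Alg by blast
  show "grade g \<subseteq> {\<alpha> \<in> carrier Alg. nonzero_set P \<alpha> \<subseteq> {\<gamma> \<in> base. c \<gamma> = g}}"
    unfolding sectional_grading_def
    using X Cc_nonzero nonzero_set_subset
    by (intro Alg.additive_span_minimal support_in_subgroup) blast
  show "{\<alpha> \<in> carrier Alg. nonzero_set P \<alpha> \<subseteq> {\<gamma> \<in> base. c \<gamma> = g}} \<subseteq> grade g"
  proof
    fix \<alpha> assume \<alpha>: "\<alpha> \<in> {\<alpha> \<in> carrier Alg. nonzero_set P \<alpha> \<subseteq> {\<gamma> \<in> base. c \<gamma> = g}}"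
    have "component g \<alpha> \<in> additive_span Sec ?X"
    proof (rule restriction_Alg[OF grading_clopen])
      show "subgroup (additive_span Sec ?X) (add_monoid Sec)"
        using X Alg_sections by (intro Sec.additive_span_subgroup) auto
      show "Cc P V \<subseteq> additive_span Sec ?X" if "open_Hausdorff base_top V" "V \<subseteq> {\<gamma> \<in> base. c \<gamma> = g}" for V
        using that by (intro subsetI additive_span_superset) blast
    qed (use \<alpha> in blast)
    then show "\<alpha> \<in> grade g"
      using \<alpha> restriction_id[of \<alpha>] Alg_sections unfolding sectional_grading_def Alg_span[OF X] by auto
  qed
qed

lemma degree_restriction_Alg: "\<alpha> \<in> carrier Alg \<Longrightarrow> restriction {\<gamma> \<in> base. Q (c \<gamma>)} \<alpha> \<in> carrier Alg"
  by (rule restriction_Alg[OF grading_clopen _ Alg_subgroup]) (use Cc_Alg in blast)+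

lemma component_grade: "\<alpha> \<in> carrier Alg \<Longrightarrow> component g \<alpha> \<in> grade g"
  unfolding sectional_grading_eq using degree_restriction_Alg by (auto simp: nonzero_set_restriction)

lemma component_sum:
  assumes \<alpha>: "\<alpha> \<in> carrier Alg" and F: "finite F" "c ` nonzero_set P \<alpha> \<subseteq> F"
  shows "finsum Alg (\<lambda>k. component k \<alpha>) F = \<alpha>"
proof (rule sections_eqI)
  have cl: "component k \<alpha> \<in> carrier Alg" for k using degree_restriction_Alg[OF \<alpha>] .
  show "finsum Alg (\<lambda>k. component k \<alpha>) F \<in> sections P"
    by (rule Alg_sections, rule Alg.finsum_closed) (use cl in blast)
  show "\<alpha> \<in> sections P" using \<alpha> by (rule Alg_sections)
  fix \<gamma> assume \<gamma>: "\<gamma> \<in> base"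
  interpret bimodule "fiber P \<gamma>" using \<gamma> by (rule fiber_bimodule)
  have "finsum Alg (\<lambda>k. component k \<alpha>) F \<gamma> = finsum (fiber P \<gamma>) (\<lambda>k. component k \<alpha> \<gamma>) F"
    by (rule finsum_Alg_eval[OF F(1) cl \<gamma>])
  also have "\<dots> = component (c \<gamma>) \<alpha> \<gamma>"
  proof (rule finsum_single[OF F(1)])
    show "component (c \<gamma>) \<alpha> \<gamma> \<in> carrier (fiber P \<gamma>)"
      by (rule sections_mem[OF Alg_sections[OF cl] \<gamma>])
    show "component (c \<gamma>) \<alpha> \<gamma> = \<zero>\<^bsub>fiber P \<gamma>\<^esub>" if "c \<gamma> \<notin> F"
      using that F(2) \<gamma> by (auto simp: restriction_def nonzero_set_def)
  qed (use \<gamma> in \<open>simp add: restriction_def\<close>)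
  also have "\<dots> = \<alpha> \<gamma>" using \<gamma> by (simp add: restriction_def)
  finally show "finsum Alg (\<lambda>k. component k \<alpha>) F \<gamma> = \<alpha> \<gamma>" .
qed

lemma component_eq_zero:
  assumes "\<alpha> \<in> carrier Alg" "g \<notin> c ` nonzero_set P \<alpha>"
  shows "component g \<alpha> = \<zero>\<^bsub>Alg\<^esub>"
  using zero_section_iff[OF restriction_section[OF Alg_sections[OF assms(1)]], of "{\<gamma> \<in> base. c \<gamma> = g}"] assms(2)
  by (auto simp: nonzero_set_restriction)

text \<open>
  At a point of degree \<open>g\<close>, only the summand of index \<open>g\<close> can be nonzero. This is the uniqueness part of
  the homogeneous decomposition.
\<close>

lemma decomposition_component:
  assumes "homogeneous_decomposition G Alg grade \<alpha> f" and g: "g \<in> arrows G"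
  shows "f g = component g \<alpha>"
proof -
  let ?F = "{g \<in> arrows G. f g \<noteq> \<zero>\<^bsub>Alg\<^esub>}"
  have f: "f \<in> (\<Pi>\<^sub>E g\<in>arrows G. grade g)" and F: "finite ?F" and \<alpha>: "\<alpha> = finsum Alg f ?F"
    using assms(1) by (auto simp: homogeneous_decomposition_def fsum_def)
  have fA: "f k \<in> carrier Alg" "nonzero_set P (f k) \<subseteq> {\<gamma> \<in> base. c \<gamma> = k}" if "k \<in> arrows G" for k
    using PiE_mem[OF f that] by (simp_all add: sectional_grading_eq)
  have \<alpha>A: "\<alpha> \<in> carrier Alg" unfolding \<alpha> by (rule Alg.finsum_closed) (use fA in blast)
  show ?thesis
  proof (rule sections_eqI)
    show "f g \<in> sections P" using fA(1)[OF g] by (rule Alg_sections)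
    show "component g \<alpha> \<in> sections P" by (rule restriction_section[OF Alg_sections[OF \<alpha>A]])
    fix \<gamma> assume \<gamma>: "\<gamma> \<in> base"
    interpret bimodule "fiber P \<gamma>" using \<gamma> by (rule fiber_bimodule)
    have off: "f k \<gamma> = \<zero>\<^bsub>fiber P \<gamma>\<^esub>" if "k \<in> arrows G" "k \<noteq> c \<gamma>" for k
      using fA(2)[OF that(1)] that(2) \<gamma> by (auto simp: nonzero_set_def)
    show "f g \<gamma> = component g \<alpha> \<gamma>"
    proof (cases "g = c \<gamma>")
      case True
      have "\<alpha> \<gamma> = finsum (fiber P \<gamma>) (\<lambda>k. f k \<gamma>) ?F"
        unfolding \<alpha> by (rule finsum_Alg_eval[OF F _ \<gamma>]) (use fA in blast)
      also have "\<dots> = f g \<gamma>"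
      proof (rule finsum_single[OF F])
        show "f k \<gamma> = \<zero>\<^bsub>fiber P \<gamma>\<^esub>" if "k \<in> ?F" "k \<noteq> g" for k
          using off[of k] that True by blast
        show "f g \<gamma> \<in> carrier (fiber P \<gamma>)"
          by (rule sections_mem[OF Alg_sections[OF fA(1)[OF g]] \<gamma>])
        show "f g \<gamma> = \<zero>\<^bsub>fiber P \<gamma>\<^esub>" if "g \<notin> ?F" using that g \<gamma> by simp
      qed
      finally show ?thesis using True \<gamma> by (simp add: restriction_def)
    next
      case False
      then show ?thesis using off[OF g] \<gamma> by (simp add: restriction_def)
    qed
  qed
qed

theorem homogeneous_projection_eq:
  assumes \<alpha>: "\<alpha> \<in> carrier Alg" and g: "g \<in> arrows G"
  shows "homogeneous_projection G Alg grade g \<alpha> = component g \<alpha>"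
proof -
  let ?f = "\<lambda>k\<in>arrows G. component k \<alpha>"
  let ?F = "{k \<in> arrows G. ?f k \<noteq> \<zero>\<^bsub>Alg\<^esub>}"
  have fin: "finite (c ` nonzero_set P \<alpha>)" by (rule Alg_image_finite[OF continuous_grading \<alpha>])
  have sub: "?F \<subseteq> c ` nonzero_set P \<alpha>" using component_eq_zero[OF \<alpha>] by force
  have arr: "c ` nonzero_set P \<alpha> \<subseteq> arrows G" using grading_arrow by (auto simp: nonzero_set_def)
  have "fsum Alg ?f (arrows G) = finsum Alg ?f (c ` nonzero_set P \<alpha>)"
  proof (rule Alg.fsum_eq_finsum[OF fin arr])
    show "?f k = \<zero>\<^bsub>Alg\<^esub>" if "k \<in> arrows G - c ` nonzero_set P \<alpha>" for k
      using that component_eq_zero[OF \<alpha>] by simp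
    show "?f \<in> c ` nonzero_set P \<alpha> \<rightarrow> carrier Alg"
    proof
      show "?f k \<in> carrier Alg" if "k \<in> c ` nonzero_set P \<alpha>" for k
        using degree_restriction_Alg[OF \<alpha>] subsetD[OF arr that] by simp
    qed
  qed
  also have "\<dots> = finsum Alg (\<lambda>k. component k \<alpha>) (c ` nonzero_set P \<alpha>)"
  proof (rule Alg.finsum_cong')
    show "(\<lambda>k. component k \<alpha>) \<in> c ` nonzero_set P \<alpha> \<rightarrow> carrier Alg"
      by (intro Pi_I) (rule degree_restriction_Alg[OF \<alpha>])
    show "?f k = component k \<alpha>" if "k \<in> c ` nonzero_set P \<alpha>" for k
      using subsetD[OF arr that] by simp
  qed simp
  also have "\<dots> = \<alpha>" by (rule component_sum[OF \<alpha> fin subset_refl])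
  finally have "homogeneous_decomposition G Alg grade \<alpha> ?f"
    using component_grade[OF \<alpha>] finite_subset[OF sub fin]
    by (auto simp: homogeneous_decomposition_def simp del: Alg_simps)
  moreover have "f = ?f" if "homogeneous_decomposition G Alg grade \<alpha> f" for f
  proof (rule PiE_ext[of _ "arrows G" grade])
    show "f \<in> Pi\<^sub>E (arrows G) grade" using that by (simp add: homogeneous_decomposition_def)
    show "?f \<in> Pi\<^sub>E (arrows G) grade" using component_grade[OF \<alpha>] by simp
    show "f k = ?f k" if "k \<in> arrows G" for k
      using decomposition_component[OF \<open>homogeneous_decomposition G Alg grade \<alpha> f\<close> that] that by simp
  qed
  ultimately have "(THE f. homogeneous_decomposition G Alg grade \<alpha> f) = ?f" by (rule the_equality)
  then show ?thesis using g by (simp add: homogeneous_projection_def)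
qed

theorem smash_coefficients_eq:
  "smash_coefficients G Alg grade g =
    {\<alpha> \<in> carrier Alg. nonzero_set P \<alpha> \<subseteq> {\<gamma>. src G (c \<gamma>) = rng G g}}"
proof
  let ?X = "\<Union>k\<in>{k\<in>arrows G. src G k = rng G g}. grade k"
  have X: "?X \<subseteq> carrier Alg" by (auto simp: sectional_grading_eq)
  show "smash_coefficients G Alg grade g \<subseteq>
      {\<alpha> \<in> carrier Alg. nonzero_set P \<alpha> \<subseteq> {\<gamma>. src G (c \<gamma>) = rng G g}}"
    unfolding smash_coefficients_def
    by (intro Alg.additive_span_minimal support_in_subgroup) (auto simp: sectional_grading_eq)
  show "{\<alpha> \<in> carrier Alg. nonzero_set P \<alpha> \<subseteq> {\<gamma>. src G (c \<gamma>) = rng G g}} \<subseteq>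
      smash_coefficients G Alg grade g"
  proof
    fix \<alpha> assume "\<alpha> \<in> {\<alpha> \<in> carrier Alg. nonzero_set P \<alpha> \<subseteq> {\<gamma>. src G (c \<gamma>) = rng G g}}"
    then have \<alpha>: "\<alpha> \<in> carrier Alg" and nz: "nonzero_set P \<alpha> \<subseteq> {\<gamma>. src G (c \<gamma>) = rng G g}" by auto
    have fin: "finite (c ` nonzero_set P \<alpha>)" by (rule Alg_image_finite[OF continuous_grading \<alpha>])
    have "finsum Alg (\<lambda>k. component k \<alpha>) (c ` nonzero_set P \<alpha>) \<in> additive_span Alg ?X"
    proof (rule Alg.finsum_mem_subgroup[OF Alg.additive_span_subgroup[OF X] fin])
      fix k assume "k \<in> c ` nonzero_set P \<alpha>"
      then have "k \<in> arrows G" "src G k = rng G g"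
        using nz grading_arrow by (auto simp: nonzero_set_def)
      then show "component k \<alpha> \<in> additive_span Alg ?X"
        using component_grade[OF \<alpha>] by (intro additive_span_superset) blast
    qed
    then show "\<alpha> \<in> smash_coefficients G Alg grade g"
      unfolding component_sum[OF \<alpha> fin subset_refl] smash_coefficients_def .
  qed
qed

end

section \<open>Sections of the skew bundle\<close>

lemma bimodule_image:
  assumes M: "bimodule M"
    and car: "carrier N = \<phi> ` carrier M"
    and zero: "\<zero>\<^bsub>N\<^esub> = \<phi> \<zero>\<^bsub>M\<^esub>"
    and add: "\<And>x y. x \<in> carrier M \<Longrightarrow> y \<in> carrier M \<Longrightarrow> \<phi> x \<oplus>\<^bsub>N\<^esub> \<phi> y = \<phi> (x \<oplus>\<^bsub>M\<^esub> y)"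
    and lact: "\<And>r x. x \<in> carrier M \<Longrightarrow> lact N r (\<phi> x) = \<phi> (lact M r x)"
    and ract: "\<And>r x. x \<in> carrier M \<Longrightarrow> ract N (\<phi> x) r = \<phi> (ract M x r)"
  shows "bimodule N"
proof -
  interpret M: bimodule M by (rule M)
  have "abelian_group N"
  proof (rule abelian_groupI)
    fix x assume "x \<in> carrier N"
    then obtain a where a: "a \<in> carrier M" "x = \<phi> a" unfolding car by blast
    show "\<exists>y\<in>carrier N. y \<oplus>\<^bsub>N\<^esub> x = \<zero>\<^bsub>N\<^esub>"
      using a by (intro bexI[of _ "\<phi> (\<ominus>\<^bsub>M\<^esub> a)"]) (simp_all add: car add zero M.l_neg)
  qed (auto simp: car zero add M.a_ac)
  then show ?thesis
    by (rule bimodule.intro, unfold_locales)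
      (auto simp: car add lact ract M.lact_closed M.ract_closed M.lact_add M.ract_add M.add_lact
        M.add_ract M.lact_lact M.ract_ract M.one_lact M.ract_one M.lact_ract)
qed

locale graded_R_bundle = etale_R_bundle P + graded_bundle P G d + grp: groupoid G
  for P :: "('l, 'x, 'g, 'v, 'r::unital_topological_ring) bundle_data"
    and G :: "('h, 'w, 'n) semigroupoid_scheme" and d :: "'g \<Rightarrow> 'h" +
  assumes grading_hom: "semigroupoid_hom (base_sg P) G d"
begin

abbreviation skew :: "('l \<times> 'h, 'x \<times> 'h, 'g \<times> 'h, 'v \<times> 'h, 'r) bundle_data" where
  "skew \<equiv> skew_bundle P d G"
abbreviation skew_base :: "('g \<times> 'h) set" where
  "skew_base \<equiv> skew_arrows (base_sg P) d G"
abbreviation skew_top :: "('g \<times> 'h) topology" where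
  "skew_top \<equiv> subtopology (prod_topology base_top (discrete_topology (arrows G))) skew_base"
abbreviation skew_total :: "('l \<times> 'h) set" where
  "skew_total \<equiv> skew_arrows (total_sg P) (d \<circ> proj P) G"
abbreviation skew_total_top :: "('l \<times> 'h) topology" where
  "skew_total_top \<equiv> subtopology (prod_topology total_top (discrete_topology (arrows G))) skew_total"

lemma skew_simps [simp]:
  "arrows (base_sg skew) = skew_base" "arrow_top (base_sg skew) = skew_top"
  "arrows (total_sg skew) = skew_total" "arrow_top (total_sg skew) = skew_total_top"
  "proj skew = (\<lambda>(x, g). (proj P x, g))" "fadd skew = (\<lambda>(x, g) (y, h). (fadd P x y, g))"
  "fzero skew = (\<lambda>(\<gamma>, g). (fzero P \<gamma>, g))" "flact skew = (\<lambda>r (x, g). (flact P r x, g))"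
  "fract skew = (\<lambda>(x, g) r. (fract P x r, g))"
  by (simp_all add: skew_bundle_def skew_product_def)

lemma skew_base_iff: "(\<gamma>, h) \<in> skew_base \<longleftrightarrow> \<gamma> \<in> base \<and> h \<in> arrows G \<and> src G (d \<gamma>) = rng G h"
  by (simp add: skew_arrows_def)

lemma skew_total_iff:
  "(x, h) \<in> skew_total \<longleftrightarrow> x \<in> arrows (total_sg P) \<and> h \<in> arrows G \<and> src G (d (proj P x)) = rng G h"
  by (simp add: skew_arrows_def)

lemma proj_base: "x \<in> arrows (total_sg P) \<Longrightarrow> proj P x \<in> base"
  using rigid_proj by (auto simp: rigid_hom_def semigroupoid_hom_def)

lemma topspace_skew: "topspace skew_top = skew_base" "topspace skew_total_top = skew_total"
  by (auto simp: topspace_base topspace_total skew_arrows_def)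

lemma continuous_skew_fst: "continuous_map skew_top base_top fst"
  by (intro continuous_map_from_subtopology continuous_map_fst)

lemma continuous_skew_snd: "continuous_map skew_top (discrete_topology (arrows G)) snd"
  by (intro continuous_map_from_subtopology continuous_map_snd)

lemma continuous_skew_total_fst: "continuous_map skew_total_top total_top fst"
  by (intro continuous_map_from_subtopology continuous_map_fst)

lemma continuous_skew_total_snd: "continuous_map skew_total_top (discrete_topology (arrows G)) snd"
  by (intro continuous_map_from_subtopology continuous_map_snd)

lemma carrier_skew_fiber:
  "(\<gamma>, h) \<in> skew_base \<Longrightarrow> carrier (fiber skew (\<gamma>, h)) = (\<lambda>x. (x, h)) ` carrier (fiber P \<gamma>)"
  by (auto simp: fiber_def skew_arrows_def)

lemma continuous_skew_act:
  assumes f: "continuous_map total_top total_top f"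
    and fib: "\<And>x. x \<in> arrows (total_sg P) \<Longrightarrow> proj P (f x) = proj P x"
  shows "continuous_map skew_total_top skew_total_top (\<lambda>(x, g). (f x, g))"
proof -
  have "continuous_map skew_total_top (prod_topology total_top (discrete_topology (arrows G)))
      (\<lambda>p. ((f \<circ> fst) p, snd p))"
    by (intro continuous_map_pairedI continuous_skew_total_snd
        continuous_map_compose[OF continuous_skew_total_fst f])
  moreover have "f x \<in> arrows (total_sg P)" if "x \<in> arrows (total_sg P)" for x
    using that f by (auto simp: continuous_map_def topspace_total)
  ultimately have "continuous_map skew_total_top skew_total_top (\<lambda>p. ((f \<circ> fst) p, snd p))"
    by (intro continuous_map_into_subtopology) (auto simp: skew_arrows_def fib)
  then show ?thesis by (simp add: case_prod_unfold)
qed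

lemma skew_bimodule_bundle: "bimodule_bundle skew"
proof (rule bimodule_bundle.intro)
  show "topspace (arrow_top (base_sg skew)) = arrows (base_sg skew)"
    "topspace (arrow_top (total_sg skew)) = arrows (total_sg skew)"
    using topspace_skew by simp_all
next
  fix p assume "p \<in> arrows (base_sg skew)"
  then obtain \<gamma> h where p: "p = (\<gamma>, h)" "(\<gamma>, h) \<in> skew_base" by (cases p) auto
  then have \<gamma>: "\<gamma> \<in> base" by (simp add: skew_base_iff)
  show "bimodule (fiber skew p)"
  proof (rule bimodule_image[OF fiber_bimodule[OF \<gamma>]])
    show "carrier (fiber skew p) = (\<lambda>x. (x, h)) ` carrier (fiber P \<gamma>)"
      using carrier_skew_fiber p by simp
  qed (simp_all add: p fiber_def)
next
  fix r :: 'r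
  have "proj P (flact P r x) = proj P x" "proj P (fract P x r) = proj P x"
    if "x \<in> arrows (total_sg P)" for x
    using that fiber_act_closed[OF proj_base[OF that], of x r] by auto
  then show "continuous_map (arrow_top (total_sg skew)) (arrow_top (total_sg skew)) (flact skew r)"
    "continuous_map (arrow_top (total_sg skew)) (arrow_top (total_sg skew)) (\<lambda>x. fract skew x r)"
    using continuous_skew_act[OF continuous_flact_at, of r] continuous_skew_act[OF continuous_fract_at, of r]
    by (simp_all add: case_prod_unfold)
qed

lemma skew_graded_bundle: "graded_bundle skew G (skew_grading d)"
proof (rule graded_bundle.intro[OF skew_bimodule_bundle], unfold_locales)
  show "continuous_map (arrow_top (base_sg skew)) (discrete_topology (arrows G)) (skew_grading d)"
    using continuous_map_compose[OF continuous_skew_fst continuous_grading]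
    by (simp add: skew_grading_def o_def case_prod_unfold)
qed

sublocale Sk: graded_bundle "skew_bundle P d G" G "skew_grading d" by (rule skew_graded_bundle)

lemma skew_section:
  assumes "\<beta> \<in> sections skew" "(\<gamma>, h) \<in> skew_base"
  obtains x where "\<beta> (\<gamma>, h) = (x, h)" "x \<in> carrier (fiber P \<gamma>)"
proof -
  have "\<beta> (\<gamma>, h) \<in> carrier (fiber skew (\<gamma>, h))"
    by (rule Sk.sections_mem[OF assms(1)]) (simp add: assms(2))
  then show ?thesis using that unfolding carrier_skew_fiber[OF assms(2)] by blast
qed

text \<open>
  The clopen set \<open>\<Gamma>\<^sub>h\<close>: for an arrow \<open>h\<close> of \<open>G\<close>, the pairs \<open>(\<gamma>, h)\<close> with \<open>\<gamma> \<in> \<Gamma>\<^sub>h\<close> are the arrows of the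
  skew product with second coordinate \<open>h\<close>.
\<close>

definition fiber_slice :: "'h \<Rightarrow> 'g set" where
  "fiber_slice h = {\<gamma> \<in> base. src G (d \<gamma>) = rng G h}"

lemma fiber_slice_clopen: "openin base_top (fiber_slice h)" "closedin base_top (fiber_slice h)"
  unfolding fiber_slice_def using grading_clopen[of "\<lambda>k. src G k = rng G h"] by simp_all

lemma continuous_insertion:
  assumes h: "h \<in> arrows G"
  shows "continuous_map (subtopology base_top (fiber_slice h)) skew_top (\<lambda>\<gamma>. (\<gamma>, h))"
  by (rule continuous_map_into_subtopology, rule continuous_map_pairedI)
    (use h in \<open>auto simp: skew_arrows_def fiber_slice_def topspace_base intro: continuous_map_from_subtopology\<close>)

text \<open>
  The section of the skew bundle that is \<open>\<alpha>\<close> on the copy of \<open>\<Gamma>\<^sub>h\<close> and zero elsewhere: it will be the image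
  of \<open>\<alpha> \<delta>\<^sub>h\<close>.
\<close>

definition insertion :: "'h \<Rightarrow> ('g \<Rightarrow> 'l) \<Rightarrow> ('g \<times> 'h \<Rightarrow> 'l \<times> 'h)" where
  "insertion h \<alpha> = (\<lambda>p\<in>skew_base. (if snd p = h then \<alpha> (fst p) else fzero P (fst p), snd p))"

definition slice :: "'h \<Rightarrow> ('g \<times> 'h \<Rightarrow> 'l \<times> 'h) \<Rightarrow> ('g \<Rightarrow> 'l)" where
  "slice h \<beta> = (\<lambda>\<gamma>\<in>base. if (\<gamma>, h) \<in> skew_base then fst (\<beta> (\<gamma>, h)) else fzero P \<gamma>)"

lemma insertion_section:
  assumes "\<alpha> \<in> sections P"
  shows "insertion h \<alpha> \<in> sections skew"
  unfolding insertion_def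
  using Sk.sectionsI[of "\<lambda>p. (if snd p = h then \<alpha> (fst p) else fzero P (fst p), snd p)"]
    sections_mem[OF assms] fiber_zero_closed
  by (auto simp: skew_arrows_def)

lemma insertion_add:
  "insertion h (\<alpha> \<oplus>\<^bsub>Sec\<^esub> \<beta>) = insertion h \<alpha> \<oplus>\<^bsub>Sk.Sec\<^esub> insertion h \<beta>"
  using fiber_add_zero(1)[OF _ fiber_zero_closed]
  by (auto simp: insertion_def skew_arrows_def intro!: restrict_ext)

lemma nonzero_set_insertion:
  "nonzero_set skew (insertion h \<alpha>) = {p \<in> skew_base. snd p = h \<and> fst p \<in> nonzero_set P \<alpha>}"
  by (auto simp: nonzero_set_def insertion_def skew_arrows_def split: if_splits)

lemma slice_section: "\<beta> \<in> sections skew \<Longrightarrow> slice h \<beta> \<in> sections P"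
  unfolding slice_def
proof (rule sectionsI)
  fix \<gamma> assume \<beta>: "\<beta> \<in> sections skew" and \<gamma>: "\<gamma> \<in> base"
  show "(if (\<gamma>, h) \<in> skew_base then fst (\<beta> (\<gamma>, h)) else fzero P \<gamma>) \<in> carrier (fiber P \<gamma>)"
  proof (cases "(\<gamma>, h) \<in> skew_base")
    case True
    from \<beta> True obtain x where "\<beta> (\<gamma>, h) = (x, h)" "x \<in> carrier (fiber P \<gamma>)" by (rule skew_section)
    then show ?thesis using True by simp
  next
    case False
    then show ?thesis using fiber_zero_closed[OF \<gamma>] by simp
  qed
qed

lemma slice_add:
  assumes "\<alpha> \<in> sections skew" "\<beta> \<in> sections skew"
  shows "slice h (\<alpha> \<oplus>\<^bsub>Sk.Sec\<^esub> \<beta>) = slice h \<alpha> \<oplus>\<^bsub>Sec\<^esub> slice h \<beta>"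
proof -
  have "fst (fadd skew (\<alpha> (\<gamma>, h)) (\<beta> (\<gamma>, h))) = fadd P (fst (\<alpha> (\<gamma>, h))) (fst (\<beta> (\<gamma>, h)))" for \<gamma>
    by (simp add: case_prod_unfold)
  then show ?thesis using fiber_add_zero(1)[OF _ fiber_zero_closed]
    by (auto simp: slice_def simp del: skew_simps(6) intro!: restrict_ext)
qed

lemma nonzero_set_slice:
  assumes \<beta>: "\<beta> \<in> sections skew"
  shows "nonzero_set P (slice h \<beta>) = {\<gamma>. (\<gamma>, h) \<in> nonzero_set skew \<beta>}"
proof -
  have "fst (\<beta> (\<gamma>, h)) = fzero P \<gamma> \<longleftrightarrow> \<beta> (\<gamma>, h) = (fzero P \<gamma>, h)" if "(\<gamma>, h) \<in> skew_base" for \<gamma>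
    using \<beta> that by (rule skew_section) auto
  then show ?thesis by (auto simp: nonzero_set_def slice_def skew_base_iff)
qed

text \<open>
  The copy of \<open>V\<close> over \<open>h\<close> is open, and the insertion is supported on the copy of the compact set
  \<open>C \<inter> \<Gamma>\<^sub>h\<close>, where \<open>C\<close> supports \<open>\<alpha>\<close>; it is compact because \<open>\<Gamma>\<^sub>h\<close> is closed.
\<close>

lemma insertion_Cc:
  assumes V: "open_Hausdorff base_top V" and \<alpha>: "\<alpha> \<in> Cc P V" and h: "h \<in> arrows G"
  shows "insertion h \<alpha> \<in> carrier Sk.Alg"
proof -
  define V' where "V' = {p \<in> skew_base. fst p \<in> V \<and> snd p = h}"
  have "V' = {p \<in> topspace skew_top. fst p \<in> V} \<inter> {p \<in> topspace skew_top. snd p \<in> {h}}"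
    unfolding topspace_skew by (auto simp: V'_def)
  moreover have "openin skew_top {p \<in> topspace skew_top. fst p \<in> V}"
    using V by (intro openin_continuous_map_preimage[OF continuous_skew_fst]) (simp add: open_Hausdorff_def)
  moreover have "openin skew_top {p \<in> topspace skew_top. snd p \<in> {h}}"
    using h by (intro openin_continuous_map_preimage[OF continuous_skew_snd]) simp
  ultimately have V'o: "openin skew_top V'" by (simp only: openin_Int)
  have fstV: "continuous_map (subtopology skew_top V') (subtopology base_top V) fst"
    by (rule continuous_map_into_subtopology)
      (auto intro: continuous_map_from_subtopology continuous_map_fst simp: V'_def)
  have "Hausdorff_space (subtopology skew_top V')"
    using V by (intro Hausdorff_space_injective_preimage[OF _ fstV])
      (auto simp: open_Hausdorff_def V'_def inj_on_def)
  then have HV': "open_Hausdorff (arrow_top (base_sg skew)) V'"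
    using V'o by (simp add: open_Hausdorff_def)
  obtain C where C: "compactin base_top C" "C \<subseteq> V" "nonzero_set P \<alpha> \<subseteq> C"
    using \<alpha> unfolding Cc_iff[OF V] by blast
  have \<alpha>s: "\<alpha> \<in> sections P" using \<alpha> by (rule Cc_sections)
  have "compactin (subtopology base_top (fiber_slice h)) (fiber_slice h \<inter> C)"
    using closed_Int_compactin[OF fiber_slice_clopen(2) C(1)] unfolding compactin_subtopology by blast
  then have "compactin skew_top ((\<lambda>\<gamma>. (\<gamma>, h)) ` (fiber_slice h \<inter> C))"
    by (rule image_compactin) (rule continuous_insertion[OF h])
  moreover have "(\<lambda>\<gamma>. (\<gamma>, h)) ` (fiber_slice h \<inter> C) \<subseteq> V'"
    using C(2) h by (auto simp: V'_def fiber_slice_def skew_base_iff)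
  moreover have "nonzero_set skew (insertion h \<alpha>) \<subseteq> (\<lambda>\<gamma>. (\<gamma>, h)) ` (fiber_slice h \<inter> C)"
    using C(3) by (force simp: nonzero_set_insertion fiber_slice_def skew_base_iff image_iff)
  moreover have "continuous_map (subtopology skew_top V') skew_total_top (insertion h \<alpha>)"
  proof -
    have "continuous_map (subtopology skew_top V') (prod_topology total_top (discrete_topology (arrows G)))
        (\<lambda>p. ((\<alpha> \<circ> fst) p, snd p))"
      by (intro continuous_map_pairedI continuous_map_compose[OF fstV Cc_continuous[OF \<alpha>]]
          continuous_map_from_subtopology[OF continuous_skew_snd])
    moreover have "(\<lambda>p. ((\<alpha> \<circ> fst) p, snd p)) \<in> topspace (subtopology skew_top V') \<rightarrow> skew_total"
      using sections_mem[OF \<alpha>s] by (auto simp: V'_def skew_base_iff skew_total_iff)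
    ultimately have "continuous_map (subtopology skew_top V') skew_total_top (\<lambda>p. ((\<alpha> \<circ> fst) p, snd p))"
      by (rule continuous_map_into_subtopology)
    then show ?thesis by (rule continuous_map_eq) (auto simp: insertion_def V'_def)
  qed
  ultimately have "insertion h \<alpha> \<in> Cc skew V'"
    unfolding Sk.Cc_iff[OF HV'] using insertion_section[OF \<alpha>s] by auto
  then show ?thesis by (rule Sk.Cc_Alg[OF HV'])
qed

lemma insertion_Alg:
  assumes \<alpha>: "\<alpha> \<in> carrier Alg" and h: "h \<in> arrows G"
  shows "insertion h \<alpha> \<in> carrier Sk.Alg"
proof (rule additive_span_image_subset[where \<phi> = "insertion h", OF Sec_abelian_group
      Sk.Sec_abelian_group _ Cc_union_sections _ _ Sk.Alg_subgroup _ \<alpha>[unfolded Alg_carrier]])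
  show "subgroup (carrier Sec) (add_monoid Sec)" using Sec.add.subgroup_self by simp
  show "insertion h x \<in> carrier Sk.Sec" if "x \<in> carrier Sec" for x
    using that insertion_section by simp
  show "insertion h x \<in> carrier Sk.Alg" if "x \<in> Cc_union" for x
    using that insertion_Cc[OF _ _ h] unfolding Cc_union_def by blast
qed (rule insertion_add)

text \<open>
  Conversely, the part of a compact set of the skew product over \<open>h\<close> is compact, and so is its
  projection to the base.
\<close>

lemma slice_Cc:
  assumes V: "open_Hausdorff (arrow_top (base_sg skew)) V" and \<beta>: "\<beta> \<in> Cc skew V" and h: "h \<in> arrows G"
  shows "slice h \<beta> \<in> carrier Alg"
proof -
  define V' where "V' = {\<gamma> \<in> fiber_slice h. (\<gamma>, h) \<in> V}"
  have Vo: "openin skew_top V" using V by (simp add: open_Hausdorff_def)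
  have top: "topspace (subtopology base_top (fiber_slice h)) = fiber_slice h"
    by (auto simp: topspace_base fiber_slice_def)
  have "openin (subtopology base_top (fiber_slice h)) V'"
    using openin_continuous_map_preimage[OF continuous_insertion[OF h] Vo] unfolding top V'_def .
  then have V'o: "openin base_top V'" using openin_trans_full fiber_slice_clopen(1) by blast
  have "V' \<subseteq> fiber_slice h" by (auto simp: V'_def)
  from continuous_map_from_subtopology_mono[OF continuous_insertion[OF h] this]
  have ins: "continuous_map (subtopology base_top V') (subtopology skew_top V) (\<lambda>\<gamma>. (\<gamma>, h))"
    by (rule continuous_map_into_subtopology) (auto simp: V'_def)
  have "Hausdorff_space (subtopology base_top V')"
    using V by (intro Hausdorff_space_injective_preimage[OF _ ins])
      (auto simp: open_Hausdorff_def inj_on_def)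
  then have HV': "open_Hausdorff base_top V'" using V'o by (simp add: open_Hausdorff_def)
  have \<beta>s: "\<beta> \<in> sections skew" using \<beta> by (rule Sk.Cc_sections)
  obtain C where C: "compactin skew_top C" "C \<subseteq> V" "nonzero_set skew \<beta> \<subseteq> C"
    using \<beta> unfolding Sk.Cc_iff[OF V] by auto
  have "closedin skew_top {p \<in> topspace skew_top. snd p \<in> {h}}"
    using h by (intro closedin_continuous_map_preimage[OF continuous_skew_snd]) simp
  from image_compactin[OF closed_Int_compactin[OF this C(1)] continuous_skew_fst]
  have comp: "compactin base_top (fst ` ({p \<in> topspace skew_top. snd p \<in> {h}} \<inter> C))" (is "compactin _ ?C") .
  have "?C \<subseteq> V'"
    using C(2) unfolding topspace_skew by (auto simp: V'_def fiber_slice_def skew_base_iff)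
  moreover have "nonzero_set P (slice h \<beta>) \<subseteq> ?C"
    using C(3) Sk.nonzero_set_subset[of \<beta>] unfolding nonzero_set_slice[OF \<beta>s] topspace_skew
    by (force simp: image_iff)
  moreover have "continuous_map (subtopology base_top V') total_top (slice h \<beta>)"
  proof -
    have "continuous_map (subtopology skew_top V) skew_total_top \<beta>"
      using Sk.Cc_continuous[OF \<beta>] by simp
    from continuous_map_compose[OF continuous_map_compose[OF ins this] continuous_skew_total_fst]
    show ?thesis
      by (rule continuous_map_eq) (use h in \<open>auto simp: slice_def V'_def fiber_slice_def skew_base_iff\<close>)
  qed
  ultimately have "slice h \<beta> \<in> Cc P V'"
    unfolding Cc_iff[OF HV'] using comp slice_section[OF \<beta>s] by blast
  then show ?thesis by (rule Cc_Alg[OF HV'])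
qed

lemma slice_Alg:
  assumes \<beta>: "\<beta> \<in> carrier Sk.Alg" and h: "h \<in> arrows G"
  shows "slice h \<beta> \<in> carrier Alg"
proof (rule additive_span_image_subset[where \<phi> = "slice h", OF Sk.Sec_abelian_group
      Sec_abelian_group _ Sk.Cc_union_sections _ _ Alg_subgroup _ \<beta>[unfolded Sk.Alg_carrier]])
  show "subgroup (carrier Sk.Sec) (add_monoid Sk.Sec)" using Sk.Sec.add.subgroup_self by simp
  show "slice h x \<in> carrier Sec" if "x \<in> carrier Sk.Sec" for x
    using that slice_section by simp
  show "slice h x \<in> carrier Alg" if "x \<in> Sk.Cc_union" for x
    using that slice_Cc[OF _ _ h] unfolding Sk.Cc_union_def by blast
  show "slice h (x \<oplus>\<^bsub>Sk.Sec\<^esub> y) = slice h x \<oplus>\<^bsub>Sec\<^esub> slice h y"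
    if "x \<in> carrier Sk.Sec" "y \<in> carrier Sk.Sec" for x y
    using that by (intro slice_add) simp_all
qed

end

section \<open>The smash product\<close>

context groupoid
begin

lemma inverse_arrow_inverse:
  assumes a: "a \<in> arrows G"
  shows "is_inverse G a (inverse_arrow G a)"
  unfolding inverse_arrow_def
proof (rule theI')
  show "\<exists>!b. is_inverse G a b"
  proof (rule ex_ex1I)
    show "\<exists>b. is_inverse G a b" by (rule ex_inverse[OF a])
    fix b c assume b: "is_inverse G a b" and c: "is_inverse G a c"
    have "b = mul G b (mul G a c)"
      using b c by (auto simp: is_inverse_def is_identity_def composable_def)
    also have "\<dots> = mul G (mul G b a) c"
      using b c by (intro mul_assoc[symmetric]) (auto simp: is_inverse_def)
    also have "\<dots> = c"
      using b c by (auto simp: is_inverse_def is_identity_def composable_def)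
    finally show "b = c" .
  qed
qed

text \<open>
  The equivalence turns the condition \<open>d(b) = g h\<^sup>-\<^sup>1\<close>, imposed by the projection in the smash product, into
  the condition \<open>g = d(b) h\<close> for composability in the skew product.
\<close>

lemma quotient_arrow:
  assumes g: "g \<in> arrows G" and h: "h \<in> arrows G" and gh: "src G g = src G h"
  shows "mul G g (inverse_arrow G h) \<in> arrows G"
    and "k \<in> arrows G \<Longrightarrow> src G k = rng G h \<Longrightarrow>
      k = mul G g (inverse_arrow G h) \<longleftrightarrow> g = mul G k h"
proof -
  let ?h = "inverse_arrow G h"
  have inv: "is_inverse G h ?h" by (rule inverse_arrow_inverse[OF h])
  then have h': "?h \<in> arrows G" "rng G ?h = src G h" "src G ?h = rng G h"
    by (auto simp: is_inverse_def composable_def)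
  have c: "composable G g ?h" using g h' gh by (simp add: composable_def)
  then show "mul G g ?h \<in> arrows G" by (rule mul_closed)
  have "mul G (mul G g ?h) h = mul G g (mul G ?h h)"
    using c inv by (intro mul_assoc) (auto simp: is_inverse_def)
  also have "\<dots> = g" using inv g gh by (auto simp: is_inverse_def is_identity_def)
  finally have 1: "mul G (mul G g ?h) h = g" .
  assume k: "k \<in> arrows G" "src G k = rng G h"
  have "mul G (mul G k h) ?h = mul G k (mul G h ?h)"
    using k h inv by (intro mul_assoc) (auto simp: is_inverse_def composable_def)
  also have "\<dots> = k" using inv k by (auto simp: is_inverse_def is_identity_def)
  finally show "k = mul G g ?h \<longleftrightarrow> g = mul G k h" using 1 by auto
qed

end

context graded_bundle
begin

abbreviation coefficients :: "'h \<Rightarrow> ('g \<Rightarrow> 'l) set" where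
  "coefficients \<equiv> smash_coefficients G Alg grade"
abbreviation smash :: "('r, 'h \<Rightarrow> 'g \<Rightarrow> 'l) bimodule" where
  "smash \<equiv> smash_product G Alg grade"

lemma smash_simps:
  "carrier smash = {u \<in> (\<Pi>\<^sub>E g\<in>arrows G. coefficients g). finite {g \<in> arrows G. u g \<noteq> \<zero>\<^bsub>Alg\<^esub>}}"
  "\<zero>\<^bsub>smash\<^esub> = (\<lambda>h\<in>arrows G. \<zero>\<^bsub>Alg\<^esub>)"
  "u \<oplus>\<^bsub>smash\<^esub> v = (\<lambda>h\<in>arrows G. u h \<oplus>\<^bsub>Alg\<^esub> v h)"
  "lact smash r u = (\<lambda>h\<in>arrows G. lact Alg r (u h))"
  "ract smash u r = (\<lambda>h\<in>arrows G. ract Alg (u h) r)"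
  "u \<otimes>\<^bsub>smash\<^esub> v = (\<lambda>h\<in>arrows G. fsum Alg
     (\<lambda>g. u g \<otimes>\<^bsub>Alg\<^esub> homogeneous_projection G Alg grade (mul G g (inverse_arrow G h)) (v h))
     {g\<in>arrows G. src G g = src G h})"
  by (simp_all add: smash_product_def)

lemma coefficients_subgroup: "subgroup (coefficients g) (add_monoid Alg)"
  unfolding smash_coefficients_eq by (rule support_in_subgroup)

lemma coefficients_Alg: "\<alpha> \<in> coefficients g \<Longrightarrow> \<alpha> \<in> carrier Alg"
  by (simp add: smash_coefficients_eq)

lemma smash_coefficient: "u \<in> carrier smash \<Longrightarrow> g \<in> arrows G \<Longrightarrow> u g \<in> coefficients g"
  by (auto simp: smash_simps(1))

lemma smash_Alg: "u \<in> carrier smash \<Longrightarrow> g \<in> arrows G \<Longrightarrow> u g \<in> carrier Alg"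
  using smash_coefficient coefficients_Alg by blast

lemma smash_abelian_group: "abelian_group smash"
proof (rule abelian_groupI)
  note zero = subgroup.one_closed[OF coefficients_subgroup, simplified monoid.simps]
  show "\<zero>\<^bsub>smash\<^esub> \<in> carrier smash" using zero by (auto simp: smash_simps simp del: Alg_simps)
  fix u assume u: "u \<in> carrier smash"
  show "\<zero>\<^bsub>smash\<^esub> \<oplus>\<^bsub>smash\<^esub> u = u"
  proof
    show "(\<zero>\<^bsub>smash\<^esub> \<oplus>\<^bsub>smash\<^esub> u) g = u g" for g
      using Alg.l_zero[OF smash_Alg[OF u, of g]] u
      by (auto simp: smash_simps restrict_apply extensional_def PiE_def simp del: Alg_simps)
  qed
  let ?v = "\<lambda>h\<in>arrows G. \<ominus>\<^bsub>Alg\<^esub> u h"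
  have "\<ominus>\<^bsub>Alg\<^esub> u g \<in> coefficients g" if "g \<in> arrows G" for g
    using subgroup.m_inv_closed[OF coefficients_subgroup smash_coefficient[OF u that]]
    by (simp add: a_inv_def)
  moreover have "finite {g \<in> arrows G. ?v g \<noteq> \<zero>\<^bsub>Alg\<^esub>}"
  proof (rule finite_subset)
    show "finite {g \<in> arrows G. u g \<noteq> \<zero>\<^bsub>Alg\<^esub>}" using u by (simp add: smash_simps(1))
    show "{g \<in> arrows G. ?v g \<noteq> \<zero>\<^bsub>Alg\<^esub>} \<subseteq> {g \<in> arrows G. u g \<noteq> \<zero>\<^bsub>Alg\<^esub>}"
      using Alg.add.inv_one by (auto simp: a_inv_def)
  qed
  ultimately have v: "?v \<in> carrier smash" by (simp add: smash_simps(1) del: Alg_simps)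
  have "?v \<oplus>\<^bsub>smash\<^esub> u = \<zero>\<^bsub>smash\<^esub>"
    using Alg.l_neg[OF smash_Alg[OF u]]
    by (auto simp: smash_simps simp del: Alg_simps intro!: restrict_ext)
  with v show "\<exists>v\<in>carrier smash. v \<oplus>\<^bsub>smash\<^esub> u = \<zero>\<^bsub>smash\<^esub>" by blast
  fix v assume v: "v \<in> carrier smash"
  have "u g \<oplus>\<^bsub>Alg\<^esub> v g \<in> coefficients g" if "g \<in> arrows G" for g
    using subgroup.m_closed[OF coefficients_subgroup smash_coefficient[OF u that] smash_coefficient[OF v that]]
    by (simp only: monoid.simps)
  moreover have "finite {g \<in> arrows G. u g \<oplus>\<^bsub>Alg\<^esub> v g \<noteq> \<zero>\<^bsub>Alg\<^esub>}"
  proof (rule finite_subset)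
    show "finite ({g \<in> arrows G. u g \<noteq> \<zero>\<^bsub>Alg\<^esub>} \<union> {g \<in> arrows G. v g \<noteq> \<zero>\<^bsub>Alg\<^esub>})"
      using u v by (simp add: smash_simps(1))
    show "{g \<in> arrows G. u g \<oplus>\<^bsub>Alg\<^esub> v g \<noteq> \<zero>\<^bsub>Alg\<^esub>} \<subseteq>
        {g \<in> arrows G. u g \<noteq> \<zero>\<^bsub>Alg\<^esub>} \<union> {g \<in> arrows G. v g \<noteq> \<zero>\<^bsub>Alg\<^esub>}"
      using Alg.l_zero[OF Alg.zero_closed] by (auto simp del: Alg_simps)
  qed
  moreover have "{g \<in> arrows G. (\<lambda>g\<in>arrows G. u g \<oplus>\<^bsub>Alg\<^esub> v g) g \<noteq> \<zero>\<^bsub>Alg\<^esub>} =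
      {g \<in> arrows G. u g \<oplus>\<^bsub>Alg\<^esub> v g \<noteq> \<zero>\<^bsub>Alg\<^esub>}" by (auto simp del: Alg_simps)
  ultimately show "u \<oplus>\<^bsub>smash\<^esub> v \<in> carrier smash"
    unfolding smash_simps(1,3) by (auto simp del: Alg_simps)
  show "u \<oplus>\<^bsub>smash\<^esub> v = v \<oplus>\<^bsub>smash\<^esub> u"
    using Alg.a_comm[OF smash_Alg[OF u] smash_Alg[OF v]]
    by (auto simp: smash_simps simp del: Alg_simps intro!: restrict_ext)
  fix w assume w: "w \<in> carrier smash"
  show "u \<oplus>\<^bsub>smash\<^esub> v \<oplus>\<^bsub>smash\<^esub> w = u \<oplus>\<^bsub>smash\<^esub> (v \<oplus>\<^bsub>smash\<^esub> w)"
    using Alg.a_assoc[OF smash_Alg[OF u] smash_Alg[OF v] smash_Alg[OF w]]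
    by (auto simp: smash_simps simp del: Alg_simps intro!: restrict_ext)
qed

lemma smash_delta_carrier:
  assumes "\<alpha> \<in> coefficients g"
  shows "smash_delta G Alg \<alpha> g \<in> carrier smash"
proof -
  note zero = subgroup.one_closed[OF coefficients_subgroup, simplified monoid.simps]
  have "{h \<in> arrows G. smash_delta G Alg \<alpha> g h \<noteq> \<zero>\<^bsub>Alg\<^esub>} \<subseteq> {g}"
    by (auto simp: smash_delta_def)
  then have "finite {h \<in> arrows G. smash_delta G Alg \<alpha> g h \<noteq> \<zero>\<^bsub>Alg\<^esub>}" by (rule finite_subset) simp
  then show ?thesis
    using assms zero unfolding smash_simps(1) by (auto simp: smash_delta_def simp del: Alg_simps)
qed

end

context graded_R_bundle
begin

section \<open>The isomorphism\<close>

text \<open>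
  The isomorphism \<open>T\<close>: on the copy of \<open>\<Gamma>\<^sub>h\<close> the assembled section is the coefficient of \<open>\<delta>\<^sub>h\<close>.
\<close>

definition assemble :: "('h \<Rightarrow> 'g \<Rightarrow> 'l) \<Rightarrow> ('g \<times> 'h \<Rightarrow> 'l \<times> 'h)" where
  "assemble u = (\<lambda>p\<in>skew_base. (u (snd p) (fst p), snd p))"

lemma assemble_apply: "(\<gamma>, h) \<in> skew_base \<Longrightarrow> assemble u (\<gamma>, h) = (u h \<gamma>, h)"
  by (simp add: assemble_def)

lemma assemble_add:
  "assemble (\<lambda>h\<in>arrows G. u h \<oplus>\<^bsub>Alg\<^esub> v h) = assemble u \<oplus>\<^bsub>Sk.Alg\<^esub> assemble v"
  by (auto simp: assemble_def skew_base_iff intro!: restrict_ext)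

lemma assemble_smash_delta: "g \<in> arrows G \<Longrightarrow> assemble (smash_delta G Alg \<alpha> g) = insertion g \<alpha>"
  by (auto simp: assemble_def insertion_def smash_delta_def skew_base_iff intro!: restrict_ext)

text \<open>
  A finitely supported family is a finite sum of insertions of its coefficients.
\<close>

lemma assemble_Alg:
  assumes u: "u \<in> carrier smash"
  shows "assemble u \<in> carrier Sk.Alg"
proof -
  have finite_case: "assemble v \<in> carrier Sk.Alg"
    if "finite F" "F \<subseteq> arrows G" "\<forall>h\<in>F. v h \<in> carrier Alg" "\<forall>h\<in>arrows G - F. v h = \<zero>\<^bsub>Alg\<^esub>" for F v
    using that
  proof (induction F arbitrary: v)
    case empty
    then have "assemble v = \<zero>\<^bsub>Sk.Alg\<^esub>"
      by (auto simp: assemble_def skew_base_iff intro!: restrict_ext)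
    then show ?case using Sk.Alg.zero_closed by metis
  next
    case (insert k F)
    let ?v = "v(k := \<zero>\<^bsub>Alg\<^esub>)"
    have k: "k \<in> arrows G" "v k \<in> carrier Alg" using insert.prems by simp_all
    have rest: "assemble ?v \<in> carrier Sk.Alg"
      by (rule insert.IH) (use insert.prems insert.hyps in \<open>auto simp del: Alg_simps\<close>)
    have one: "insertion k (v k) \<in> carrier Sk.Alg" by (rule insertion_Alg[OF k(2,1)])
    have split: "assemble v = assemble ?v \<oplus>\<^bsub>Sk.Alg\<^esub> insertion k (v k)"
    proof -
      have "fadd P (fzero P \<gamma>) (v h \<gamma>) = v h \<gamma>" "fadd P (v h \<gamma>) (fzero P \<gamma>) = v h \<gamma>"
        if "h \<in> arrows G" "\<gamma> \<in> base" for h \<gamma>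
      proof -
        have "v h \<in> carrier Alg" using insert.prems(2,3) that(1) Alg.zero_closed by (metis DiffI)
        from sections_mem[OF Alg_sections[OF this] that(2)]
        show "fadd P (fzero P \<gamma>) (v h \<gamma>) = v h \<gamma>" "fadd P (v h \<gamma>) (fzero P \<gamma>) = v h \<gamma>"
          by (rule fiber_add_zero[OF that(2)])+
      qed
      then show ?thesis
        by (auto simp: assemble_def insertion_def skew_base_iff intro!: restrict_ext)
    qed
    show ?case unfolding split by (rule Sk.Alg.a_closed[OF rest one])
  qed
  show ?thesis
  proof (rule finite_case)
    show "finite {g \<in> arrows G. u g \<noteq> \<zero>\<^bsub>Alg\<^esub>}" using u by (simp add: smash_simps(1))
    show "\<forall>h\<in>{g \<in> arrows G. u g \<noteq> \<zero>\<^bsub>Alg\<^esub>}. u h \<in> carrier Alg" using smash_Alg[OF u] by blast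
  qed blast+
qed

lemma smash_off_slice:
  assumes "u \<in> carrier smash" "h \<in> arrows G" "\<gamma> \<in> base" "(\<gamma>, h) \<notin> skew_base"
  shows "u h \<gamma> = fzero P \<gamma>"
  using smash_coefficient[OF assms(1,2)] assms(2-4)
  by (auto simp: smash_coefficients_eq nonzero_set_def skew_base_iff)

lemma assemble_inj: "inj_on assemble (carrier smash)"
proof (rule inj_onI)
  fix u v assume u: "u \<in> carrier smash" and v: "v \<in> carrier smash" and eq: "assemble u = assemble v"
  show "u = v"
  proof (rule PiE_ext[of _ "arrows G" coefficients])
    show "u \<in> Pi\<^sub>E (arrows G) coefficients" "v \<in> Pi\<^sub>E (arrows G) coefficients"
      using u v by (simp_all add: smash_simps(1))
    fix h assume h: "h \<in> arrows G"
    show "u h = v h"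
    proof (rule sections_eqI)
      show "u h \<in> sections P" "v h \<in> sections P" using smash_Alg u v h Alg_sections by blast+
      fix \<gamma> assume \<gamma>: "\<gamma> \<in> base"
      show "u h \<gamma> = v h \<gamma>"
      proof (cases "(\<gamma>, h) \<in> skew_base")
        case True
        then show ?thesis using fun_cong[OF eq, of "(\<gamma>, h)"] by (simp add: assemble_apply)
      next
        case False
        then show ?thesis using smash_off_slice[OF u h \<gamma>] smash_off_slice[OF v h \<gamma>] by simp
      qed
    qed
  qed
qed

text \<open>
  The preimage of \<open>\<beta>\<close> is the family of its slices.
\<close>

lemma assemble_surj:
  assumes \<beta>: "\<beta> \<in> carrier Sk.Alg"
  shows "\<beta> \<in> assemble ` carrier smash"
proof
  let ?u = "\<lambda>h\<in>arrows G. slice h \<beta>"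
  have \<beta>s: "\<beta> \<in> sections skew" using \<beta> by (rule Sk.Alg_sections)
  have "slice h \<beta> \<in> coefficients h" if "h \<in> arrows G" for h
    unfolding smash_coefficients_eq
    using slice_Alg[OF \<beta> that] Sk.nonzero_set_subset[of \<beta>]
    by (auto simp: nonzero_set_slice[OF \<beta>s] skew_base_iff)
  moreover have "finite {h \<in> arrows G. ?u h \<noteq> \<zero>\<^bsub>Alg\<^esub>}"
  proof (rule finite_subset)
    have "continuous_map (arrow_top (base_sg skew)) (discrete_topology (arrows G)) snd"
      using continuous_skew_snd by simp
    from Sk.Alg_image_finite[OF this \<beta>] show "finite (snd ` nonzero_set skew \<beta>)" .
    have "h \<in> snd ` nonzero_set skew \<beta>" if "slice h \<beta> \<noteq> \<zero>\<^bsub>Alg\<^esub>" for h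
      using that zero_section_iff[OF slice_section[OF \<beta>s, of h]]
      by (force simp: nonzero_set_slice[OF \<beta>s])
    then show "{h \<in> arrows G. ?u h \<noteq> \<zero>\<^bsub>Alg\<^esub>} \<subseteq> snd ` nonzero_set skew \<beta>"
      by (auto simp del: Alg_simps)
  qed
  ultimately show "?u \<in> carrier smash" by (simp add: smash_simps(1) del: Alg_simps)
  have "assemble ?u = restrict \<beta> skew_base"
    unfolding assemble_def
  proof (rule restrict_ext)
    fix p assume "p \<in> skew_base"
    then obtain \<gamma> h where p: "p = (\<gamma>, h)" "(\<gamma>, h) \<in> skew_base" by (cases p) auto
    from \<beta>s p(2) obtain x where "\<beta> (\<gamma>, h) = (x, h)" by (rule skew_section)
    then show "(?u (snd p) (fst p), snd p) = \<beta> p" using p by (auto simp: slice_def skew_base_iff)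
  qed
  then show "\<beta> = assemble ?u" using Sk.sections_extensional[OF \<beta>s] by simp
qed

lemma assemble_act:
  shows "assemble (lact smash r u) = lact Sk.Alg r (assemble u)"
    and "assemble (ract smash u r) = ract Sk.Alg (assemble u) r"
  by (auto simp: assemble_def smash_simps skew_base_iff intro!: restrict_ext)

lemma finsum_skew_fiber:
  assumes p: "(\<gamma>, h) \<in> skew_base" and F: "finite F" and f: "\<And>i. i \<in> F \<Longrightarrow> f i \<in> carrier (fiber P \<gamma>)"
  shows "finsum (fiber skew (\<gamma>, h)) (\<lambda>i. (f i, h)) F = (finsum (fiber P \<gamma>) f F, h)"
  using F f
proof (induction F)
  case empty
  interpret K: abelian_group "fiber skew (\<gamma>, h)" using p by (intro Sk.fiber_group) simp
  interpret bimodule "fiber P \<gamma>" using p by (intro fiber_bimodule) (simp add: skew_base_iff)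
  show ?case by simp
next
  case (insert i F)
  interpret K: abelian_group "fiber skew (\<gamma>, h)" using p by (intro Sk.fiber_group) simp
  interpret bimodule "fiber P \<gamma>" using p by (intro fiber_bimodule) (simp add: skew_base_iff)
  have f: "f \<in> F \<rightarrow> carrier (fiber P \<gamma>)" "f i \<in> carrier (fiber P \<gamma>)" using insert.prems by auto
  have "(\<lambda>i. (f i, h)) \<in> F \<rightarrow> carrier (fiber skew (\<gamma>, h))"
    "(f i, h) \<in> carrier (fiber skew (\<gamma>, h))"
    using f unfolding carrier_skew_fiber[OF p] by auto
  then show ?case
    using insert f by (simp add: K.finsum_insert finsum_insert del: Sk.fiber_simps(1) fiber_simps(1))
qed

text \<open>
  The second coordinate of a right factor is \<open>h\<close>, and composability forces the one of a left factor.
\<close>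

lemma skew_factorizations:
  assumes p: "(\<gamma>, h) \<in> skew_base"
  shows "{(x, y). composable (base_sg skew) x y \<and> mul (base_sg skew) x y = (\<gamma>, h)} =
    (\<lambda>(a, b). ((a, mul G (d b) h), (b, h))) ` factorizations \<gamma>"
proof -
  have 1: "(a, mul G (d b) h) \<in> skew_base \<and> (b, h) \<in> skew_base"
    if ab: "composable (base_sg P) a b" "mul (base_sg P) a b = \<gamma>" for a b
  proof -
    have base: "a \<in> base" "b \<in> base" using ab(1) by (auto simp: composable_def)
    have dab: "composable G (d a) (d b)" "d \<gamma> = mul G (d a) (d b)"
      using grading_hom ab by (auto simp: semigroupoid_hom_def)
    have h: "h \<in> arrows G" "src G (d \<gamma>) = rng G h" using p by (simp_all add: skew_base_iff)
    have db: "src G (d b) = rng G h" using grp.src_mul[OF dab(1)] dab(2) h(2) by simp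
    then have c: "composable G (d b) h" using dab(1) h(1) by (simp add: composable_def)
    then show ?thesis
      using grp.mul_closed[OF c] grp.rng_mul[OF c] base h(1) db dab(1)
      by (simp add: skew_base_iff composable_def)
  qed
  show ?thesis
  proof (intro subset_antisym subsetI)
    fix z assume "z \<in> {(x, y). composable (base_sg skew) x y \<and> mul (base_sg skew) x y = (\<gamma>, h)}"
    then obtain a g b k where z: "z = ((a, g), (b, k))"
      "composable (base_sg skew) (a, g) (b, k)" "mul (base_sg skew) (a, g) (b, k) = (\<gamma>, h)"
      by (cases z) force
    then show "z \<in> (\<lambda>(a, b). ((a, mul G (d b) h), (b, h))) ` factorizations \<gamma>"
      by (auto simp: composable_def skew_bundle_def skew_product_def skew_arrows_def)
  next
    fix z assume "z \<in> (\<lambda>(a, b). ((a, mul G (d b) h), (b, h))) ` factorizations \<gamma>"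
    then obtain a b where z: "z = ((a, mul G (d b) h), (b, h))" "composable (base_sg P) a b"
      "mul (base_sg P) a b = \<gamma>" by auto
    then show "z \<in> {(x, y). composable (base_sg skew) x y \<and> mul (base_sg skew) x y = (\<gamma>, h)}"
      using 1[OF z(2,3)] by (simp add: composable_def skew_bundle_def skew_product_def)
  qed
qed

lemma convolution_zero:
  assumes "\<alpha> \<in> sections P" "\<beta> \<in> sections P" "\<gamma> \<in> base" "\<And>x. x \<in> base \<Longrightarrow> \<alpha> x = fzero P x"
  shows "convolution P \<alpha> \<beta> \<gamma> = fzero P \<gamma>"
proof -
  interpret bimodule "fiber P \<gamma>" using assms(3) by (rule fiber_bimodule)
  have "nonzero_factorizations \<alpha> \<beta> \<gamma> = {}" using assms(4) by (auto simp: nonzero_factorizations_def nonzero_set_def)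
  then show ?thesis using convolution_eq[OF assms(1-3), of "{}"] by simp
qed

text \<open>
  Both sides are evaluated at \<open>(\<gamma>, h)\<close> as the sum of the same terms \<open>t(a, b) = u\<^bsub>d(b)h\<^esub>(a) v\<^sub>h(b)\<close> over a common
  finite set \<open>F\<close> of factorizations \<open>ab = \<gamma>\<close>. The left side is a sum over \<open>g\<close> of convolutions; after the
  exchange of sums, \<open>g = d(b)h\<close> is the only index that contributes at \<open>(a, b)\<close>.
\<close>

theorem assemble_mult:
  assumes u: "u \<in> carrier smash" and v: "v \<in> carrier smash"
  shows "assemble (u \<otimes>\<^bsub>smash\<^esub> v) = assemble u \<otimes>\<^bsub>Sk.Alg\<^esub> assemble v"
proof -
  have point: "assemble (u \<otimes>\<^bsub>smash\<^esub> v) (\<gamma>, h) = convolution skew (assemble u) (assemble v) (\<gamma>, h)"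
    if p: "(\<gamma>, h) \<in> skew_base" for \<gamma> h
  proof -
    have \<gamma>: "\<gamma> \<in> base" and h: "h \<in> arrows G" and dh: "src G (d \<gamma>) = rng G h"
      using p by (simp_all add: skew_base_iff)
    interpret bimodule "fiber P \<gamma>" using \<gamma> by (rule fiber_bimodule)
    interpret K: abelian_group "fiber skew (\<gamma>, h)" using p by (intro Sk.fiber_group) simp
    let ?q = "\<lambda>g. mul G g (inverse_arrow G h)"
    define w where "w g = component (?q g) (v h)" for g
    define I where "I = {g \<in> arrows G. src G g = src G h}"
    define E where "E = {g \<in> I. u g \<noteq> \<zero>\<^bsub>Alg\<^esub>}"
    define F where "F = (\<Union>g\<in>E. nonzero_factorizations (u g) (v h) \<gamma>)"
    define t where "t = (\<lambda>(a, b). mul (total_sg P) (u (mul G (d b) h) a) (v h b))"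
    have vh: "v h \<in> carrier Alg" by (rule smash_Alg[OF v h])
    have uA: "u g \<in> carrier Alg" if "g \<in> I" for g using smash_Alg[OF u] that by (simp add: I_def)
    have wA: "w g \<in> carrier Alg" for g unfolding w_def by (rule degree_restriction_Alg[OF vh])
    have us: "u g \<in> sections P" if "g \<in> I" for g using uA[OF that] by (rule Alg_sections)
    have vs: "v h \<in> sections P" using vh by (rule Alg_sections)
    have ws: "w g \<in> sections P" for g using wA by (rule Alg_sections)
    have finE: "finite E"
      by (rule finite_subset[of _ "{g \<in> arrows G. u g \<noteq> \<zero>\<^bsub>Alg\<^esub>}"])
        (use u in \<open>auto simp: E_def I_def smash_simps(1) simp del: Alg_simps\<close>)
    have EI: "E \<subseteq> I" by (auto simp: E_def)
    have finF: "finite F" unfolding F_def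
      using finE uA EI vh Alg_source_finite by (intro finite_UN_I finite_nonzero_factorizations) auto
    have Ffact: "F \<subseteq> factorizations \<gamma>" by (auto simp: F_def nonzero_factorizations_def)
    have nzu: "g \<in> E" if "g \<in> I" "u g a \<noteq> fzero P a" "a \<in> base" for g a
      using that by (auto simp: E_def)
    have fact: "a \<in> base" "b \<in> base" "mul G (d b) h \<in> I"
      "g \<in> I \<Longrightarrow> d b = ?q g \<longleftrightarrow> g = mul G (d b) h"
      if ab: "composable (base_sg P) a b" "mul (base_sg P) a b = \<gamma>" for a b g
    proof -
      show base: "a \<in> base" "b \<in> base" using ab(1) by (auto simp: composable_def)
      have dab: "composable G (d a) (d b)" "d \<gamma> = mul G (d a) (d b)"
        using grading_hom ab by (auto simp: semigroupoid_hom_def)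
      have db: "src G (d b) = rng G h" using grp.src_mul[OF dab(1)] dab(2) dh by simp
      then have c: "composable G (d b) h" using dab(1) h by (simp add: composable_def)
      show "mul G (d b) h \<in> I" using grp.mul_closed[OF c] grp.src_mul[OF c] by (simp add: I_def)
      show "d b = ?q g \<longleftrightarrow> g = mul G (d b) h" if "g \<in> I"
        using that grp.quotient_arrow(2)[OF _ h _ grading_arrow[OF base(2)] db] by (simp add: I_def)
    qed
    have summand: "(\<lambda>(a, b). mul (total_sg P) (u g a) (w g b)) z \<in> carrier (fiber P \<gamma>)"
      if "g \<in> I" "z \<in> F" for g z
      by (rule factor_term_closed[OF us[OF that(1)] ws]) (use that Ffact in blast)
    have t_closed: "t z \<in> carrier (fiber P \<gamma>)" if z: "z \<in> factorizations \<gamma>" for z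
    proof -
      obtain a b where ab: "z = (a, b)" "composable (base_sg P) a b" "mul (base_sg P) a b = \<gamma>"
        using z by auto
      show ?thesis
        using factor_term_closed[OF us[OF fact(3)[OF ab(2,3)]] vs z] ab by (simp add: t_def)
    qed
    have t_zero: "t z = fzero P \<gamma>" if z: "z \<in> factorizations \<gamma> - F" for z
    proof -
      obtain a b where ab: "z = (a, b)" "composable (base_sg P) a b" "mul (base_sg P) a b = \<gamma>"
        using z by auto
      note f = fact[OF ab(2,3)]
      let ?j = "mul G (d b) h"
      have "u ?j a = fzero P a \<or> v h b = fzero P b"
      proof (rule ccontr)
        assume n: "\<not> ?thesis"
        then have "?j \<in> E" using nzu[OF f(3)] f(1) by blast
        moreover have "(a, b) \<in> nonzero_factorizations (u ?j) (v h) \<gamma>"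
          using n f(1,2) ab by (auto simp: nonzero_factorizations_def nonzero_set_def)
        ultimately show False using z ab by (auto simp: F_def)
      qed
      then show ?thesis
        using mul_fzero[OF ab(2)] sections_mem[OF us[OF f(3)] f(1)] sections_mem[OF vs f(2)] ab
        by (auto simp: t_def)
    qed
    have proj: "homogeneous_projection G Alg grade (?q g) (v h) = w g" if "g \<in> I" for g
      unfolding w_def
      by (rule homogeneous_projection_eq[OF vh grp.quotient_arrow(1)]) (use that h in \<open>simp_all add: I_def\<close>)
    \<comment> \<open>the left side: \<open>w g\<close> is the projection of \<open>v h\<close> to degree \<open>g h\<^sup>-\<^sup>1\<close>\<close>
    have "(u \<otimes>\<^bsub>smash\<^esub> v) h = fsum Alg (\<lambda>g. u g \<otimes>\<^bsub>Alg\<^esub>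
        homogeneous_projection G Alg grade (?q g) (v h)) I"
      using h by (simp add: smash_simps I_def)
    also have "\<dots> = finsum Alg (\<lambda>g. u g \<otimes>\<^bsub>Alg\<^esub>
        homogeneous_projection G Alg grade (?q g) (v h)) E"
    proof (rule Alg.fsum_eq_finsum[OF finE EI])
      show "u g \<otimes>\<^bsub>Alg\<^esub> homogeneous_projection G Alg grade (?q g) (v h) = \<zero>\<^bsub>Alg\<^esub>" if g: "g \<in> I - E" for g
      proof (rule sections_eqI)
        have gI: "g \<in> I" and ug: "u g = \<zero>\<^bsub>Alg\<^esub>" using g by (auto simp: E_def)
        show "u g \<otimes>\<^bsub>Alg\<^esub> homogeneous_projection G Alg grade (?q g) (v h) \<in> sections P"
          using convolution_closed[OF uA[OF gI] wA] Alg_sections proj[OF gI] by simp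
        show "\<zero>\<^bsub>Alg\<^esub> \<in> sections P" using zero_section by simp
        show "(u g \<otimes>\<^bsub>Alg\<^esub> homogeneous_projection G Alg grade (?q g) (v h)) x = \<zero>\<^bsub>Alg\<^esub> x"
          if "x \<in> base" for x
          using convolution_zero[OF us[OF gI] ws that] ug that proj[OF gI] by simp
      qed
      show "(\<lambda>g. u g \<otimes>\<^bsub>Alg\<^esub> homogeneous_projection G Alg grade (?q g) (v h)) \<in> E \<rightarrow> carrier Alg"
        using convolution_closed[OF uA wA] proj EI by (auto simp: subset_iff)
    qed
    also have "\<dots> = finsum Alg (\<lambda>g. convolution P (u g) (w g)) E"
      by (rule Alg.finsum_cong') (use convolution_closed[OF uA wA] proj EI in \<open>auto simp: subset_iff\<close>)
    finally have "(u \<otimes>\<^bsub>smash\<^esub> v) h \<gamma> = finsum (fiber P \<gamma>) (\<lambda>g. convolution P (u g) (w g) \<gamma>) E"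
      using finsum_Alg_eval[OF finE _ \<gamma>, of "\<lambda>g. convolution P (u g) (w g)"]
        convolution_closed[OF uA wA] EI by (simp add: subset_iff)
    also have "\<dots> = finsum (fiber P \<gamma>) (\<lambda>g. finsum (fiber P \<gamma>)
        (\<lambda>z. (\<lambda>(a, b). mul (total_sg P) (u g a) (w g b)) z) F) E"
    proof (rule finsum_cong')
      show "(\<lambda>g. finsum (fiber P \<gamma>) (\<lambda>z. (\<lambda>(a, b). mul (total_sg P) (u g a) (w g b)) z) F) \<in>
          E \<rightarrow> carrier (fiber P \<gamma>)"
        using summand EI by (intro Pi_I finsum_closed) blast
      fix g assume g: "g \<in> E"
      have "nonzero_factorizations (u g) (w g) \<gamma> \<subseteq> nonzero_factorizations (u g) (v h) \<gamma>"
        by (auto simp: nonzero_factorizations_def w_def nonzero_set_restriction)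
      then have "nonzero_factorizations (u g) (w g) \<gamma> \<subseteq> F" using g by (auto simp: F_def)
      then show "convolution P (u g) (w g) \<gamma> = finsum (fiber P \<gamma>)
          (\<lambda>z. (\<lambda>(a, b). mul (total_sg P) (u g a) (w g b)) z) F"
        using convolution_eq[OF us ws \<gamma> finF Ffact] g EI by blast
    qed simp
    also have "\<dots> = finsum (fiber P \<gamma>) (\<lambda>z. finsum (fiber P \<gamma>)
        (\<lambda>g. (\<lambda>(a, b). mul (total_sg P) (u g a) (w g b)) z) E) F"
      by (rule finsum_swap[OF finE finF]) (use summand EI in blast)
    also have "\<dots> = finsum (fiber P \<gamma>) t F"
    proof (rule finsum_cong')
      show "t \<in> F \<rightarrow> carrier (fiber P \<gamma>)" using t_closed Ffact by blast
      fix z assume z: "z \<in> F"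
      obtain a b where ab: "z = (a, b)" "composable (base_sg P) a b" "mul (base_sg P) a b = \<gamma>"
        using z Ffact by blast
      note f = fact[OF ab(2,3)]
      let ?j = "mul G (d b) h"
      have "finsum (fiber P \<gamma>) (\<lambda>g. (\<lambda>(a, b). mul (total_sg P) (u g a) (w g b)) z) E =
          (\<lambda>(a, b). mul (total_sg P) (u ?j a) (w ?j b)) z"
      proof (rule finsum_single[OF finE])
        show "(\<lambda>(a, b). mul (total_sg P) (u g a) (w g b)) z = \<zero>\<^bsub>fiber P \<gamma>\<^esub>" if g: "g \<in> E" "g \<noteq> ?j" for g
        proof -
          have gI: "g \<in> I" using g EI by blast
          then have "w g b = fzero P b" using f(4)[OF gI] g(2) f(2) by (auto simp: w_def restriction_def)
          then show ?thesis
            using mul_fzero(2)[OF ab(2) sections_mem[OF us[OF gI] f(1)]] ab by simp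
        qed
        show "(\<lambda>(a, b). mul (total_sg P) (u ?j a) (w ?j b)) z \<in> carrier (fiber P \<gamma>)"
          by (rule summand[OF f(3) z])
        show "(\<lambda>(a, b). mul (total_sg P) (u ?j a) (w ?j b)) z = \<zero>\<^bsub>fiber P \<gamma>\<^esub>" if "?j \<notin> E"
        proof -
          have "u ?j a = fzero P a" using nzu[OF f(3) _ f(1)] that by blast
          then show ?thesis using mul_fzero(1)[OF ab(2) sections_mem[OF ws f(2)]] ab by simp
        qed
      qed
      also have "w ?j b = v h b" using f(4)[OF f(3)] f(2) by (simp add: w_def restriction_def)
      then have "(\<lambda>(a, b). mul (total_sg P) (u ?j a) (w ?j b)) z = t z" using ab by (simp add: t_def)
      finally show "finsum (fiber P \<gamma>) (\<lambda>g. (\<lambda>(a, b). mul (total_sg P) (u g a) (w g b)) z) E = t z" .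
    qed simp
    finally have lhs: "(u \<otimes>\<^bsub>smash\<^esub> v) h \<gamma> = finsum (fiber P \<gamma>) t F" .
    \<comment> \<open>the right side, reindexed along \<open>skew_factorizations\<close>\<close>
    let ?\<sigma> = "\<lambda>(a, b). ((a, mul G (d b) h), (b, h))"
    let ?T = "\<lambda>(x, y). mul (total_sg skew) (assemble u x) (assemble v y)"
    have T\<sigma>: "?T (?\<sigma> z) = (t z, h)" if z: "z \<in> factorizations \<gamma>" for z
    proof -
      obtain a b where ab: "z = (a, b)" using z by auto
      have "?\<sigma> z \<in> {(x, y). composable (base_sg skew) x y \<and> mul (base_sg skew) x y = (\<gamma>, h)}"
        unfolding skew_factorizations[OF p] using z by blast
      then have "(a, mul G (d b) h) \<in> skew_base" "(b, h) \<in> skew_base"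
        by (auto simp: ab composable_def)
      then show ?thesis
        by (simp add: ab assemble_apply t_def) (simp add: skew_bundle_def skew_product_def)
    qed
    have cl: "(t z, h) \<in> carrier (fiber skew (\<gamma>, h))" if "z \<in> factorizations \<gamma>" for z
      unfolding carrier_skew_fiber[OF p] using t_closed[OF that] by blast
    have "convolution skew (assemble u) (assemble v) (\<gamma>, h) =
        fsum (fiber skew (\<gamma>, h)) ?T (?\<sigma> ` factorizations \<gamma>)"
      using p by (simp add: convolution_def skew_factorizations[OF p])
    also have "\<dots> = finsum (fiber skew (\<gamma>, h)) ?T (?\<sigma> ` F)"
    proof (rule K.fsum_eq_finsum)
      show "finite (?\<sigma> ` F)" using finF by simp
      show "?\<sigma> ` F \<subseteq> ?\<sigma> ` factorizations \<gamma>" using Ffact by (rule image_mono)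
      fix y assume "y \<in> ?\<sigma> ` factorizations \<gamma> - ?\<sigma> ` F"
      then obtain z where z: "y = ?\<sigma> z" "z \<in> factorizations \<gamma> - F" by blast
      then have "?T y = (t z, h)" using T\<sigma> by blast
      then show "?T y = \<zero>\<^bsub>fiber skew (\<gamma>, h)\<^esub>" using t_zero[OF z(2)] by simp
    next
      show "?T \<in> ?\<sigma> ` F \<rightarrow> carrier (fiber skew (\<gamma>, h))"
      proof
        fix y assume "y \<in> ?\<sigma> ` F"
        then obtain z where z: "y = ?\<sigma> z" "z \<in> F" by blast
        then show "?T y \<in> carrier (fiber skew (\<gamma>, h))" using T\<sigma>[of z] cl[of z] Ffact by auto
      qed
    qed
    also have "\<dots> = finsum (fiber skew (\<gamma>, h)) (\<lambda>z. ?T (?\<sigma> z)) F"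
    proof (rule K.finsum_reindex)
      show "?T \<in> ?\<sigma> ` F \<rightarrow> carrier (fiber skew (\<gamma>, h))"
      proof
        fix y assume "y \<in> ?\<sigma> ` F"
        then obtain z where z: "y = ?\<sigma> z" "z \<in> F" by blast
        then show "?T y \<in> carrier (fiber skew (\<gamma>, h))" using T\<sigma>[of z] cl[of z] Ffact by auto
      qed
      show "inj_on ?\<sigma> F" by (auto simp: inj_on_def)
    qed
    also have "\<dots> = finsum (fiber skew (\<gamma>, h)) (\<lambda>z. (t z, h)) F"
    proof (rule K.finsum_cong')
      show "(\<lambda>z. (t z, h)) \<in> F \<rightarrow> carrier (fiber skew (\<gamma>, h))" using cl Ffact by blast
      show "?T (?\<sigma> z) = (t z, h)" if "z \<in> F" for z by (rule T\<sigma>) (use that Ffact in blast)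
    qed simp
    also have "\<dots> = (finsum (fiber P \<gamma>) t F, h)"
      by (rule finsum_skew_fiber[OF p finF t_closed]) (use Ffact in blast)
    finally show ?thesis using lhs assemble_apply[OF p] by simp
  qed
  have "assemble (u \<otimes>\<^bsub>smash\<^esub> v) z = convolution skew (assemble u) (assemble v) z" for z
  proof (cases "z \<in> skew_base")
    case True
    then show ?thesis using point by (cases z) simp
  next
    case False
    then show ?thesis by (simp add: assemble_def convolution_def)
  qed
  then show ?thesis by auto
qed

lemma assemble_graded:
  assumes x: "x \<in> smash_grading G Alg grade g"
  shows "assemble x \<in> Sk.grade g"
proof (rule additive_span_image_subset[where \<phi> = assemble, OF smash_abelian_group Sk.Alg_abelian_group
      _ _ _ _ _ _ x[unfolded smash_grading_def]])
  interpret S: abelian_group smash by (rule smash_abelian_group)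
  show "subgroup (carrier smash) (add_monoid smash)" using S.add.subgroup_self by simp
  show "{smash_delta G Alg a h | a h. a \<in> grade g \<and> h \<in> arrows G \<and> rng G h = src G g} \<subseteq> carrier smash"
  proof
    fix y assume "y \<in> {smash_delta G Alg a h | a h. a \<in> grade g \<and> h \<in> arrows G \<and> rng G h = src G g}"
    then obtain a h where "y = smash_delta G Alg a h" "a \<in> grade g" "rng G h = src G g" by blast
    then show "y \<in> carrier smash"
      using smash_delta_carrier[of a h] by (auto simp: smash_coefficients_eq sectional_grading_eq)
  qed
  show "assemble x \<in> carrier Sk.Alg" if "x \<in> carrier smash" for x by (rule assemble_Alg[OF that])
  show "assemble (x \<oplus>\<^bsub>smash\<^esub> y) = assemble x \<oplus>\<^bsub>Sk.Alg\<^esub> assemble y" for x y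
    unfolding smash_simps(3) by (rule assemble_add)
  show "subgroup (Sk.grade g) (add_monoid Sk.Alg)"
    unfolding Sk.sectional_grading_eq by (rule Sk.support_in_subgroup)
  fix y assume "y \<in> {smash_delta G Alg a h | a h. a \<in> grade g \<and> h \<in> arrows G \<and> rng G h = src G g}"
  then obtain a h where y: "y = smash_delta G Alg a h" "a \<in> grade g" "h \<in> arrows G" by blast
  then have a: "a \<in> carrier Alg" "nonzero_set P a \<subseteq> {\<gamma> \<in> base. d \<gamma> = g}"
    by (simp_all add: sectional_grading_eq)
  show "assemble y \<in> Sk.grade g"
    unfolding y(1) assemble_smash_delta[OF y(3)] Sk.sectional_grading_eq
    using insertion_Alg[OF a(1) y(3)] a(2) by (auto simp: nonzero_set_insertion skew_grading_def)
qed

theorem assemble_graded_isomorphism: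
  "graded_isomorphism G smash (smash_grading G Alg grade) Sk.Alg Sk.grade assemble"
  unfolding graded_isomorphism_def algebra_hom_def
proof (intro conjI ballI allI)
  show "assemble \<in> carrier smash \<rightarrow> carrier Sk.Alg" by (intro Pi_I assemble_Alg)
  show "bij_betw assemble (carrier smash) (carrier Sk.Alg)"
    unfolding bij_betw_def
    using assemble_inj assemble_surj assemble_Alg by (intro conjI subset_antisym subsetI) auto
  show "assemble (x \<oplus>\<^bsub>smash\<^esub> y) = assemble x \<oplus>\<^bsub>Sk.Alg\<^esub> assemble y" for x y
    unfolding smash_simps(3) by (rule assemble_add)
  show "assemble ` smash_grading G Alg grade g \<subseteq> Sk.grade g" for g
    using assemble_graded by (rule image_subsetI)
qed (rule assemble_act | erule (1) assemble_mult)+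

end

theorem theorem5p16:
  fixes \<pi> :: "('l, 'x, 'g, 'v, 'r::unital_topological_ring) bundle_data"
    and G :: "('h, 'w) semigroupoid"
    and d :: "'g \<Rightarrow> 'h"
  assumes "continuous_R_bundle \<pi>"
    and "etale_semigroupoid (base_sg \<pi>)"
    and "locally_in (R_normal TYPE('r)) (arrow_top (base_sg \<pi>))"
    and "groupoid G"
    and "semigroupoid_hom (base_sg \<pi>) G d"
    and "continuous_map (arrow_top (base_sg \<pi>)) (discrete_topology (arrows G)) d"
  shows "\<exists>T :: ('h \<Rightarrow> 'g \<Rightarrow> 'l) \<Rightarrow> ('g \<times> 'h \<Rightarrow> 'l \<times> 'h).
    graded_isomorphism G
      (smash_product G (sectional_algebra \<pi>) (sectional_grading \<pi> d))
      (smash_grading G (sectional_algebra \<pi>) (sectional_grading \<pi> d))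
      (sectional_algebra (skew_bundle \<pi> d G))
      (sectional_grading (skew_bundle \<pi> d G) (skew_grading d))
      T \<and>
    (\<forall>g\<in>arrows G.
       \<forall>\<alpha>\<in>smash_coefficients G (sectional_algebra \<pi>) (sectional_grading \<pi> d) g.
       \<forall>(\<gamma>, h)\<in>arrows (skew_product (base_sg \<pi>) d G).
         T (smash_delta G (sectional_algebra \<pi>) \<alpha> g) (\<gamma>, h) =
           (if g = h then (\<alpha> \<gamma>, g) else (fzero \<pi> \<gamma>, h)))"
proof -
  interpret continuous_R_bundle \<pi> by (rule assms(1))
  interpret etale_R_bundle \<pi>
    by (intro etale_R_bundle.intro etale_R_bundle_axioms.intro assms)
  interpret graded_R_bundle \<pi> G d
    by (intro graded_R_bundle.intro graded_bundle.intro graded_bundle_axioms.intro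
        graded_R_bundle_axioms.intro bimodule_bundle_axioms etale_R_bundle_axioms assms)
  show ?thesis
  proof (intro exI[of _ assemble] conjI assemble_graded_isomorphism ballI)
    fix g \<alpha> p assume g: "g \<in> arrows G" and "p \<in> arrows (skew_product (base_sg \<pi>) d G)"
    then obtain \<gamma> h where p: "p = (\<gamma>, h)" "(\<gamma>, h) \<in> skew_base"
      by (cases p) (auto simp: skew_product_def)
    then show "case p of (\<gamma>, h) \<Rightarrow> assemble (smash_delta G Alg \<alpha> g) (\<gamma>, h) =
        (if g = h then (\<alpha> \<gamma>, g) else (fzero \<pi> \<gamma>, h))"
      unfolding assemble_smash_delta[OF g] by (auto simp: insertion_def)
  qed
qed

end
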